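(* There is a constant $c > 0$ such that for every prime $p$ with $p \equiv 1 \pmod 4$, the value of the degree 4 sum-of-squares relaxation of the clique number of the Paley graph $G_p$ satisfies $\mathrm{SOS}_4(G_p) \geq c\, p^{1/3}$.
   Context: For a prime $p \equiv 1 \pmod 4$, the Paley graph $G_p$ has vertex set $\mathbb{F}_p$, with distinct $a,b$ adjacent iff $a-b$ is a nonzero square in $\mathbb{F}_p$. For a graph $G$ on vertex set $V$, $\mathrm{SOS}_4(G)$ is the maximum of $\sum_{i\in V}\widetilde{\mathbb{E}}[x_i]$ over all linear functionals $\widetilde{\mathbb{E}}$ on the real polynomials of degree at most $4$ in variables $(x_i)_{i\in V}$ such that: $\widetilde{\mathbb{E}}[1]=1$; $\widetilde{\mathbb{E}}[(x_i^2-x_i)q]=0$ for all $i\in V$ and all polynomials $q$ of degree at most $2$; $\widetilde{\mathbb{E}}[x_ix_jq]=0$ for all distinct non-adjacent $i,j$ and all $q$ of degree at most $2$; and $\widetilde{\mathbb{E}}[q^2]\geq 0$ for all polynomials $q$ of degree at most $2$. *)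

theory Defs
  imports
    "HOL-Analysis.Analysis"
    "HOL-Library.Poly_Mapping"
    "HOL-Number_Theory.Number_Theory"
begin

text \<open>
  Real polynomials in variables indexed by \<open>'v\<close> are finitely supported maps from exponent vectors
  to coefficients; their product is the convolution product of \<^theory>\<open>HOL-Library.Poly_Mapping\<close>.
\<close>

type_synonym 'v mpoly = "('v \<Rightarrow>\<^sub>0 nat) \<Rightarrow>\<^sub>0 real"

definition const_poly :: "real \<Rightarrow> 'v mpoly" where
  "const_poly c = Poly_Mapping.single 0 c"

definition var_poly :: "'v \<Rightarrow> 'v mpoly" where
  "var_poly i = Poly_Mapping.single (Poly_Mapping.single i 1) 1"

definition mon_degree :: "('v \<Rightarrow>\<^sub>0 nat) \<Rightarrow> nat" where
  "mon_degree m = (\<Sum>i\<in>Poly_Mapping.keys m. Poly_Mapping.lookup m i)"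

definition polys_upto :: "'v set \<Rightarrow> nat \<Rightarrow> 'v mpoly set" where
  "polys_upto V d =
     {f. \<forall>m\<in>Poly_Mapping.keys f. Poly_Mapping.keys m \<subseteq> V \<and> mon_degree m \<le> d}"

text \<open>
  Only the values of \<open>E\<close> on \<open>polys_upto V 4\<close> are constrained, and only they matter.
\<close>

definition linear_functional_upto :: "'v set \<Rightarrow> nat \<Rightarrow> ('v mpoly \<Rightarrow> real) \<Rightarrow> bool" where
  "linear_functional_upto V d E \<longleftrightarrow>
     (\<forall>f\<in>polys_upto V d. \<forall>g\<in>polys_upto V d. E (f + g) = E f + E g) \<and>
     (\<forall>c. \<forall>f\<in>polys_upto V d. E (const_poly c * f) = c * E f)"

definition sos4_feasible :: "'v set \<Rightarrow> ('v \<Rightarrow> 'v \<Rightarrow> bool) \<Rightarrow> ('v mpoly \<Rightarrow> real) \<Rightarrow> bool" where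
  "sos4_feasible V adj E \<longleftrightarrow>
     linear_functional_upto V 4 E \<and>
     E 1 = 1 \<and>
     (\<forall>i\<in>V. \<forall>q\<in>polys_upto V 2. E ((var_poly i ^ 2 - var_poly i) * q) = 0) \<and>
     (\<forall>i\<in>V. \<forall>j\<in>V. i \<noteq> j \<and> \<not> adj i j \<longrightarrow>
        (\<forall>q\<in>polys_upto V 2. E (var_poly i * var_poly j * q) = 0)) \<and>
     (\<forall>q\<in>polys_upto V 2. E (q ^ 2) \<ge> 0)"

text \<open>
  The supremum is a maximum whenever \<open>V\<close> is finite: see \<open>SOS4_is_maximum\<close> below.
\<close>

definition SOS4 :: "'v set \<Rightarrow> ('v \<Rightarrow> 'v \<Rightarrow> bool) \<Rightarrow> real" where
  "SOS4 V adj = Sup {\<Sum>i\<in>V. E (var_poly i) | E. sos4_feasible V adj E}"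

text \<open>
  The field of order \<open>p\<close> is represented by the integers \<open>0, \<dots>, p - 1\<close> modulo \<open>p\<close>.
\<close>

definition paley_vertices :: "nat \<Rightarrow> int set" where
  "paley_vertices p = {0..<int p}"

definition paley_adj :: "nat \<Rightarrow> int \<Rightarrow> int \<Rightarrow> bool" where
  "paley_adj p a b \<longleftrightarrow> \<not> [a - b = 0] (mod int p) \<and> QuadRes (int p) (a - b)"


lemma mon_degree_superset:
  assumes "finite A" "Poly_Mapping.keys m \<subseteq> A"
  shows "mon_degree m = (\<Sum>i\<in>A. Poly_Mapping.lookup m i)"
  unfolding mon_degree_def using assms
  by (intro sum.mono_neutral_left) (auto simp: in_keys_iff)

lemma keys_add_nat:
  "Poly_Mapping.keys (a + b) = Poly_Mapping.keys a \<union> Poly_Mapping.keys (b :: 'v \<Rightarrow>\<^sub>0 nat)"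
  by (auto simp: in_keys_iff lookup_add)

lemma mon_degree_add: "mon_degree (a + b) = mon_degree a + mon_degree b"
proof -
  let ?A = "Poly_Mapping.keys a \<union> Poly_Mapping.keys b"
  have "mon_degree (a + b) = (\<Sum>i\<in>?A. Poly_Mapping.lookup (a + b) i)"
    by (rule mon_degree_superset) (auto simp: keys_add_nat)
  also have "\<dots> = (\<Sum>i\<in>?A. Poly_Mapping.lookup a i) + (\<Sum>i\<in>?A. Poly_Mapping.lookup b i)"
    by (simp add: lookup_add sum.distrib)
  also have "\<dots> = mon_degree a + mon_degree b"
    by (simp add: mon_degree_superset[of ?A])
  finally show ?thesis .
qed

lemma mon_degree_0 [simp]: "mon_degree 0 = 0"
  by (simp add: mon_degree_def)

lemma mon_degree_single [simp]: "mon_degree (Poly_Mapping.single i n) = n"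
  by (simp add: mon_degree_def)

lemma polys_upto_add: "f \<in> polys_upto V d \<Longrightarrow> g \<in> polys_upto V d \<Longrightarrow> f + g \<in> polys_upto V d"
  using Poly_Mapping.keys_add[of f g] by (fastforce simp: polys_upto_def)

lemma polys_upto_mult:
  assumes "f \<in> polys_upto V d" "g \<in> polys_upto V e"
  shows "f * g \<in> polys_upto V (d + e)"
proof -
  have "Poly_Mapping.keys m \<subseteq> V \<and> mon_degree m \<le> d + e" if m: "m \<in> Poly_Mapping.keys (f * g)" for m
  proof -
    obtain a b where "m = a + b" "a \<in> Poly_Mapping.keys f" "b \<in> Poly_Mapping.keys g"
      using keys_mult[of f g] m by blast
    then show ?thesis
      using assms by (auto simp: polys_upto_def mon_degree_add keys_add_nat intro!: add_mono)
  qed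
  then show ?thesis by (auto simp: polys_upto_def)
qed

lemma polys_upto_mono: "f \<in> polys_upto V d \<Longrightarrow> d \<le> e \<Longrightarrow> f \<in> polys_upto V e"
  by (fastforce simp: polys_upto_def)

lemma const_poly_upto: "const_poly c \<in> polys_upto V d"
  by (simp add: const_poly_def polys_upto_def)

lemma one_upto: "1 \<in> polys_upto V d"
  by (simp add: polys_upto_def)

lemma zero_upto: "0 \<in> polys_upto V d"
  by (simp add: polys_upto_def)

lemma monomial_upto:
  "Poly_Mapping.keys m \<subseteq> V \<Longrightarrow> mon_degree m \<le> d \<Longrightarrow> Poly_Mapping.single m c \<in> polys_upto V d"
  by (simp add: polys_upto_def)

lemma var_upto: "i \<in> V \<Longrightarrow> 1 \<le> d \<Longrightarrow> var_poly i \<in> polys_upto V d"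
  unfolding var_poly_def by (rule monomial_upto) auto

lemma scale_upto: "f \<in> polys_upto V d \<Longrightarrow> const_poly c * f \<in> polys_upto V d"
  using polys_upto_mult[OF const_poly_upto[of c V 0], of f d] by simp

lemma uminus_upto: "f \<in> polys_upto V d \<Longrightarrow> - f \<in> polys_upto V d"
  by (simp add: polys_upto_def in_keys_iff)

lemma diff_upto: "f \<in> polys_upto V d \<Longrightarrow> g \<in> polys_upto V d \<Longrightarrow> f - g \<in> polys_upto V d"
  using polys_upto_add[of f V d "- g"] uminus_upto[of g V d] by simp

lemma functional_add:
  "linear_functional_upto V d E \<Longrightarrow> f \<in> polys_upto V d \<Longrightarrow> g \<in> polys_upto V d \<Longrightarrow>
     E (f + g) = E f + E g"
  by (simp add: linear_functional_upto_def)

lemma functional_scale: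
  "linear_functional_upto V d E \<Longrightarrow> f \<in> polys_upto V d \<Longrightarrow> E (const_poly c * f) = c * E f"
  by (simp add: linear_functional_upto_def)

lemma functional_diff:
  assumes "linear_functional_upto V d E" "f \<in> polys_upto V d" "g \<in> polys_upto V d"
  shows "E (f - g) = E f - E g"
  using functional_add[OF assms(1) diff_upto[OF assms(2,3)] assms(3)] by simp

lemma functional_0: "linear_functional_upto V d E \<Longrightarrow> E 0 = 0"
  using functional_scale[of V d E 0 0] by (simp add: zero_upto)

lemma poly_as_sum:
  "f = (\<Sum>m\<in>Poly_Mapping.keys f. Poly_Mapping.single m (Poly_Mapping.lookup f m))"
proof (rule poly_mapping_eqI)
  fix k
  show "Poly_Mapping.lookup f k =
    Poly_Mapping.lookup (\<Sum>m\<in>Poly_Mapping.keys f. Poly_Mapping.single m (Poly_Mapping.lookup f m)) k"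
    by (simp add: lookup_sum lookup_single when_def sum.delta' in_keys_iff)
qed

lemma functional_sum:
  assumes E: "linear_functional_upto V d E" and "\<And>x. x \<in> A \<Longrightarrow> g x \<in> polys_upto V d"
  shows "E (sum g A) = (\<Sum>x\<in>A. E (g x))"
proof (cases "finite A")
  case True
  have "B \<subseteq> A \<Longrightarrow> sum g B \<in> polys_upto V d \<and> E (sum g B) = (\<Sum>x\<in>B. E (g x))" if "finite B" for B
    using that
  proof (induction B rule: finite_induct)
    case empty
    then show ?case by (simp add: zero_upto functional_0[OF E])
  next
    case (insert x B)
    then show ?case using assms(2)[of x] by (simp add: functional_add[OF E] polys_upto_add)
  qed
  from this[OF True] show ?thesis by simp
qed (simp add: functional_0[OF E])

lemma mon_split:
  "mon_degree m \<le> a + b \<Longrightarrow> \<exists>u v. m = u + v \<and> mon_degree u \<le> a \<and> mon_degree v \<le> b"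
proof (induction b arbitrary: m)
  case 0
  then show ?case by (intro exI[of _ m] exI[of _ 0]) simp
next
  case (Suc b)
  show ?case
  proof (cases "m = 0")
    case True
    then show ?thesis by (intro exI[of _ 0]) simp
  next
    case False
    then obtain i where i: "Poly_Mapping.lookup m i > 0"
      by (metis gr0I lookup_zero poly_mapping_eqI)
    define n where "n = m - Poly_Mapping.single i 1"
    have m: "m = n + Poly_Mapping.single i 1"
      by (rule poly_mapping_eqI) (use i in \<open>auto simp: n_def lookup_add lookup_minus lookup_single when_def\<close>)
    then have "mon_degree n \<le> a + b"
      using Suc.prems by (simp add: mon_degree_add)
    then obtain u v where uv: "n = u + v" "mon_degree u \<le> a" "mon_degree v \<le> b"
      using Suc.IH by blast
    show ?thesis
      by (intro exI[of _ u] exI[of _ "v + Poly_Mapping.single i 1"])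
         (use uv m in \<open>auto simp: mon_degree_add add.assoc\<close>)
  qed
qed

lemma mon_degree_le_1: "mon_degree m \<le> 1 \<Longrightarrow> m = 0 \<or> (\<exists>i. m = Poly_Mapping.single i 1)"
proof -
  assume le: "mon_degree m \<le> 1"
  show ?thesis
  proof (cases "m = 0")
    case False
    then obtain i where i: "Poly_Mapping.lookup m i > 0"
      by (metis gr0I lookup_zero poly_mapping_eqI)
    define n where "n = m - Poly_Mapping.single i 1"
    have m: "m = n + Poly_Mapping.single i 1"
      by (rule poly_mapping_eqI) (use i in \<open>auto simp: n_def lookup_add lookup_minus lookup_single when_def\<close>)
    then have "mon_degree n = 0"
      using le by (simp add: mon_degree_add)
    then have "n = 0"
      unfolding mon_degree_def by (intro poly_mapping_eqI) (auto simp: in_keys_iff)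
    with m show ?thesis by auto
  qed simp
qed

lemma feasible_mult_bound:
  assumes F: "sos4_feasible V adj E" and u: "u \<in> polys_upto V 2" and v: "v \<in> polys_upto V 2"
  shows "2 * \<bar>E (u * v)\<bar> \<le> E (u ^ 2) + E (v ^ 2)"
proof -
  have L: "linear_functional_upto V 4 E" and P: "\<And>q. q \<in> polys_upto V 2 \<Longrightarrow> E (q ^ 2) \<ge> 0"
    using F by (auto simp: sos4_feasible_def)
  have in4: "a * b \<in> polys_upto V 4" if "a \<in> polys_upto V 2" "b \<in> polys_upto V 2" for a b
    using polys_upto_mult[OF that] by simp
  have sq: "u ^ 2 \<in> polys_upto V 4" "v ^ 2 \<in> polys_upto V 4"
    using in4 u v by (auto simp: power2_eq_square)
  have uv: "u * v \<in> polys_upto V 4" using in4 u v by simp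
  have "(u + v) ^ 2 = u ^ 2 + v ^ 2 + (u * v + u * v)"
    by (simp add: power2_eq_square algebra_simps)
  then have "E ((u + v) ^ 2) = E (u ^ 2) + E (v ^ 2) + (E (u * v) + E (u * v))"
    by (simp only: functional_add[OF L] polys_upto_add sq uv)
  moreover have "(u - v) ^ 2 = u ^ 2 + v ^ 2 - (u * v + u * v)"
    by (simp add: power2_eq_square algebra_simps)
  then have "E ((u - v) ^ 2) = E (u ^ 2) + E (v ^ 2) - (E (u * v) + E (u * v))"
    by (simp only: functional_add[OF L] functional_diff[OF L] polys_upto_add sq uv)
  ultimately show ?thesis
    using P[OF polys_upto_add[OF u v]] P[OF diff_upto[OF u v]] by linarith
qed

lemma feasible_var:
  assumes F: "sos4_feasible V adj E" and i: "i \<in> V"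
  shows "E (var_poly i ^ 2) = E (var_poly i)" "0 \<le> E (var_poly i)" "E (var_poly i) \<le> 1"
proof -
  have L: "linear_functional_upto V 4 E" and P: "\<And>q. q \<in> polys_upto V 2 \<Longrightarrow> E (q ^ 2) \<ge> 0"
    and one: "E 1 = 1" and B: "\<And>q. q \<in> polys_upto V 2 \<Longrightarrow> E ((var_poly i ^ 2 - var_poly i) * q) = 0"
    using F i by (auto simp: sos4_feasible_def)
  have v2: "var_poly i \<in> polys_upto V 2" and v4: "var_poly i \<in> polys_upto V 4"
    using i by (auto intro: var_upto)
  have vv: "var_poly i ^ 2 \<in> polys_upto V 4"
    using polys_upto_mult[OF v2 v2] by (simp add: power2_eq_square)
  show eq: "E (var_poly i ^ 2) = E (var_poly i)"
    using B[OF one_upto] by (simp add: functional_diff[OF L vv v4])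
  show "0 \<le> E (var_poly i)" using P[OF v2] eq by simp
  have "2 * \<bar>E (var_poly i * 1)\<bar> \<le> E (var_poly i ^ 2) + E (1 ^ 2)"
    by (rule feasible_mult_bound[OF F v2 one_upto])
  then show "E (var_poly i) \<le> 1" using eq one by simp
qed

lemma feasible_monomial_square:
  assumes F: "sos4_feasible V adj E" and k: "Poly_Mapping.keys u \<subseteq> V" and d: "mon_degree u \<le> 2"
  shows "E (Poly_Mapping.single u 1 ^ 2) \<le> 1"
proof -
  have L: "linear_functional_upto V 4 E" and one: "E 1 = 1"
    and B: "\<And>i q. i \<in> V \<Longrightarrow> q \<in> polys_upto V 2 \<Longrightarrow> E ((var_poly i ^ 2 - var_poly i) * q) = 0"
    using F by (auto simp: sos4_feasible_def)
  obtain a b where ab: "u = a + b" "mon_degree a \<le> 1" "mon_degree b \<le> 1"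
    using mon_split[of u 1 1] d by auto
  have kab: "Poly_Mapping.keys a \<subseteq> V" "Poly_Mapping.keys b \<subseteq> V"
    using k ab by (auto simp: keys_add_nat)
  have s: "Poly_Mapping.single u 1 = Poly_Mapping.single a 1 * (Poly_Mapping.single b 1 :: 'a mpoly)"
    by (simp add: mult_single ab)
  have A: "Poly_Mapping.single a 1 = (1 :: 'a mpoly) \<or> (\<exists>i\<in>V. Poly_Mapping.single a 1 = var_poly i)"
    using mon_degree_le_1[OF ab(2)] kab by (auto simp: var_poly_def)
  have B': "Poly_Mapping.single b 1 = (1 :: 'a mpoly) \<or> (\<exists>i\<in>V. Poly_Mapping.single b 1 = var_poly i)"
    using mon_degree_le_1[OF ab(3)] kab by (auto simp: var_poly_def)
  have var: "E (var_poly i ^ 2) \<le> 1" if "i \<in> V" for i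
    using feasible_var[OF F that] by simp
  have two: "E ((var_poly i * var_poly j) ^ 2) \<le> 1" if i: "i \<in> V" and j: "j \<in> V" for i j
  proof -
    have vi: "var_poly i \<in> polys_upto V 1" "var_poly i \<in> polys_upto V 2"
      and vj: "var_poly j \<in> polys_upto V 1" "var_poly j \<in> polys_upto V 2"
      using i j by (auto intro: var_upto)
    have ij: "var_poly i * var_poly j \<in> polys_upto V 2" "var_poly j ^ 2 \<in> polys_upto V 2"
      "var_poly i ^ 2 \<in> polys_upto V 2"
      using polys_upto_mult[OF vi(1) vj(1)] polys_upto_mult[OF vj(1) vj(1)] polys_upto_mult[OF vi(1) vi(1)]
      by (auto simp: power2_eq_square numeral_2_eq_2)
    have in4: "x * y \<in> polys_upto V 4" if "x \<in> polys_upto V 2" "y \<in> polys_upto V 2" for x y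
      using polys_upto_mult[OF that] by simp
    have "E (var_poly i ^ 2 * var_poly j ^ 2) - E (var_poly i * var_poly j ^ 2) = 0"
      using B[OF i ij(2)] functional_diff[OF L in4[OF ij(3) ij(2)] in4[OF vi(2) ij(2)]]
      by (simp add: left_diff_distrib)
    moreover have "E (var_poly j ^ 2 * var_poly i) - E (var_poly j * var_poly i) = 0"
      using B[OF j vi(2)] functional_diff[OF L in4[OF ij(2) vi(2)] in4[OF vj(2) vi(2)]]
      by (simp add: left_diff_distrib)
    ultimately have "E ((var_poly i * var_poly j) ^ 2) = E (var_poly i * var_poly j)"
      by (simp add: power_mult_distrib mult.commute)
    then show ?thesis
      using feasible_mult_bound[OF F vi(2) vj(2)] var[OF i] var[OF j] by linarith
  qed
  show ?thesis
    using A B' one var two unfolding s by auto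
qed

lemma feasible_bound:
  assumes F: "sos4_feasible V adj E" and f: "f \<in> polys_upto V 4"
  shows "\<bar>E f\<bar> \<le> (\<Sum>m\<in>Poly_Mapping.keys f. \<bar>Poly_Mapping.lookup f m\<bar>)"
proof -
  have L: "linear_functional_upto V 4 E"
    using F by (auto simp: sos4_feasible_def)
  have k: "Poly_Mapping.keys m \<subseteq> V" "mon_degree m \<le> 4" if "m \<in> Poly_Mapping.keys f" for m
    using f that by (auto simp: polys_upto_def)
  have one: "\<bar>E (Poly_Mapping.single m 1)\<bar> \<le> 1" if m: "m \<in> Poly_Mapping.keys f" for m
  proof -
    obtain u v where uv: "m = u + v" "mon_degree u \<le> 2" "mon_degree v \<le> 2"
      using mon_split[of m 2 2] k(2)[OF m] by auto
    have kuv: "Poly_Mapping.keys u \<subseteq> V" "Poly_Mapping.keys v \<subseteq> V"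
      using k(1)[OF m] uv by (auto simp: keys_add_nat)
    have "2 * \<bar>E (Poly_Mapping.single u 1 * Poly_Mapping.single v 1)\<bar>
        \<le> E (Poly_Mapping.single u 1 ^ 2) + E (Poly_Mapping.single v 1 ^ 2)"
      by (rule feasible_mult_bound[OF F monomial_upto monomial_upto]) (use kuv uv in auto)
    also have "\<dots> \<le> 1 + 1"
      by (intro add_mono feasible_monomial_square[OF F] kuv uv)
    finally show ?thesis by (simp add: mult_single uv)
  qed
  have "E f = (\<Sum>m\<in>Poly_Mapping.keys f. E (Poly_Mapping.single m (Poly_Mapping.lookup f m)))"
    by (subst poly_as_sum, rule functional_sum[OF L]) (use k in \<open>auto intro: monomial_upto\<close>)
  also have "\<dots> = (\<Sum>m\<in>Poly_Mapping.keys f. Poly_Mapping.lookup f m * E (Poly_Mapping.single m 1))"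
  proof (rule sum.cong[OF refl])
    fix m assume "m \<in> Poly_Mapping.keys f"
    then have "Poly_Mapping.single m 1 \<in> polys_upto V 4" using k by (auto intro: monomial_upto)
    from functional_scale[OF L this, of "Poly_Mapping.lookup f m"]
    show "E (Poly_Mapping.single m (Poly_Mapping.lookup f m)) =
      Poly_Mapping.lookup f m * E (Poly_Mapping.single m 1)"
      by (simp add: const_poly_def mult_single)
  qed
  also have "\<bar>\<dots>\<bar> \<le> (\<Sum>m\<in>Poly_Mapping.keys f. \<bar>Poly_Mapping.lookup f m * E (Poly_Mapping.single m 1)\<bar>)"
    by (rule sum_abs)
  also have "\<dots> \<le> (\<Sum>m\<in>Poly_Mapping.keys f. \<bar>Poly_Mapping.lookup f m\<bar>)"
    by (intro sum_mono) (auto simp: abs_mult intro: mult_left_le one)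
  finally show ?thesis .
qed

lemma lookup_mult_0:
  fixes f g :: "'v mpoly"
  shows "Poly_Mapping.lookup (f * g) 0 = Poly_Mapping.lookup f 0 * Poly_Mapping.lookup g 0"
proof -
  have z: "(0 = k + l) = (k = 0 \<and> l = 0)" for k l :: "'v \<Rightarrow>\<^sub>0 nat"
    by (auto simp: poly_mapping_eq_iff fun_eq_iff lookup_add)
  show ?thesis
    by (simp add: lookup_mult z mult_when flip: when_when)
qed

lemma feasible_eval_0: "sos4_feasible V adj (\<lambda>f. Poly_Mapping.lookup f 0)"
proof -
  have v: "Poly_Mapping.lookup (var_poly i) 0 = 0" for i :: 'a
    by (simp add: var_poly_def lookup_single when_def poly_mapping_eq_iff fun_eq_iff)
  show ?thesis
    by (auto simp: sos4_feasible_def linear_functional_upto_def lookup_add lookup_mult_0 const_poly_def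
        lookup_minus v power2_eq_square)
qed

lemma feasible_cong:
  assumes F: "sos4_feasible V adj E" and eq: "\<And>f. f \<in> polys_upto V 4 \<Longrightarrow> E' f = E f"
  shows "sos4_feasible V adj E'"
proof -
  have in4: "x * y \<in> polys_upto V 4" if "x \<in> polys_upto V 2" "y \<in> polys_upto V 2" for x y :: "'a mpoly"
    using polys_upto_mult[OF that] by simp
  have vv: "var_poly i * var_poly j \<in> polys_upto V 2" if "i \<in> V" "j \<in> V" for i j :: 'a
    using polys_upto_mult[OF var_upto[of i V 1] var_upto[of j V 1]] that by (simp add: numeral_2_eq_2)
  have vd: "var_poly i ^ 2 - var_poly i \<in> polys_upto V 2" if "i \<in> V" for i :: 'a
    using vv[OF that that] var_upto[OF that, of 2] by (simp add: power2_eq_square diff_upto)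
  show ?thesis
    using F unfolding sos4_feasible_def linear_functional_upto_def
    by (simp add: eq in4 vv vd one_upto scale_upto polys_upto_add power2_eq_square[of "_ :: 'a mpoly"]
        del: power2_eq_square) (simp add: eq in4 vd flip: power2_eq_square)
qed

lemma SOS4_is_maximum:
  assumes "finite V"
  obtains E where "sos4_feasible V adj E" "(\<Sum>i\<in>V. E (var_poly i)) = SOS4 V adj"
    "\<And>E'. sos4_feasible V adj E' \<Longrightarrow> (\<Sum>i\<in>V. E' (var_poly i)) \<le> SOS4 V adj"
proof -
  define B where "B f = (if f \<in> polys_upto V 4 then
     {- (\<Sum>m\<in>Poly_Mapping.keys f. \<bar>Poly_Mapping.lookup f m\<bar>) ..
      (\<Sum>m\<in>Poly_Mapping.keys f. \<bar>Poly_Mapping.lookup f m\<bar>)} else {0})" for f :: "'a mpoly"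
  define K where "K = PiE UNIV B"
  define S where "S = {E. sos4_feasible V adj E}"
  have "compactin (product_topology (\<lambda>_. euclidean) UNIV) K"
    unfolding K_def by (subst compactin_PiE) (auto simp: B_def)
  then have K: "compact K"
    by (simp add: euclidean_product_topology)
  have ev: "continuous_on UNIV (\<lambda>E :: 'a mpoly \<Rightarrow> real. E f)" for f
    by simp
  have "closed S"
    unfolding S_def sos4_feasible_def linear_functional_upto_def Ball_def
    by (intro closed_Collect_conj closed_Collect_all closed_Collect_imp open_Collect_const
        closed_Collect_eq closed_Collect_le continuous_intros ev)
  then have C: "compact (S \<inter> K)"
    using K compact_Int_closed[of K S] by (simp add: Int_commute)
  have restr: "(\<lambda>f. if f \<in> polys_upto V 4 then E f else 0) \<in> S \<inter> K" if "sos4_feasible V adj E" for E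
    using feasible_cong[OF that, of "\<lambda>f. if f \<in> polys_upto V 4 then E f else 0"]
      feasible_bound[OF that] by (auto simp: S_def K_def B_def abs_le_iff minus_le_iff)
  have "S \<inter> K \<noteq> {}"
    using restr[OF feasible_eval_0] by blast
  then obtain E where E: "E \<in> S \<inter> K"
    and max: "\<And>E'. E' \<in> S \<inter> K \<Longrightarrow> (\<Sum>i\<in>V. E' (var_poly i)) \<le> (\<Sum>i\<in>V. E (var_poly i))"
    using continuous_attains_sup[OF C, of "\<lambda>E. \<Sum>i\<in>V. E (var_poly i)"]
    by (force intro: continuous_intros continuous_on_subset[OF ev])
  have le: "(\<Sum>i\<in>V. E' (var_poly i)) \<le> (\<Sum>i\<in>V. E (var_poly i))" if "sos4_feasible V adj E'" for E'
    using max[OF restr[OF that]] by (simp add: var_upto)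
  have F: "sos4_feasible V adj E" using E by (simp add: S_def)
  have "SOS4 V adj = (\<Sum>i\<in>V. E (var_poly i))"
    unfolding SOS4_def by (rule cSup_eq_maximum) (use F le in auto)
  then show ?thesis using that F le by simp
qed

end

theory Submission
  imports Defs
begin

text \<open>
  The pseudomoments are those of Feige and Krauthgamer: the moment of a set depends only on its size if
  the set is a clique, and vanishes otherwise, with first moment \<open>t\<close> of order \<open>p\<close> to the power \<open>-2/3\<close>.
  Expanding the clique indicators in the quadratic character \<open>chi\<close> writes the moment form at
  \<open>c + \<Sum> a i x i + \<Sum> b i j x i x j\<close> as a positive main part plus forms in products of values
  \<open>chi (i - k)\<close>. All of these except one are bounded by iterating the fact that the matrix
  \<open>chi (i - j)\<close> has norm \<open>sqrt p\<close>.

  The exception is the operator \<open>T\<close> on pairs with kernel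
  \<open>chi ((i - k) (i - l) (j - k) (j - l))\<close>, for which a norm bound of order \<open>p\<close> to the power \<open>5/4\<close>
  suffices. The trace of the fourth power of \<open>T\<close> is a fourth moment of character sums over products of
  four linear factors; embedding these products in the family of all monic quartics bounds it by
  \<open>O(p ^ 6)\<close> without the Weil bound. Since \<open>T\<close> commutes with the affine group, its
  singular values occur with multiplicity about \<open>p\<close> away from the translation-invariant functions,
  which gives the claimed bound there; here multiplicity is replaced by averaging over the group.
  The kernel is a function of the cross ratio, so \<open>T\<close> also commutes with inversion, and
  inversion moves translation-invariant functions almost entirely to the good part.
\<close>

section \<open>The quadratic character\<close>

text \<open>Why the exponent is -2/3. Put u = p^(1/2), v = p, w = p^(5/4): these bound the forms
  with one factor \<open>chi\<close>, with two or three, and T. The terms of order t in the linear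
  part \<open>a\<close> and t^2 in the quadratic part \<open>b\<close> must absorb the errors, which
  needs t u, t^3 v^2 and t^2 w small. The second condition is binding: it comes from the coupling of
  vertices with pairs through chi (i - j) chi (i - k), and it gives t = p^(-2/3), hence the value p
  t = p^(1/3). The third condition would tolerate a bound for T up to p^(4/3). The trace of the
  fourth power alone yields p^(3/2), which would force t = p^(-3/4) and the value p^(1/4); the group
  averaging has to close the gap between 3/2 and 4/3. A second obstacle is the coupling of
  \<open>a\<close> with the row sums L of \<open>b\<close>. Estimating the norm of L by sqrt p times
  that of \<open>b\<close> would force t below 1/p. So L is kept as a third quantity next to
  \<open>a\<close> and \<open>b\<close>, paid for by a positive multiple of its squared norm that
  the third moments supply.\<close>

locale paley =
  fixes p :: nat
  assumes prime_p: "prime p" and p_mod_4: "[p = 1] (mod 4)"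
begin

abbreviation P :: int where "P \<equiv> int p"

abbreviation F :: "int set" where "F \<equiv> {0..<int p}"

definition chi :: "int \<Rightarrow> real" where
  "chi a = real_of_int (Legendre a P)"

text \<open>Functions on the field are modelled as functions on all integers that factor through
  reduction mod p, so that shifts and dilations need no reduction; \<open>F\<close> serves only as
  the range of summation.\<close>

definition periodic :: "(int \<Rightarrow> 'b) \<Rightarrow> bool" where
  "periodic f \<longleftrightarrow> (\<forall>x. f (x mod P) = f x)"

lemma p_ge_5: "p \<ge> 5"
proof -
  have "p \<ge> 2" using prime_p by (rule prime_ge_2_nat)
  moreover have "p mod 4 = 1" using p_mod_4 by (simp add: cong_def)
  ultimately show ?thesis by presburger
qed

lemma prime_P: "prime P"
  using prime_p by simp

lemma periodic_cong: "periodic f \<Longrightarrow> P dvd a - b \<Longrightarrow> f a = f b"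
  unfolding periodic_def by (metis mod_eq_dvd_iff)

lemma periodicI: "(\<And>a b. P dvd a - b \<Longrightarrow> f a = f b) \<Longrightarrow> periodic f"
  unfolding periodic_def by (metis mod_eq_dvd_iff mod_mod_trivial)

lemma F_eqI: "x \<in> F \<Longrightarrow> y \<in> F \<Longrightarrow> P dvd x - y \<Longrightarrow> x = y"
  by (metis atLeastLessThan_iff mod_eq_dvd_iff mod_pos_pos_trivial)

lemma dvd_F_iff: "x \<in> F \<Longrightarrow> P dvd x \<longleftrightarrow> x = 0"
  using F_eqI[of x 0] p_ge_5 by auto

lemma dvd_mult_iff: "P dvd a * b \<longleftrightarrow> P dvd a \<or> P dvd b"
  using prime_P by (rule prime_dvd_mult_iff)

lemma not_dvd_2: "\<not> P dvd 2"
proof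
  assume "P dvd 2"
  then have "P \<le> 2" by (rule zdvd_imp_le) simp
  then show False using p_ge_5 by simp
qed

lemma not_dvd_4: "\<not> P dvd 4"
proof
  assume "P dvd 4"
  then have "P \<le> 4" by (rule zdvd_imp_le) simp
  then show False using p_ge_5 by simp
qed

text \<open>The map g need not preserve \<open>F\<close>: composed with reduction mod p it is an
  injective self-map of a finite set, hence a permutation.\<close>

lemma sum_reindex_mod:
  assumes f: "periodic (f :: int \<Rightarrow> 'b::comm_monoid_add)"
    and g: "\<And>x y. x \<in> F \<Longrightarrow> y \<in> F \<Longrightarrow> P dvd g x - g y \<Longrightarrow> P dvd x - y"
  shows "(\<Sum>x\<in>F. f (g x)) = (\<Sum>x\<in>F. f x)"
proof -
  let ?h = "\<lambda>x. g x mod P"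
  have inj: "inj_on ?h F"
  proof (rule inj_onI)
    fix x y assume xy: "x \<in> F" "y \<in> F" and "g x mod P = g y mod P"
    then have "P dvd g x - g y" by (simp add: mod_eq_dvd_iff)
    then show "x = y" using F_eqI[OF xy] g[OF xy] by blast
  qed
  have "?h ` F \<subseteq> F" using p_ge_5 by auto
  then have im: "?h ` F = F" by (intro endo_inj_surj inj) auto
  have "(\<Sum>x\<in>F. f (g x)) = (\<Sum>x\<in>F. f (?h x))"
    using f by (simp add: periodic_def)
  also have "\<dots> = (\<Sum>x\<in>?h ` F. f x)" using sum.reindex[OF inj, of f] by simp
  finally show ?thesis by (simp add: im)
qed

lemma sum_affine:
  assumes "periodic (f :: int \<Rightarrow> 'b::comm_monoid_add)" "\<not> P dvd u"
  shows "(\<Sum>x\<in>F. f (u * x + v)) = (\<Sum>x\<in>F. f x)"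
proof (rule sum_reindex_mod[OF assms(1)])
  fix x y assume "P dvd (u * x + v) - (u * y + v)"
  then have "P dvd u * (x - y)" by (simp add: algebra_simps)
  then show "P dvd x - y" using assms(2) by (simp add: dvd_mult_iff)
qed

lemma sum_shift:
  assumes "periodic (f :: int \<Rightarrow> 'b::comm_monoid_add)"
  shows "(\<Sum>x\<in>F. f (x + v)) = (\<Sum>x\<in>F. f x)"
  using sum_affine[OF assms, of 1 v] p_ge_5 by (simp add: zdvd1_eq)

lemma sum_reflect:
  assumes "periodic (f :: int \<Rightarrow> 'b::comm_monoid_add)"
  shows "(\<Sum>x\<in>F. f (v - x)) = (\<Sum>x\<in>F. f x)"
  using sum_affine[OF assms, of "-1" v] p_ge_5 by (simp add: zdvd1_eq)

lemma sum_split_0: "(\<Sum>x\<in>F. f x) = f 0 + (\<Sum>x\<in>F - {0}. (f x :: real))"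
  using p_ge_5 by (subst sum.remove[of _ 0]) auto

text \<open>The inverse from Fermat's little theorem. Since 0 goes to 0, it permutes the whole field
  and can be substituted in complete sums.\<close>

definition recip :: "int \<Rightarrow> int" where "recip x = x ^ (p - 2)"

lemma recip_dvd_iff: "P dvd recip x \<longleftrightarrow> P dvd x"
  using prime_P p_ge_5 by (auto simp: recip_def prime_dvd_power_iff)

lemma recip_mult: "\<not> P dvd x \<Longrightarrow> P dvd x * recip x - 1"
proof -
  assume "\<not> P dvd x"
  define n where "n = nat (x mod P)"
  have n: "int n = x mod P" using p_ge_5 by (simp add: n_def)
  have "\<not> P dvd int n" unfolding n using \<open>\<not> P dvd x\<close> by (simp add: dvd_mod_iff)
  then have "[n ^ (p - 1) = 1] (mod p)"
    using fermat_theorem[OF prime_p, of n] by simp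
  then have "[int n ^ (p - 1) = 1] (mod P)"
    by (simp flip: cong_int_iff)
  then have "[x ^ (p - 1) = 1] (mod P)"
    unfolding n cong_def by (simp add: power_mod)
  moreover have "x ^ (p - 1) = x * recip x"
  proof -
    have "p - 1 = Suc (p - 2)" using p_ge_5 by simp
    then show ?thesis by (simp only: recip_def power_Suc)
  qed
  ultimately show ?thesis by (simp add: cong_iff_dvd_diff)
qed

lemma recip_cong: "P dvd x - y \<Longrightarrow> P dvd recip x - recip y"
  unfolding recip_def cong_iff_dvd_diff[symmetric] by (rule cong_pow)

lemma recip_inj: assumes "P dvd recip x - recip y" shows "P dvd x - y"
proof (cases "P dvd x")
  case True
  then have "P dvd recip y"
    using assms recip_dvd_iff[of x] dvd_diff[of P "recip x" "recip x - recip y"] by simp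
  then show ?thesis using True by (simp add: recip_dvd_iff)
next
  case False
  then have "P dvd x * recip x - 1" by (rule recip_mult)
  moreover have "\<not> P dvd y"
    using False assms recip_dvd_iff[of x] recip_dvd_iff[of y] dvd_add[of P "recip x - recip y" "recip y"] by auto
  then have "P dvd y * recip y - 1" by (rule recip_mult)
  \<comment> \<open>Identities between inverses are certified here and below by writing them as
    integer combinations of relations x * recip x - 1.\<close>
  ultimately have "P dvd (- y) * (x * recip x - 1) + x * (y * recip y - 1) + x * y * (recip x - recip y)"
    using assms by simp
  also have "(- y) * (x * recip x - 1) + x * (y * recip y - 1) + x * y * (recip x - recip y) = - (x - y)"
    by (simp add: algebra_simps)
  finally show ?thesis by (simp only: dvd_minus_iff)
qed

lemma sum_recip:
  assumes "periodic (f :: int \<Rightarrow> 'b::comm_monoid_add)"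
  shows "(\<Sum>x\<in>F. f (recip x)) = (\<Sum>x\<in>F. f x)"
  using assms recip_inj by (intro sum_reindex_mod) auto

lemma Legendre_values: "Legendre a P \<in> {-1, 0, 1}"
  by (simp add: Legendre_def)

text \<open>The values -1, 0, 1 are distinct mod p because p exceeds 2, so a congruence between them
  is an equality.\<close>

lemma Legendre_eqI: "[Legendre a P = c] (mod P) \<Longrightarrow> c \<in> {-1, 0, 1} \<Longrightarrow> Legendre a P = c"
  using Legendre_values[of a] p_ge_5 zdvd_imp_le[of P 1] zdvd_imp_le[of P 2]
  by (auto simp: cong_iff_dvd_diff)

lemma euler: "[Legendre a P = a ^ ((p - 1) div 2)] (mod P)"
  using euler_criterion[of p a] prime_p p_ge_5 by simp

lemma chi_mult: "chi (a * b) = chi a * chi b"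
proof -
  have "[Legendre (a * b) P = Legendre a P * Legendre b P] (mod P)"
    using euler[of "a * b"] cong_mult[OF euler[of a] euler[of b]]
    by (simp add: power_mult_distrib) (metis cong_sym cong_trans)
  moreover have "Legendre a P * Legendre b P \<in> {-1, 0, 1}"
    using Legendre_values[of a] Legendre_values[of b] by auto
  ultimately show ?thesis using Legendre_eqI by (simp add: chi_def flip: of_int_mult)
qed

lemma chi_cong: assumes "P dvd a - b" shows "chi a = chi b"
proof -
  have "[a ^ ((p - 1) div 2) = b ^ ((p - 1) div 2)] (mod P)"
    using assms by (intro cong_pow) (simp add: cong_iff_dvd_diff)
  then have "[Legendre a P = Legendre b P] (mod P)"
    using euler[of a] euler[of b] by (metis cong_sym cong_trans)
  then show ?thesis using Legendre_eqI Legendre_values[of b] by (simp add: chi_def)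
qed

text \<open>For p = 1 mod 4 the exponent (p - 1) / 2 is even, so -1 is a square. This makes every
  kernel below symmetric.\<close>

lemma chi_minus [simp]: "chi (- a) = chi a"
proof -
  have "even ((p - 1) div 2)"
  proof -
    have "p mod 4 = 1" using p_mod_4 by (simp add: cong_def)
    then show ?thesis by presburger
  qed
  then have "[Legendre (-1) P = 1] (mod P)" using euler[of "-1"] by simp
  then have "chi (-1) = 1" using Legendre_eqI[of "-1" 1] by (simp add: chi_def)
  then show ?thesis using chi_mult[of "-1" a] by simp
qed

lemma chi_commute: "chi (a - b) = chi (b - a)"
  using chi_minus[of "a - b"] by simp

lemma chi_eq_0_iff: "chi a = 0 \<longleftrightarrow> P dvd a"
  by (auto simp: chi_def Legendre_def cong_iff_dvd_diff)

lemma chi_0 [simp]: "chi 0 = 0" by (simp add: chi_eq_0_iff)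

lemma chi_square: "\<not> P dvd a \<Longrightarrow> chi a * chi a = 1"
  using chi_eq_0_iff[of a] Legendre_values[of a] by (auto simp: chi_def)

lemma chi_1 [simp]: "chi 1 = 1"
  using chi_square[of 1] chi_mult[of 1 1] p_ge_5 by (auto simp: zdvd1_eq)

lemma abs_chi_le: "\<bar>chi a\<bar> \<le> 1"
  using Legendre_values[of a] by (auto simp: chi_def)

lemma chi_recip: "chi (recip x) = chi x"
proof (cases "P dvd x")
  case True
  then show ?thesis using chi_eq_0_iff recip_dvd_iff by metis
next
  case False
  then have "chi x * chi (recip x) = 1"
    using chi_cong[OF recip_mult[OF False]] by (simp add: chi_mult)
  then show ?thesis using chi_square[OF False]
    by (metis mult.commute mult.left_commute mult.right_neutral)
qed

lemma periodic_chi: "periodic chi"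
  by (rule periodicI) (rule chi_cong)

lemma chi_eq_1_iff: "chi a = 1 \<longleftrightarrow> \<not> P dvd a \<and> QuadRes P a"
  by (auto simp: chi_def Legendre_def cong_iff_dvd_diff)

lemma card_square_roots:
  assumes a: "a \<in> F"
  shows "real (card {y \<in> F. y\<^sup>2 mod P = a}) = 1 + chi a"
proof (cases "a = 0")
  case True
  have "{y \<in> F. y\<^sup>2 mod P = a} = {0}"
    using True p_ge_5 dvd_F_iff by (auto simp: mod_eq_0_iff_dvd prime_dvd_power_iff[OF prime_P])
  then show ?thesis using True by simp
next
  case False
  then have nd: "\<not> P dvd a" using a dvd_F_iff by simp
  have am: "a mod P = a" using a by simp
  show ?thesis
  proof (cases "QuadRes P a")
    case True
    then obtain z where z: "[z\<^sup>2 = a] (mod P)" by (auto simp: QuadRes_def)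
    define y1 where "y1 = z mod P"
    define y2 where "y2 = (- z) mod P"
    have in_F: "y1 \<in> F" "y2 \<in> F" using p_ge_5 by (auto simp: y1_def y2_def)
    have zd: "P dvd z\<^sup>2 - a" using z by (simp add: cong_iff_dvd_diff)
    have nz: "\<not> P dvd z"
    proof
      assume "P dvd z"
      then have "P dvd z\<^sup>2" by (simp add: power2_eq_square)
      then have "P dvd z\<^sup>2 - (z\<^sup>2 - a)" using zd by (rule dvd_diff)
      then show False using nd by simp
    qed
    have ne: "y1 \<noteq> y2"
    proof
      assume "y1 = y2"
      then have "P dvd 2 * z" by (simp add: y1_def y2_def mod_eq_dvd_iff)
      then show False using nz not_dvd_2 by (simp add: dvd_mult_iff)
    qed
    have "{y \<in> F. y\<^sup>2 mod P = a} = {y1, y2}"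
    proof (intro equalityI subsetI)
      fix y assume y: "y \<in> {y \<in> F. y\<^sup>2 mod P = a}"
      then have "y\<^sup>2 mod P = a mod P" using am by simp
      then have "P dvd y\<^sup>2 - a" by (simp add: mod_eq_dvd_iff)
      then have "P dvd (y\<^sup>2 - a) - (z\<^sup>2 - a)" using zd by (rule dvd_diff)
      then have "P dvd (y - z) * (y - (- z))" by (simp add: algebra_simps power2_eq_square)
      then have "y mod P = y1 \<or> y mod P = y2"
        unfolding y1_def y2_def mod_eq_dvd_iff by (simp only: dvd_mult_iff)
      then show "y \<in> {y1, y2}" using y by auto
    next
      fix y assume "y \<in> {y1, y2}"
      moreover have "y1\<^sup>2 mod P = a" "y2\<^sup>2 mod P = a"
        using z am by (auto simp: y1_def y2_def power_mod cong_def)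
      ultimately show "y \<in> {y \<in> F. y\<^sup>2 mod P = a}" using in_F by auto
    qed
    moreover have "chi a = 1" using True nd by (simp add: chi_eq_1_iff)
    ultimately show ?thesis using ne by simp
  next
    case False
    have "{y \<in> F. y\<^sup>2 mod P = a} = {}"
      using False am by (auto simp: QuadRes_def cong_def)
    moreover have "chi a = -1"
      using False nd by (auto simp: chi_def Legendre_def cong_iff_dvd_diff)
    ultimately show ?thesis by (simp only: card.empty)
  qed
qed

lemma sum_squares:
  assumes "periodic (g :: int \<Rightarrow> real)"
  shows "(\<Sum>y\<in>F. g (y\<^sup>2)) = (\<Sum>a\<in>F. (1 + chi a) * g a)"
proof -
  have "(\<Sum>y\<in>F. g (y\<^sup>2)) = (\<Sum>y\<in>F. g (y\<^sup>2 mod P))"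
    using assms by (simp add: periodic_def)
  also have "\<dots> = (\<Sum>a\<in>F. \<Sum>y | y \<in> F \<and> y\<^sup>2 mod P = a. g (y\<^sup>2 mod P))"
    using p_ge_5 by (intro sum.group[symmetric]) auto
  also have "\<dots> = (\<Sum>a\<in>F. (1 + chi a) * g a)"
    by (intro sum.cong refl) (simp add: card_square_roots del: atLeastLessThan_iff)
  finally show ?thesis .
qed

lemma sum_chi: "(\<Sum>x\<in>F. chi x) = 0"
  using sum_squares[of "\<lambda>_. 1"] by (simp add: periodic_def sum.distrib)

lemma sum_chi_affine: "\<not> P dvd u \<Longrightarrow> (\<Sum>s\<in>F. chi (u * s + v)) = 0"
  using sum_affine[OF periodic_chi] sum_chi by simp

text \<open>After a shift the summand at x nonzero is chi (1 + (a - b) / x). Inversion turns the sum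
  into a complete linear one, minus the term 1 at x = 0.\<close>

lemma sum_chi_chi:
  "(\<Sum>x\<in>F. chi (x - a) * chi (x - b)) = (if P dvd a - b then real p - 1 else - 1)"
proof -
  have per: "periodic (\<lambda>x. chi x * chi (x + (a - b)))"
    by (intro periodicI arg_cong2[of _ _ _ _ "(*)"] chi_cong) auto
  have "(\<Sum>x\<in>F. chi (x - a) * chi (x - b)) = (\<Sum>x\<in>F. chi x * chi (x + (a - b)))"
    using sum_shift[OF per, of "- a"] by simp
  also have "\<dots> = (\<Sum>x\<in>F - {0}. chi x * chi (x + (a - b)))"
    by (simp add: sum_split_0)
  also have "\<dots> = (\<Sum>x\<in>F - {0}. chi ((a - b) * recip x + 1))"
  proof (rule sum.cong[OF refl])
    fix x assume "x \<in> F - {0}"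
    then have x: "\<not> P dvd x" using dvd_F_iff by auto
    have "chi x * chi (x + (a - b)) = chi (recip x * (x + (a - b)))"
      by (simp add: chi_mult chi_recip)
    also have "\<dots> = chi ((a - b) * recip x + 1)"
      using recip_mult[OF x] by (intro chi_cong) (simp add: algebra_simps)
    finally show "chi x * chi (x + (a - b)) = chi ((a - b) * recip x + 1)" .
  qed
  also have "\<dots> = (\<Sum>x\<in>F. chi ((a - b) * recip x + 1)) - 1"
  proof -
    have "chi ((a - b) * recip 0 + 1) = 1"
      using chi_cong[of "(a - b) * recip 0 + 1" 1] recip_dvd_iff[of 0] by simp
    then show ?thesis by (simp add: sum_split_0)
  qed
  also have "(\<Sum>x\<in>F. chi ((a - b) * recip x + 1)) = (\<Sum>x\<in>F. chi ((a - b) * x + 1))"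
  proof (rule sum_recip)
    show "periodic (\<lambda>x. chi ((a - b) * x + 1))"
      by (intro periodicI chi_cong) (simp flip: right_diff_distrib)
  qed
  also have "\<dots> = (if P dvd a - b then real p else 0)"
  proof (cases "P dvd a - b")
    case True
    then have "chi ((a - b) * x + 1) = 1" for x
      using chi_cong[of "(a - b) * x + 1" 1] by simp
    then show ?thesis using True by simp
  qed (simp add: sum_chi_affine)
  finally show ?thesis by simp
qed


section \<open>A fourth moment of character sums\<close>

lemma periodic_sum: "(\<And>y. y \<in> A \<Longrightarrow> periodic (\<lambda>x. f x y)) \<Longrightarrow> periodic (\<lambda>x. \<Sum>y\<in>A. f x y :: real)"
  unfolding periodic_def by (intro allI sum.cong) auto

abbreviation F4 :: "(int \<times> int \<times> int \<times> int) set" where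
  "F4 \<equiv> F \<times> F \<times> F \<times> F"

lemma sum_F4: "(\<Sum>c\<in>F4. G c) = (\<Sum>a\<in>F. \<Sum>b\<in>F. \<Sum>c\<in>F. \<Sum>d\<in>F. (G (a, b, c, d) :: real))"
  by (simp add: sum.cartesian_product case_prod_unfold)

lemma sum_F4_shift:
  assumes "\<And>b c d. periodic (\<lambda>a. G (a, b, c, d) :: real)" "\<And>a c d. periodic (\<lambda>b. G (a, b, c, d))"
    "\<And>a b d. periodic (\<lambda>c. G (a, b, c, d))" "\<And>a b c. periodic (\<lambda>d. G (a, b, c, d))"
  shows "(\<Sum>(a, b, c, d)\<in>F4. G (a + s, b + t, c + u, d + v)) = (\<Sum>c\<in>F4. G c)"
proof -
  have "(\<Sum>(a, b, c, d)\<in>F4. G (a + s, b + t, c + u, d + v))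
      = (\<Sum>a\<in>F. \<Sum>b\<in>F. \<Sum>c\<in>F. \<Sum>d\<in>F. G (a + s, b + t, c + u, d + v))"
    by (simp add: sum_F4)
  also have "\<dots> = (\<Sum>a\<in>F. \<Sum>b\<in>F. \<Sum>c\<in>F. \<Sum>d\<in>F. G (a + s, b + t, c + u, d))"
    by (intro sum.cong refl sum_shift assms)
  also have "\<dots> = (\<Sum>a\<in>F. \<Sum>b\<in>F. \<Sum>c\<in>F. \<Sum>d\<in>F. G (a + s, b + t, c, d))"
    by (intro sum.cong refl sum_shift[of "\<lambda>c. \<Sum>d\<in>F. G (_, _, c, d)"] periodic_sum assms)
  also have "\<dots> = (\<Sum>a\<in>F. \<Sum>b\<in>F. \<Sum>c\<in>F. \<Sum>d\<in>F. G (a + s, b, c, d))"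
    by (intro sum.cong refl sum_shift[of "\<lambda>b. \<Sum>c\<in>F. \<Sum>d\<in>F. G (_, b, c, d)"] periodic_sum assms)
  also have "\<dots> = (\<Sum>a\<in>F. \<Sum>b\<in>F. \<Sum>c\<in>F. \<Sum>d\<in>F. G (a, b, c, d))"
    by (intro sum_shift[of "\<lambda>a. \<Sum>b\<in>F. \<Sum>c\<in>F. \<Sum>d\<in>F. G (a, b, c, d)"] periodic_sum assms)
  finally show ?thesis by (simp add: sum_F4)
qed

definition quartic :: "int \<times> int \<times> int \<times> int \<Rightarrow> int \<Rightarrow> int" where
  "quartic = (\<lambda>(a, b, c, d) x. x ^ 4 + a * x ^ 3 + b * x ^ 2 + c * x + d)"

lemma periodic_mult: "periodic (f :: int \<Rightarrow> 'b::times) \<Longrightarrow> periodic g \<Longrightarrow> periodic (\<lambda>x. f x * g x)"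
  by (simp add: periodic_def)

lemma periodic_chi_linear: "periodic (\<lambda>a. chi (u * a + v))"
  by (intro periodicI chi_cong) (simp flip: right_diff_distrib)

lemma periodic_chi_quartic:
  "periodic (\<lambda>a. chi (quartic (a, b, c, d) x))" "periodic (\<lambda>b. chi (quartic (a, b, c, d) x))"
  "periodic (\<lambda>c. chi (quartic (a, b, c, d) x))" "periodic (\<lambda>d. chi (quartic (a, b, c, d) x))"
  using periodic_chi_linear[of "x ^ 3" "x ^ 4 + b * x ^ 2 + c * x + d"]
    periodic_chi_linear[of "x ^ 2" "x ^ 4 + a * x ^ 3 + c * x + d"]
    periodic_chi_linear[of x "x ^ 4 + a * x ^ 3 + b * x ^ 2 + d"]
    periodic_chi_linear[of 1 "x ^ 4 + a * x ^ 3 + b * x ^ 2 + c * x"]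
  by (simp_all add: quartic_def algebra_simps)

definition prod4 :: "int \<times> int \<times> int \<times> int \<Rightarrow> int \<times> int \<times> int \<times> int \<Rightarrow> real" where
  "prod4 = (\<lambda>c (x, y, z, w). chi (quartic c x) * chi (quartic c y) * chi (quartic c z) * chi (quartic c w))"

text \<open>Adding multiples of \<open>(X - x) (X - y) (X - z)\<close> permutes the monic quartics, keeps the
  values at \<open>x\<close>, \<open>y\<close>, \<open>z\<close> and makes the value at \<open>w\<close> run through the whole field.\<close>

lemma sum_prod4_eq_0:
  assumes in_F: "x \<in> F" "y \<in> F" "z \<in> F" "w \<in> F" and ne: "w \<noteq> x" "w \<noteq> y" "w \<noteq> z"
  shows "(\<Sum>c\<in>F4. prod4 c (x, y, z, w)) = 0"
proof -
  let ?G = "\<lambda>c. prod4 c (x, y, z, w)"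
  define u where "u = (w - x) * (w - y) * (w - z)"
  have u: "\<not> P dvd u"
    using F_eqI[of w] in_F ne by (auto simp: u_def dvd_mult_iff)
  have shift: "quartic (a + s, b + s * (- (x + y + z)), c + s * (x * y + y * z + z * x), d + s * (- (x * y * z))) v
      = s * ((v - x) * (v - y) * (v - z)) + quartic (a, b, c, d) v" for a b c d s v
    by (simp add: quartic_def algebra_simps power2_eq_square power3_eq_cube)
  have G: "?G (a + s, b + s * (- (x + y + z)), c + s * (x * y + y * z + z * x), d + s * (- (x * y * z)))
      = chi (quartic (a, b, c, d) x) * chi (quartic (a, b, c, d) y) * chi (quartic (a, b, c, d) z)
        * chi (u * s + quartic (a, b, c, d) w)" for a b c d s
    unfolding prod4_def prod.case shift by (simp add: u_def mult.commute)
  have "(\<Sum>c\<in>F4. ?G c) = (\<Sum>(a, b, c, d)\<in>F4. ?G (a + s, b + s * (- (x + y + z)),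
      c + s * (x * y + y * z + z * x), d + s * (- (x * y * z))))" for s
    by (rule sum_F4_shift[symmetric])
      (simp_all add: prod4_def periodic_mult periodic_chi_quartic)
  then have "(\<Sum>s\<in>F. \<Sum>c\<in>F4. ?G c) = (\<Sum>s\<in>F. \<Sum>(a, b, c, d)\<in>F4. ?G (a + s, b + s * (- (x + y + z)),
      c + s * (x * y + y * z + z * x), d + s * (- (x * y * z))))"
    by (rule sum.cong[OF refl])
  also have "\<dots> = (\<Sum>(a, b, c, d)\<in>F4. \<Sum>s\<in>F. ?G (a + s, b + s * (- (x + y + z)),
      c + s * (x * y + y * z + z * x), d + s * (- (x * y * z))))"
    by (subst sum.swap) (simp add: case_prod_unfold)
  also have "\<dots> = 0"
    unfolding G by (intro sum.neutral) (auto simp: sum_chi_affine[OF u] simp flip: sum_distrib_left)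
  finally show ?thesis using p_ge_5 by simp
qed

definition paired :: "(int \<times> int \<times> int \<times> int) set" where
  "paired = {(x, y, z, w). (x = y \<and> z = w) \<or> (x = z \<and> y = w) \<or> (x = w \<and> y = z)}"

text \<open>In a quadruple that is not paired some entry differs from the other three; by symmetry
  it can be moved to the last place, where \<open>sum_prod4_eq_0\<close> applies. Paired quadruples
  get the trivial bound.\<close>

lemma sum_prod4_le:
  assumes v: "v \<in> F4"
  shows "(\<Sum>c\<in>F4. prod4 c v) \<le> (if v \<in> paired then real p ^ 4 else 0)"
proof (cases "v \<in> paired")
  case True
  have "(\<Sum>c\<in>F4. prod4 c v) \<le> (\<Sum>c\<in>F4. 1)"
  proof (rule sum_mono)
    fix c
    obtain x y z w where "v = (x, y, z, w)" by (cases v)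
    then have "\<bar>prod4 c v\<bar> \<le> 1"
      by (simp add: prod4_def abs_mult mult_le_one abs_chi_le)
    then show "prod4 c v \<le> 1" by linarith
  qed
  also have "\<dots> = real p ^ 4" by (simp add: card_cartesian_product power4_eq_xxxx)
  finally show ?thesis using True by simp
next
  case False
  obtain x y z w where vv: "v = (x, y, z, w)" by (cases v)
  have in_F: "x \<in> F" "y \<in> F" "z \<in> F" "w \<in> F" using v vv by auto
  have sym: "prod4 c (x, y, z, w) = prod4 c (x, y, w, z)"
    "prod4 c (x, y, z, w) = prod4 c (x, w, z, y)"
    "prod4 c (x, y, z, w) = prod4 c (w, y, z, x)" for c
    by (simp_all add: prod4_def)
  have "(w \<noteq> x \<and> w \<noteq> y \<and> w \<noteq> z) \<or> (z \<noteq> x \<and> z \<noteq> y \<and> z \<noteq> w)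
      \<or> (y \<noteq> x \<and> y \<noteq> w \<and> y \<noteq> z) \<or> (x \<noteq> w \<and> x \<noteq> y \<and> x \<noteq> z)"
    using False vv by (auto simp: paired_def)
  moreover have "(\<Sum>c\<in>F4. prod4 c (x, y, z, w)) = (\<Sum>c\<in>F4. prod4 c (x, y, w, z))"
    "(\<Sum>c\<in>F4. prod4 c (x, y, z, w)) = (\<Sum>c\<in>F4. prod4 c (x, w, z, y))"
    "(\<Sum>c\<in>F4. prod4 c (x, y, z, w)) = (\<Sum>c\<in>F4. prod4 c (w, y, z, x))"
    by (rule sum.cong[OF refl sym(1)], rule sum.cong[OF refl sym(2)], rule sum.cong[OF refl sym(3)])
  ultimately have "(\<Sum>c\<in>F4. prod4 c (x, y, z, w)) = 0"
    using sum_prod4_eq_0[of x y z w] sum_prod4_eq_0[of x y w z] sum_prod4_eq_0[of x w z y]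
      sum_prod4_eq_0[of w y z x] in_F by argo
  then show ?thesis using False vv by simp
qed

lemma card_paired: "real (card (paired \<inter> F4)) \<le> 3 * real p ^ 2"
proof -
  let ?f = "\<lambda>(a, b). (a, a, b, b)" and ?g = "\<lambda>(a, b). (a, b, a, b)" and ?h = "\<lambda>(a, b). (a, b, b, a)"
  have "paired \<inter> F4 \<subseteq> (?f ` (F \<times> F) \<union> ?g ` (F \<times> F)) \<union> ?h ` (F \<times> F)"
    by (auto simp: paired_def)
  then have "card (paired \<inter> F4) \<le> card ((?f ` (F \<times> F) \<union> ?g ` (F \<times> F)) \<union> ?h ` (F \<times> F))"
    by (intro card_mono) auto
  also have "\<dots> \<le> (card (F \<times> F) + card (F \<times> F)) + card (F \<times> F)"
    by (intro order_trans[OF card_Un_le] add_mono card_image_le) auto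
  also have "\<dots> = 3 * p ^ 2" by (simp add: card_cartesian_product power2_eq_square)
  finally show ?thesis by (metis of_nat_le_iff of_nat_mult of_nat_numeral of_nat_power)
qed

lemma sum_power4:
  "(\<Sum>x\<in>F. g x) ^ 4 = (\<Sum>(x, y, z, w)\<in>F4. g x * g y * g z * (g w :: real))"
proof -
  have "(\<Sum>x\<in>F. g x) ^ 4 = (\<Sum>x\<in>F. g x) * ((\<Sum>x\<in>F. g x) * ((\<Sum>x\<in>F. g x) * (\<Sum>x\<in>F. g x)))"
    by (simp add: power4_eq_xxxx)
  also have "\<dots> = (\<Sum>x\<in>F. \<Sum>y\<in>F. \<Sum>z\<in>F. \<Sum>w\<in>F. g x * (g y * (g z * g w)))"
    by (simp flip: sum_distrib_left sum_distrib_right)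
  finally show ?thesis by (simp add: sum_F4 mult.assoc)
qed

text \<open>Square-root cancellation on average: p^4 quartics, each with a fourth power of order
  p^2. Only the at most 3 p^2 paired quadruples survive the expansion.\<close>

lemma quartic_moment: "(\<Sum>c\<in>F4. (\<Sum>x\<in>F. chi (quartic c x)) ^ 4) \<le> 3 * real p ^ 6"
proof -
  have "(\<Sum>c\<in>F4. (\<Sum>x\<in>F. chi (quartic c x)) ^ 4) = (\<Sum>c\<in>F4. \<Sum>v\<in>F4. prod4 c v)"
    by (simp add: sum_power4 prod4_def)
  also have "\<dots> = (\<Sum>v\<in>F4. \<Sum>c\<in>F4. prod4 c v)" by (rule sum.swap)
  also have "\<dots> \<le> (\<Sum>v\<in>F4. if v \<in> paired then real p ^ 4 else 0)"
    by (intro sum_mono sum_prod4_le)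
  also have "\<dots> = real (card (F4 \<inter> paired)) * real p ^ 4"
    by (subst sum.inter_restrict[symmetric]) auto
  also have "\<dots> \<le> (3 * real p ^ 2) * real p ^ 4"
    using card_paired by (intro mult_right_mono) (simp_all add: Int_commute)
  also have "\<dots> = 3 * real p ^ 6" by (simp add: eval_nat_numeral)
  finally show ?thesis .
qed

section \<open>From all monic quartics to products of four linear factors\<close>

definition char_sum :: "int \<times> int \<times> int \<times> int \<Rightarrow> real" where
  "char_sum = (\<lambda>(i, j, k, l). \<Sum>x\<in>F. chi (x - i) * chi (x - j) * chi (x - k) * chi (x - l))"

text \<open>Vieta's coefficients of (X - i) (X - j) (X - k) (X - l), reduced mod p so that they lie
  in \<open>F4\<close>, the range of \<open>quartic_moment\<close>.\<close>

definition coeffs4 :: "int \<times> int \<times> int \<times> int \<Rightarrow> int \<times> int \<times> int \<times> int" where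
  "coeffs4 = (\<lambda>(i, j, k, l). ((- (i + j + k + l)) mod P, (i*j + i*k + i*l + j*k + j*l + k*l) mod P,
      (- (i*j*k + i*j*l + i*k*l + j*k*l)) mod P, (i*j*k*l) mod P))"

lemma quartic_coeffs4:
  "P dvd quartic (coeffs4 (i, j, k, l)) x - (x - i) * (x - j) * (x - k) * (x - l)"
proof -
  let ?a = "- (i + j + k + l)" and ?b = "i*j + i*k + i*l + j*k + j*l + k*l"
    and ?c = "- (i*j*k + i*j*l + i*k*l + j*k*l)" and ?d = "i*j*k*l"
  have "[quartic (coeffs4 (i, j, k, l)) x = quartic (?a, ?b, ?c, ?d) x] (mod P)"
    unfolding coeffs4_def quartic_def prod.case
    by (intro cong_add cong_mult cong_refl) (simp_all add: cong_def)
  also have "quartic (?a, ?b, ?c, ?d) x = (x - i) * (x - j) * (x - k) * (x - l)"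
    by (simp add: quartic_def algebra_simps power2_eq_square power3_eq_cube power4_eq_xxxx)
  finally show ?thesis by (simp add: cong_iff_dvd_diff)
qed

lemma char_sum_quartic: "char_sum v = (\<Sum>x\<in>F. chi (quartic (coeffs4 v) x))"
proof -
  obtain i j k l where v: "v = (i, j, k, l)" by (cases v)
  show ?thesis unfolding v
    by (simp add: char_sum_def chi_cong[OF quartic_coeffs4] chi_mult)
qed

text \<open>A root of the quartic must be one of i, j, k, l for a fixed preimage, so every preimage
  is one of the 4^4 tuples over these roots.\<close>

lemma card_fibre: "card {v \<in> F4. coeffs4 v = c} \<le> 256"
proof (cases "{v \<in> F4. coeffs4 v = c} = {}")
  case False
  then obtain i j k l where v0: "(i, j, k, l) \<in> F4" "coeffs4 (i, j, k, l) = c" by auto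
  have root: "r \<in> {i, j, k, l}" if "r \<in> F" "P dvd quartic c r" for r
  proof -
    have "P dvd quartic c r - (quartic (coeffs4 (i, j, k, l)) r - (r - i) * (r - j) * (r - k) * (r - l))"
      by (intro dvd_diff that quartic_coeffs4)
    then have "P dvd (r - i) * (r - j) * (r - k) * (r - l)" using v0 by simp
    then have "P dvd r - i \<or> P dvd r - j \<or> P dvd r - k \<or> P dvd r - l"
      by (simp add: dvd_mult_iff)
    then show ?thesis using F_eqI[OF \<open>r \<in> F\<close>] v0 by auto
  qed
  have "{v \<in> F4. coeffs4 v = c} \<subseteq> {i, j, k, l} \<times> {i, j, k, l} \<times> {i, j, k, l} \<times> {i, j, k, l}"
  proof (rule subsetI)
    fix v assume "v \<in> {v \<in> F4. coeffs4 v = c}"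
    then obtain x y z w where v: "v = (x, y, z, w)" "x \<in> F" "y \<in> F" "z \<in> F" "w \<in> F"
      "coeffs4 (x, y, z, w) = c" by auto
    have "P dvd quartic c r" if "r \<in> {x, y, z, w}" for r
      using quartic_coeffs4[of x y z w r] that v by auto
    then have "x \<in> {i, j, k, l}" "y \<in> {i, j, k, l}" "z \<in> {i, j, k, l}" "w \<in> {i, j, k, l}"
      using root v by blast+
    then show "v \<in> {i, j, k, l} \<times> {i, j, k, l} \<times> {i, j, k, l} \<times> {i, j, k, l}"
      unfolding v by blast
  qed
  then have "card {v \<in> F4. coeffs4 v = c} \<le> card ({i, j, k, l} \<times> {i, j, k, l} \<times> {i, j, k, l} \<times> {i, j, k, l})"
    by (intro card_mono) auto
  also have "\<dots> = card {i, j, k, l} ^ 4" by (simp only: card_cartesian_product power4_eq_xxxx mult.assoc)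
  also have "card {i, j, k, l} \<le> 4" by (simp add: card_insert_if)
  then have "card {i, j, k, l} ^ 4 \<le> 4 ^ 4" by (intro power_mono) auto
  finally show ?thesis by simp
next
  case True
  then show ?thesis by (metis card.empty le0)
qed

text \<open>Fourth powers are nonnegative, so passing from split quartics to all monic ones only
  increases the sum; 768 = 256 * 3.\<close>

lemma char_sum_moment: "(\<Sum>v\<in>F4. char_sum v ^ 4) \<le> 768 * real p ^ 6"
proof -
  let ?g = "\<lambda>c. (\<Sum>x\<in>F. chi (quartic c x)) ^ 4"
  have g: "0 \<le> ?g c" for c by (rule zero_le_even_power) simp
  have "(\<Sum>v\<in>F4. char_sum v ^ 4) = (\<Sum>v\<in>F4. ?g (coeffs4 v))"
    by (simp add: char_sum_quartic)
  also have "\<dots> = (\<Sum>c\<in>F4. \<Sum>v | v \<in> F4 \<and> coeffs4 v = c. ?g (coeffs4 v))"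
    using p_ge_5 by (intro sum.group[symmetric]) (auto simp: coeffs4_def)
  also have "\<dots> = (\<Sum>c\<in>F4. real (card {v \<in> F4. coeffs4 v = c}) * ?g c)"
    by (intro sum.cong refl) (simp del: mem_Sigma_iff)
  also have "\<dots> \<le> (\<Sum>c\<in>F4. 256 * ?g c)"
    using card_fibre by (intro sum_mono mult_right_mono g) simp
  also have "\<dots> \<le> 768 * real p ^ 6"
    using quartic_moment by (simp flip: sum_distrib_left)
  finally show ?thesis .
qed


section \<open>Near-orthogonality under the affine group\<close>

abbreviation FF :: "(int \<times> int) set" where "FF \<equiv> F \<times> F"

lemma sum_FF: "(\<Sum>q\<in>FF. h q) = (\<Sum>x\<in>F. \<Sum>y\<in>F. h (x, y))"
  by (simp add: sum.cartesian_product)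

definition periodic2 :: "(int \<times> int \<Rightarrow> 'b) \<Rightarrow> bool" where
  "periodic2 b \<longleftrightarrow> (\<forall>x y. b (x mod P, y mod P) = b (x, y))"

lemma periodic2_cong:
  "periodic2 b \<Longrightarrow> P dvd x - x' \<Longrightarrow> P dvd y - y' \<Longrightarrow> b (x, y) = b (x', y')"
  unfolding periodic2_def by (metis mod_eq_dvd_iff)

lemma periodic2I:
  "(\<And>x x' y y'. P dvd x - x' \<Longrightarrow> P dvd y - y' \<Longrightarrow> b (x, y) = b (x', y')) \<Longrightarrow> periodic2 b"
  unfolding periodic2_def by (metis mod_eq_dvd_iff mod_mod_trivial)

lemma periodic2_comp:
  assumes "periodic2 b" "\<And>x x'. P dvd x - x' \<Longrightarrow> P dvd f x - f x'" "\<And>x x'. P dvd x - x' \<Longrightarrow> P dvd g x - g x'"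
  shows "periodic (\<lambda>x. b (f x, g x))"
  by (rule periodicI, rule periodic2_cong[OF assms(1)]) (use assms in auto)

lemma sum_FF_diag:
  assumes "periodic2 h"
  shows "(\<Sum>q\<in>FF. h q) = (\<Sum>d\<in>F. \<Sum>x\<in>F. (h (x, x + d) :: 'b::comm_monoid_add))"
proof -
  have "(\<Sum>q\<in>FF. h q) = (\<Sum>x\<in>F. \<Sum>y\<in>F. h (x, y))" by (rule sum_FF)
  also have "\<dots> = (\<Sum>x\<in>F. \<Sum>d\<in>F. h (x, d + x))"
    by (intro sum.cong refl sum_shift[symmetric] periodic2_comp assms) auto
  also have "\<dots> = (\<Sum>d\<in>F. \<Sum>x\<in>F. h (x, x + d))"
    by (subst sum.swap) (simp add: add.commute)
  finally show ?thesis .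
qed

section \<open>Fourier analysis in the direction of translation\<close>

definition add_char :: "int \<Rightarrow> complex" where "add_char n = cis (2 * pi * (of_int n / of_nat p))"

lemma add_char_add: "add_char (a + b) = add_char a * add_char b"
  by (simp add: add_char_def cis_mult add_divide_distrib ring_distribs)

lemma add_char_0 [simp]: "add_char 0 = 1" by (simp add: add_char_def)

lemma cnj_add_char: "cnj (add_char a) = add_char (- a)" by (simp add: add_char_def cis_cnj)

lemma add_char_eq_1_iff: "add_char n = 1 \<longleftrightarrow> P dvd n"
proof
  assume "P dvd n"
  then obtain k where "n = P * k" ..
  then show "add_char n = 1" using p_ge_5 by (simp add: add_char_def)
next
  assume "add_char n = 1"
  then have "\<exists>k::int. 2 * pi * (of_int n / of_nat p) = of_int (2 * k) * pi"
    by (simp add: add_char_def cis_conv_exp exp_eq_1)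
  then obtain k :: int where "2 * pi * (of_int n / of_nat p) = of_int (2 * k) * pi" ..
  then have "real_of_int n = real_of_int k * real p" using p_ge_5 by (simp add: field_simps)
  then have "real_of_int n = real_of_int (k * P)" by simp
  then have "n = k * P" by (simp only: of_int_eq_iff)
  then show "P dvd n" by simp
qed

lemma add_char_cong: assumes "P dvd a - b" shows "add_char a = add_char b"
proof -
  have "add_char (b + (a - b)) = add_char b * add_char (a - b)" by (rule add_char_add)
  then show ?thesis using assms add_char_eq_1_iff[of "a - b"] by simp
qed

lemma sum_add_char: "(\<Sum>w\<in>F. add_char (w * k)) = (if P dvd k then of_nat p else 0)"
proof (cases "P dvd k")
  case True
  then have "add_char (w * k) = 1" for w by (simp add: add_char_eq_1_iff)
  then show ?thesis using True by simp
next
  case False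
  have "periodic (\<lambda>w. add_char (w * k))"
    by (intro periodicI add_char_cong) (simp flip: left_diff_distrib)
  from sum_shift[OF this, of 1]
  have "(\<Sum>w\<in>F. add_char (w * k)) * add_char k = (\<Sum>w\<in>F. add_char (w * k))"
    by (simp add: ring_distribs add_char_add sum_distrib_right)
  then show ?thesis using False add_char_eq_1_iff[of k] by (simp add: mult_cancel_left1)
qed

lemma parseval:
  "(\<Sum>w\<in>F. (cmod (\<Sum>x\<in>F. of_real (a x) * add_char (w * x)))\<^sup>2) = real p * (\<Sum>x\<in>F. (a x)\<^sup>2)"
proof -
  have sq: "of_real ((cmod (\<Sum>x\<in>F. of_real (a x) * add_char (w * x)))\<^sup>2) =
      (\<Sum>x\<in>F. \<Sum>y\<in>F. of_real (a x * a y) * add_char (w * (x - y)))" for w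
    by (subst complex_norm_square)
      (simp add: cnj_sum cnj_add_char sum_product ring_distribs diff_conv_add_uminus add_char_add mult_ac del: add_uminus_conv_diff)
  have "complex_of_real (\<Sum>w\<in>F. (cmod (\<Sum>x\<in>F. of_real (a x) * add_char (w * x)))\<^sup>2) =
      (\<Sum>w\<in>F. \<Sum>x\<in>F. \<Sum>y\<in>F. of_real (a x * a y) * add_char (w * (x - y)))"
    unfolding of_real_sum sq ..
  also have "\<dots> = (\<Sum>x\<in>F. \<Sum>w\<in>F. \<Sum>y\<in>F. of_real (a x * a y) * add_char (w * (x - y)))"
    by (rule sum.swap)
  also have "\<dots> = (\<Sum>x\<in>F. \<Sum>y\<in>F. \<Sum>w\<in>F. of_real (a x * a y) * add_char (w * (x - y)))"
    by (intro sum.cong refl sum.swap)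
  also have "\<dots> = (\<Sum>x\<in>F. \<Sum>y\<in>F. if y = x then of_real (a x * a y) * of_nat p else 0)"
  proof (intro sum.cong refl)
    fix x y assume "x \<in> F" "y \<in> F"
    then have "P dvd x - y \<longleftrightarrow> y = x" using F_eqI[of x y] by auto
    then show "(\<Sum>w\<in>F. of_real (a x * a y) * add_char (w * (x - y))) = (if y = x then of_real (a x * a y) * of_nat p else 0)"
      by (simp add: sum_add_char flip: sum_distrib_left)
  qed
  also have "\<dots> = of_real (real p * (\<Sum>x\<in>F. (a x)\<^sup>2))"
    by (simp add: sum.delta sum_distrib_left power2_eq_square mult.commute)
  finally show ?thesis by (simp only: of_real_eq_iff)
qed

definition sq_norm :: "(int \<times> int \<Rightarrow> real) \<Rightarrow> real" where "sq_norm b = (\<Sum>q\<in>FF. (b q)\<^sup>2)"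

lemma sq_norm_nonneg [simp]: "0 \<le> sq_norm b" by (simp add: sq_norm_def sum_nonneg)

text \<open>Both entries of a pair are translated together, so the transform is taken along each
  diagonal, with the difference d fixed.\<close>

definition fourier :: "(int \<times> int \<Rightarrow> real) \<Rightarrow> int \<Rightarrow> int \<Rightarrow> complex" where
  "fourier b d w = (\<Sum>x\<in>F. of_real (b (x, x + d)) * add_char (w * x))"

definition energy :: "(int \<times> int \<Rightarrow> real) \<Rightarrow> int \<Rightarrow> real" where
  "energy b w = (\<Sum>d\<in>F. (cmod (fourier b d w))\<^sup>2)"

lemma energy_nonneg: "0 \<le> energy b w" by (simp add: energy_def sum_nonneg)

lemma sum_energy: assumes "periodic2 b" shows "(\<Sum>w\<in>F. energy b w) = real p * sq_norm b"
proof -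
  have "(\<Sum>w\<in>F. energy b w) = (\<Sum>d\<in>F. \<Sum>w\<in>F. (cmod (fourier b d w))\<^sup>2)"
    unfolding energy_def by (rule sum.swap)
  also have "\<dots> = (\<Sum>d\<in>F. real p * (\<Sum>x\<in>F. (b (x, x + d))\<^sup>2))"
    unfolding fourier_def by (subst parseval) simp
  also have "\<dots> = real p * sq_norm b"
    unfolding sq_norm_def using assms by (subst sum_FF_diag) (auto simp: periodic2_def sum_distrib_left)
  finally show ?thesis .
qed

lemma periodic_energy: "periodic (energy b)"
proof (rule periodicI)
  fix v w assume "P dvd v - w"
  then have "add_char (v * x) = add_char (w * x)" for x by (intro add_char_cong) (simp flip: left_diff_distrib)
  then show "energy b v = energy b w" by (simp add: energy_def fourier_def)
qed

definition affine_act :: "int \<Rightarrow> int \<Rightarrow> int \<times> int \<Rightarrow> int \<times> int" where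
  "affine_act u v = (\<lambda>(x, y). (u * x + v, u * y + v))"

lemma periodic2_affine_act: "periodic2 b \<Longrightarrow> periodic2 (\<lambda>q. b (affine_act u v q))"
  by (rule periodic2I, unfold affine_act_def prod.case, erule periodic2_cong) (simp_all flip: right_diff_distrib)

text \<open>The correlation is a convolution in v, so its transform is a product on each diagonal;
  the dilation by u takes the difference d to u d and rescales the frequency of
  \<open>c\<close>.\<close>

lemma correlation_fourier:
  assumes b: "periodic2 b" and c: "periodic2 c"
  shows "(\<Sum>v\<in>F. of_real (\<Sum>q\<in>FF. c q * b (affine_act u v q)) * add_char (w * v))
    = (\<Sum>d\<in>F. fourier b (u * d) w * fourier c d (- u * w))"
proof -
  have per: "periodic2 (\<lambda>q. c q * b (affine_act u v q))" for v
    using c periodic2_affine_act[OF b, of u v] by (simp add: periodic2_def)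
  have inner: "(\<Sum>v\<in>F. of_real (b (u * x + v, u * x + v + u * d)) * add_char (w * v)) = add_char (- u * w * x) * fourier b (u * d) w" for x d
  proof -
    have "periodic (\<lambda>v. of_real (b (v, v + u * d)) * add_char (w * v - w * (u * x)))"
    proof (intro periodic_mult periodic2_comp[of "\<lambda>q. of_real (b q)"])
      show "periodic (\<lambda>v. add_char (w * v - w * (u * x)))"
        by (intro periodicI add_char_cong) (simp flip: right_diff_distrib)
    qed (use b in \<open>auto simp: periodic2_def\<close>)
    from sum_shift[OF this, of "u * x"]
    have "(\<Sum>v\<in>F. of_real (b (u * x + v, u * x + v + u * d)) * add_char (w * v)) = (\<Sum>v\<in>F. of_real (b (v, v + u * d)) * add_char (w * v - w * (u * x)))"
      by (simp add: algebra_simps)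
    also have "\<dots> = (\<Sum>v\<in>F. add_char (- u * w * x) * (of_real (b (v, v + u * d)) * add_char (w * v)))"
      by (intro sum.cong refl) (simp add: diff_conv_add_uminus add_char_add mult_ac del: add_uminus_conv_diff)
    finally show ?thesis by (simp add: fourier_def sum_distrib_left)
  qed
  have "(\<Sum>v\<in>F. of_real (\<Sum>q\<in>FF. c q * b (affine_act u v q)) * add_char (w * v))
      = (\<Sum>v\<in>F. \<Sum>d\<in>F. \<Sum>x\<in>F. of_real (c (x, x + d)) * (of_real (b (u * x + v, u * x + v + u * d)) * add_char (w * v)))"
    by (subst sum_FF_diag[OF per]) (simp add: affine_act_def sum_distrib_left sum_distrib_right algebra_simps)
  also have "\<dots> = (\<Sum>d\<in>F. \<Sum>v\<in>F. \<Sum>x\<in>F. of_real (c (x, x + d)) * (of_real (b (u * x + v, u * x + v + u * d)) * add_char (w * v)))"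
    by (rule sum.swap)
  also have "\<dots> = (\<Sum>d\<in>F. \<Sum>x\<in>F. \<Sum>v\<in>F. of_real (c (x, x + d)) * (of_real (b (u * x + v, u * x + v + u * d)) * add_char (w * v)))"
    by (intro sum.cong refl sum.swap)
  also have "\<dots> = (\<Sum>d\<in>F. \<Sum>x\<in>F. of_real (c (x, x + d)) * (add_char (- u * w * x) * fourier b (u * d) w))"
    by (simp only: inner flip: sum_distrib_left)
  also have "\<dots> = (\<Sum>d\<in>F. fourier b (u * d) w * fourier c d (- u * w))"
    unfolding fourier_def[of c] sum_distrib_left by (intro sum.cong refl) (simp add: mult_ac)
  finally show ?thesis .
qed

text \<open>Parseval in v, then Cauchy-Schwarz in d. Since d to u d is a permutation, the factor of
  \<open>b\<close> no longer depends on u.\<close>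

lemma sum_correlation_square:
  assumes b: "periodic2 b" and c: "periodic2 c" and u: "\<not> P dvd u"
  shows "real p * (\<Sum>v\<in>F. (\<Sum>q\<in>FF. c q * b (affine_act u v q))\<^sup>2) \<le> (\<Sum>w\<in>F. energy b w * energy c (- u * w))"
proof -
  have "real p * (\<Sum>v\<in>F. (\<Sum>q\<in>FF. c q * b (affine_act u v q))\<^sup>2)
      = (\<Sum>w\<in>F. (cmod (\<Sum>d\<in>F. fourier b (u * d) w * fourier c d (- u * w)))\<^sup>2)"
    unfolding correlation_fourier[OF b c, symmetric] by (rule parseval[symmetric])
  also have "\<dots> \<le> (\<Sum>w\<in>F. energy b w * energy c (- u * w))"
  proof (rule sum_mono)
    fix w
    have per: "periodic (\<lambda>d. (cmod (fourier b d w))\<^sup>2)"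
    proof (rule periodicI)
      fix d d' assume "P dvd d - d'"
      then have "b (x, x + d) = b (x, x + d')" for x using b by (intro periodic2_cong) auto
      then show "(cmod (fourier b d w))\<^sup>2 = (cmod (fourier b d' w))\<^sup>2" by (simp add: fourier_def)
    qed
    have "cmod (\<Sum>d\<in>F. fourier b (u * d) w * fourier c d (- u * w)) \<le> (\<Sum>d\<in>F. cmod (fourier b (u * d) w) * cmod (fourier c d (- u * w)))"
      by (rule order_trans[OF norm_sum]) (simp add: norm_mult)
    then have "(cmod (\<Sum>d\<in>F. fourier b (u * d) w * fourier c d (- u * w)))\<^sup>2 \<le> (\<Sum>d\<in>F. cmod (fourier b (u * d) w) * cmod (fourier c d (- u * w)))\<^sup>2"
      by (rule power_mono) simp
    also have "\<dots> \<le> (\<Sum>d\<in>F. (cmod (fourier b (u * d) w))\<^sup>2) * (\<Sum>d\<in>F. (cmod (fourier c d (- u * w)))\<^sup>2)"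
      by (rule Cauchy_Schwarz_ineq_sum)
    also have "(\<Sum>d\<in>F. (cmod (fourier b (u * d) w))\<^sup>2) = energy b w"
      using sum_affine[OF per u, of 0] by (simp add: energy_def)
    finally show "(cmod (\<Sum>d\<in>F. fourier b (u * d) w * fourier c d (- u * w)))\<^sup>2 \<le> energy b w * energy c (- u * w)"
      by (simp add: energy_def)
  qed
  finally show ?thesis .
qed

text \<open>Translates and dilates of a function without translation-invariant part are nearly orthogonal
  on average: the dilations move every nonzero frequency through all nonzero frequencies.\<close>

lemma affine_near_orthogonality:
  assumes b: "periodic2 b" and c: "periodic2 c" and mean: "\<And>d. (\<Sum>x\<in>F. b (x, x + d)) = 0"
  shows "(\<Sum>u\<in>F - {0}. \<Sum>v\<in>F. (\<Sum>q\<in>FF. c q * b (affine_act u v q))\<^sup>2) \<le> real p * sq_norm b * sq_norm c"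
proof -
  have "energy b 0 = 0"
    by (simp add: energy_def fourier_def mean flip: of_real_sum)
  have C: "(\<Sum>u\<in>F - {0}. energy c (- u * w)) \<le> (\<Sum>s\<in>F. energy c s)" if "w \<in> F" "w \<noteq> 0" for w
  proof -
    have "\<not> P dvd - w" using that dvd_F_iff by simp
    from sum_affine[OF periodic_energy this, of c 0]
    have "(\<Sum>u\<in>F. energy c (- u * w)) = (\<Sum>s\<in>F. energy c s)" by (simp add: mult.commute)
    then show ?thesis using sum_split_0[of "\<lambda>u. energy c (- u * w)"] energy_nonneg[of c 0] by simp
  qed
  have "real p * (\<Sum>u\<in>F - {0}. \<Sum>v\<in>F. (\<Sum>q\<in>FF. c q * b (affine_act u v q))\<^sup>2)
      = (\<Sum>u\<in>F - {0}. real p * (\<Sum>v\<in>F. (\<Sum>q\<in>FF. c q * b (affine_act u v q))\<^sup>2))"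
    by (rule sum_distrib_left)
  also have "\<dots> \<le> (\<Sum>u\<in>F - {0}. \<Sum>w\<in>F. energy b w * energy c (- u * w))"
    using dvd_F_iff by (intro sum_mono sum_correlation_square b c) auto
  also have "\<dots> = (\<Sum>w\<in>F. energy b w * (\<Sum>u\<in>F - {0}. energy c (- u * w)))"
    by (subst sum.swap) (simp add: sum_distrib_left)
  also have "\<dots> \<le> (\<Sum>w\<in>F. energy b w * (\<Sum>s\<in>F. energy c s))"
  proof (rule sum_mono)
    fix w assume "w \<in> F"
    show "energy b w * (\<Sum>u\<in>F - {0}. energy c (- u * w)) \<le> energy b w * (\<Sum>s\<in>F. energy c s)"
      using C[OF \<open>w \<in> F\<close>] \<open>energy b 0 = 0\<close> energy_nonneg[of b w] by (cases "w = 0") (auto intro: mult_left_mono)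
  qed
  also have "\<dots> = (real p * sq_norm b) * (real p * sq_norm c)"
    by (simp add: sum_energy b c flip: sum_distrib_right)
  finally show ?thesis using p_ge_5 by (simp add: mult.assoc mult.left_commute)
qed


section \<open>The operator on pairs\<close>

definition quad_kernel :: "int \<times> int \<Rightarrow> int \<times> int \<Rightarrow> real" where
  "quad_kernel = (\<lambda>(i, j) (k, l). chi (i - k) * chi (i - l) * chi (j - k) * chi (j - l))"

definition quad_op :: "(int \<times> int \<Rightarrow> real) \<Rightarrow> int \<times> int \<Rightarrow> real" where
  "quad_op b q = (\<Sum>q'\<in>FF. quad_kernel q q' * b q')"

definition pair_char_sum :: "int \<times> int \<Rightarrow> int \<times> int \<Rightarrow> real" where
  "pair_char_sum = (\<lambda>(i, j) (k, l). char_sum (i, j, k, l))"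

text \<open>The two entries of r separate into equal character sums: the kernel of the square of T
  is the square of one character sum.\<close>

lemma sum_quad_kernel_quad_kernel: "(\<Sum>r\<in>FF. quad_kernel r q * quad_kernel r q') = (pair_char_sum q q')\<^sup>2"
proof -
  obtain i j k l where q: "q = (i, j)" "q' = (k, l)" by (cases q, cases q')
  show ?thesis
    unfolding q sum_FF pair_char_sum_def quad_kernel_def char_sum_def power2_eq_square sum_product prod.case
    by (intro sum.cong refl) (simp add: mult_ac)
qed

lemma sq_norm_quad_op: "sq_norm (quad_op b) = (\<Sum>q\<in>FF. \<Sum>q'\<in>FF. (b q * b q') * (pair_char_sum q q')\<^sup>2)"
proof -
  have "sq_norm (quad_op b) = (\<Sum>r\<in>FF. \<Sum>q\<in>FF. \<Sum>q'\<in>FF. (b q * b q') * (quad_kernel r q * quad_kernel r q'))"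
    unfolding sq_norm_def quad_op_def power2_eq_square sum_product by (intro sum.cong refl) (simp add: mult_ac)
  also have "\<dots> = (\<Sum>q\<in>FF. \<Sum>r\<in>FF. \<Sum>q'\<in>FF. (b q * b q') * (quad_kernel r q * quad_kernel r q'))"
    by (rule sum.swap)
  also have "\<dots> = (\<Sum>q\<in>FF. \<Sum>q'\<in>FF. \<Sum>r\<in>FF. (b q * b q') * (quad_kernel r q * quad_kernel r q'))"
    by (intro sum.cong refl sum.swap)
  finally show ?thesis by (simp only: sum_quad_kernel_quad_kernel flip: sum_distrib_left)
qed

text \<open>The left side is the squared Hilbert-Schmidt norm of the square of T, that is, the trace
  of its fourth power.\<close>

lemma pair_char_sum_moment: "(\<Sum>q\<in>FF. \<Sum>q'\<in>FF. ((pair_char_sum q q')\<^sup>2)\<^sup>2) \<le> 768 * real p ^ 6"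
proof -
  have "(\<Sum>q\<in>FF. \<Sum>q'\<in>FF. ((pair_char_sum q q')\<^sup>2)\<^sup>2) = (\<Sum>v\<in>F4. char_sum v ^ 4)"
    unfolding sum_F4 sum_FF by (simp add: pair_char_sum_def flip: power_mult)
  then show ?thesis using char_sum_moment by simp
qed

lemma double_Cauchy_Schwarz:
  "(\<Sum>q\<in>A. \<Sum>q'\<in>B. w q q' * (k q q' :: real))\<^sup>2
    \<le> (\<Sum>q\<in>A. \<Sum>q'\<in>B. (w q q')\<^sup>2) * (\<Sum>q\<in>A. \<Sum>q'\<in>B. (k q q')\<^sup>2)"
  unfolding sum.cartesian_product
  using Cauchy_Schwarz_ineq_sum[of "\<lambda>(q, q'). w q q'" "\<lambda>(q, q'). k q q'" "A \<times> B"]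
  by (simp add: case_prod_unfold)

text \<open>The fourth power of the norm is at most the trace of the fourth power. The resulting
  bound p^(3/2) is applied only to functions whose norm is already small.\<close>

lemma quad_op_crude: "(sq_norm (quad_op b))\<^sup>2 \<le> 768 * real p ^ 6 * (sq_norm b)\<^sup>2"
proof -
  have "(sq_norm (quad_op b))\<^sup>2 \<le> (\<Sum>q\<in>FF. \<Sum>q'\<in>FF. (b q * b q')\<^sup>2) * (\<Sum>q\<in>FF. \<Sum>q'\<in>FF. ((pair_char_sum q q')\<^sup>2)\<^sup>2)"
    unfolding sq_norm_quad_op by (rule double_Cauchy_Schwarz)
  also have "(\<Sum>q\<in>FF. \<Sum>q'\<in>FF. (b q * b q')\<^sup>2) = (sq_norm b)\<^sup>2"
    unfolding sq_norm_def power2_eq_square[of "sum _ _"] sum_product by (simp add: power_mult_distrib)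
  also have "(sq_norm b)\<^sup>2 * (\<Sum>q\<in>FF. \<Sum>q'\<in>FF. ((pair_char_sum q q')\<^sup>2)\<^sup>2) \<le> (sq_norm b)\<^sup>2 * (768 * real p ^ 6)"
    by (intro mult_left_mono pair_char_sum_moment) simp
  finally show ?thesis by (simp add: mult_ac)
qed

lemma sum_FF_reindex:
  assumes h: "periodic2 (h :: int \<times> int \<Rightarrow> real)"
    and inj: "\<And>x y. P dvd g x - g y \<Longrightarrow> P dvd x - y"
  shows "(\<Sum>q\<in>FF. h (g (fst q), g (snd q))) = (\<Sum>q\<in>FF. h q)"
proof -
  have "(\<Sum>q\<in>FF. h (g (fst q), g (snd q))) = (\<Sum>x\<in>F. \<Sum>y\<in>F. h (g x, g y))"
    by (simp add: sum_FF)
  also have "\<dots> = (\<Sum>x\<in>F. \<Sum>y\<in>F. h (g x, y))"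
  proof (rule sum.cong[OF refl])
    fix x
    have "periodic (\<lambda>y. h (g x, y))" by (rule periodic2_comp[OF h]) auto
    then show "(\<Sum>y\<in>F. h (g x, g y)) = (\<Sum>y\<in>F. h (g x, y))"
      by (rule sum_reindex_mod) (rule inj)
  qed
  also have "\<dots> = (\<Sum>x\<in>F. \<Sum>y\<in>F. h (x, y))"
  proof (rule sum_reindex_mod[where f = "\<lambda>x. \<Sum>y\<in>F. h (x, y)"])
    show "periodic (\<lambda>x. \<Sum>y\<in>F. h (x, y))"
      by (intro periodic_sum periodic2_comp[OF h]) auto
  qed (rule inj)
  finally show ?thesis by (simp add: sum_FF)
qed

lemma sum_FF_affine_act:
  assumes h: "periodic2 (h :: int \<times> int \<Rightarrow> real)" and u: "\<not> P dvd u"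
  shows "(\<Sum>q\<in>FF. h (affine_act u v q)) = (\<Sum>q\<in>FF. h q)"
proof -
  have "(\<Sum>q\<in>FF. h (u * fst q + v, u * snd q + v)) = (\<Sum>q\<in>FF. h q)"
  proof (rule sum_FF_reindex[OF h, where g = "\<lambda>x. u * x + v"])
    fix x y
    have "u * x + v - (u * y + v) = u * (x - y)" by (simp add: algebra_simps)
    then show "P dvd u * x + v - (u * y + v) \<Longrightarrow> P dvd x - y"
      using u by (simp add: dvd_mult_iff)
  qed
  then show ?thesis by (simp add: affine_act_def case_prod_unfold)
qed

lemma sq_norm_affine_act: "periodic2 b \<Longrightarrow> \<not> P dvd u \<Longrightarrow> sq_norm (\<lambda>q. b (affine_act u v q)) = sq_norm b"
  unfolding sq_norm_def by (rule sum_FF_affine_act[of "\<lambda>q. (b q)\<^sup>2"]) (auto simp: periodic2_def)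

text \<open>Substituting x by u x + v produces chi u four times, and the product of these is
  1.\<close>

lemma pair_char_sum_affine_act: assumes u: "\<not> P dvd u" shows "pair_char_sum (affine_act u v q) (affine_act u v q') = pair_char_sum q q'"
proof -
  obtain i j k l where q: "q = (i, j)" "q' = (k, l)" by (cases q, cases q')
  let ?g = "\<lambda>x. chi (x - (u*i+v)) * chi (x - (u*j+v)) * chi (x - (u*k+v)) * chi (x - (u*l+v))"
  have "periodic ?g"
    by (intro periodicI arg_cong2[of _ _ _ _ "(*)"] chi_cong) auto
  from sum_affine[OF this u, of v]
  have "(\<Sum>x\<in>F. ?g x) = (\<Sum>x\<in>F. ?g (u * x + v))" by simp
  also have "\<dots> = (\<Sum>x\<in>F. chi (x - i) * chi (x - j) * chi (x - k) * chi (x - l))"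
  proof (intro sum.cong refl)
    fix x
    have "u * x + v - (u * y + v) = u * (x - y)" for y by (simp add: algebra_simps)
    then have "?g (u * x + v) = (chi u * chi u) * (chi u * chi u) * (chi (x - i) * chi (x - j) * chi (x - k) * chi (x - l))"
      by (simp only: chi_mult) (simp add: mult_ac)
    then show "?g (u * x + v) = chi (x - i) * chi (x - j) * chi (x - k) * chi (x - l)"
      by (simp add: chi_square[OF u])
  qed
  finally show ?thesis by (simp add: q pair_char_sum_def affine_act_def char_sum_def)
qed

lemma periodic2_pair_char_sum: "periodic2 (\<lambda>q. pair_char_sum q q')" "periodic2 (\<lambda>q. pair_char_sum q' q)"
proof -
  show "periodic2 (\<lambda>q. pair_char_sum q q')"
    by (cases q', rule periodic2I)
      (auto simp: pair_char_sum_def char_sum_def intro!: sum.cong arg_cong2[of _ _ _ _ "(*)"] chi_cong simp: dvd_diff_commute)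
  show "periodic2 (\<lambda>q. pair_char_sum q' q)"
    by (cases q', rule periodic2I)
      (auto simp: pair_char_sum_def char_sum_def intro!: sum.cong arg_cong2[of _ _ _ _ "(*)"] chi_cong simp: dvd_diff_commute)
qed

lemma sq_norm_quad_op_affine_act:
  assumes b: "periodic2 b" and u: "\<not> P dvd u"
  shows "sq_norm (quad_op b) = (\<Sum>q\<in>FF. \<Sum>q'\<in>FF. (b (affine_act u v q) * b (affine_act u v q')) * (pair_char_sum q q')\<^sup>2)"
proof -
  have "(\<Sum>q\<in>FF. \<Sum>q'\<in>FF. (b (affine_act u v q) * b (affine_act u v q')) * (pair_char_sum q q')\<^sup>2)
      = (\<Sum>q\<in>FF. \<Sum>q'\<in>FF. (b (affine_act u v q) * b (affine_act u v q')) * (pair_char_sum (affine_act u v q) (affine_act u v q'))\<^sup>2)"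
    by (simp add: pair_char_sum_affine_act[OF u])
  also have "\<dots> = (\<Sum>q\<in>FF. \<Sum>q'\<in>FF. (b (affine_act u v q) * b q') * (pair_char_sum (affine_act u v q) q')\<^sup>2)"
    using b periodic2_pair_char_sum(2) by (intro sum.cong refl sum_FF_affine_act[OF _ u, of "\<lambda>q'. (b _ * b q') * (pair_char_sum _ q')\<^sup>2"]) (simp add: periodic2_def)
  also have "\<dots> = (\<Sum>q\<in>FF. \<Sum>q'\<in>FF. (b q * b q') * (pair_char_sum q q')\<^sup>2)"
    using b periodic2_pair_char_sum(1) by (intro sum_FF_affine_act[OF _ u, of "\<lambda>q. \<Sum>q'\<in>FF. (b q * b q') * (pair_char_sum q q')\<^sup>2"]) (simp add: periodic2_def)
  finally show ?thesis by (simp add: sq_norm_quad_op)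
qed

text \<open>A sum of rank-one matrices and the Gram matrix of its vectors have the same
  Hilbert-Schmidt norm.\<close>

lemma gram_swap:
  "(\<Sum>q\<in>A. \<Sum>q'\<in>A. (\<Sum>g\<in>G. f g q * f g q')\<^sup>2) = (\<Sum>g\<in>G. \<Sum>h\<in>G. (\<Sum>q\<in>A. f g q * (f h q :: real))\<^sup>2)"
proof -
  have "(\<Sum>q\<in>A. \<Sum>q'\<in>A. (\<Sum>g\<in>G. f g q * f g q')\<^sup>2)
      = (\<Sum>(q, q')\<in>A \<times> A. \<Sum>(g, h)\<in>G \<times> G. (f g q * f g q') * (f h q * f h q'))"
    by (simp add: power2_eq_square sum_product flip: sum.cartesian_product)
  also have "\<dots> = (\<Sum>(g, h)\<in>G \<times> G. \<Sum>(q, q')\<in>A \<times> A. (f g q * f h q) * (f g q' * f h q'))"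
    by (simp add: case_prod_unfold mult_ac) (rule sum.swap)
  also have "\<dots> = (\<Sum>g\<in>G. \<Sum>h\<in>G. (\<Sum>q\<in>A. f g q * f h q)\<^sup>2)"
    by (simp add: power2_eq_square sum_product flip: sum.cartesian_product)
  finally show ?thesis .
qed

text \<open>All affine images of \<open>b\<close> give the same value, so the trace bound is tested
  against the sum of their rank-one matrices. By near-orthogonality its squared Hilbert-Schmidt norm
  is at most |G| p times the fourth power of the norm of \<open>b\<close>, against |G|^2 in the
  trivial estimate. As |G| is about p^2, this gains a factor p over
  \<open>quad_op_crude\<close>.\<close>

lemma quad_op_mean_zero:
  assumes b: "periodic2 b" and mean: "\<And>d. (\<Sum>x\<in>F. b (x, x + d)) = 0"
  shows "(sq_norm (quad_op b))\<^sup>2 \<le> 960 * real p ^ 5 * (sq_norm b)\<^sup>2"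
proof -
  define G where "G = (F - {0}) \<times> F"
  define f where "f = (\<lambda>(u, v) q. b (affine_act u v q))"
  have card_G: "real (card G) = (real p - 1) * real p"
    using p_ge_5 by (simp add: G_def card_cartesian_product of_nat_diff)
  have nd: "\<not> P dvd u" if "(u, v) \<in> G" for u v
    using that dvd_F_iff by (auto simp: G_def)
  have "real (card G) * sq_norm (quad_op b) = (\<Sum>g\<in>G. sq_norm (quad_op b))" by simp
  also have "\<dots> = (\<Sum>g\<in>G. \<Sum>q\<in>FF. \<Sum>q'\<in>FF. (f g q * f g q') * (pair_char_sum q q')\<^sup>2)"
  proof (rule sum.cong[OF refl])
    fix g assume "g \<in> G"
    then show "sq_norm (quad_op b) = (\<Sum>q\<in>FF. \<Sum>q'\<in>FF. (f g q * f g q') * (pair_char_sum q q')\<^sup>2)"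
      using sq_norm_quad_op_affine_act[OF b nd, of "fst g" "snd g" "snd g"] by (simp add: f_def case_prod_unfold)
  qed
  also have "\<dots> = (\<Sum>q\<in>FF. \<Sum>g\<in>G. \<Sum>q'\<in>FF. (f g q * f g q') * (pair_char_sum q q')\<^sup>2)" by (rule sum.swap)
  also have "\<dots> = (\<Sum>q\<in>FF. \<Sum>q'\<in>FF. \<Sum>g\<in>G. (f g q * f g q') * (pair_char_sum q q')\<^sup>2)"
    by (intro sum.cong refl sum.swap)
  also have "\<dots> = (\<Sum>q\<in>FF. \<Sum>q'\<in>FF. (\<Sum>g\<in>G. f g q * f g q') * (pair_char_sum q q')\<^sup>2)"
    by (simp only: sum_distrib_right)
  finally have "(real (card G) * sq_norm (quad_op b))\<^sup>2
      \<le> (\<Sum>q\<in>FF. \<Sum>q'\<in>FF. (\<Sum>g\<in>G. f g q * f g q')\<^sup>2) * (\<Sum>q\<in>FF. \<Sum>q'\<in>FF. ((pair_char_sum q q')\<^sup>2)\<^sup>2)"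
    by (simp only: double_Cauchy_Schwarz)
  also have "\<dots> \<le> (real (card G) * (real p * (sq_norm b)\<^sup>2)) * (768 * real p ^ 6)"
  proof (intro mult_mono pair_char_sum_moment)
    have "(\<Sum>q\<in>FF. \<Sum>q'\<in>FF. (\<Sum>g\<in>G. f g q * f g q')\<^sup>2) = (\<Sum>g\<in>G. \<Sum>h\<in>G. (\<Sum>q\<in>FF. f g q * f h q)\<^sup>2)"
      by (rule gram_swap)
    also have "\<dots> \<le> (\<Sum>g\<in>G. real p * (sq_norm b)\<^sup>2)"
    proof (rule sum_mono)
      fix g assume "g \<in> G"
      have g: "f g = (\<lambda>q. b (affine_act (fst g) (snd g) q))" by (simp add: f_def case_prod_unfold)
      have "(\<Sum>h\<in>G. (\<Sum>q\<in>FF. f g q * f h q)\<^sup>2) = (\<Sum>u\<in>F - {0}. \<Sum>v\<in>F. (\<Sum>q\<in>FF. f g q * b (affine_act u v q))\<^sup>2)"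
        unfolding G_def by (simp add: sum.cartesian_product f_def case_prod_unfold)
      also have "\<dots> \<le> real p * sq_norm b * sq_norm (f g)"
        by (rule affine_near_orthogonality[OF b _ mean]) (simp add: g periodic2_affine_act b)
      also have "sq_norm (f g) = sq_norm b"
        unfolding g using \<open>g \<in> G\<close> by (intro sq_norm_affine_act b nd[of _ "snd g"]) simp
      finally show "(\<Sum>h\<in>G. (\<Sum>q\<in>FF. f g q * f h q)\<^sup>2) \<le> real p * (sq_norm b)\<^sup>2"
        by (simp add: power2_eq_square mult_ac)
    qed
    finally show "(\<Sum>q\<in>FF. \<Sum>q'\<in>FF. (\<Sum>g\<in>G. f g q * f g q')\<^sup>2) \<le> real (card G) * (real p * (sq_norm b)\<^sup>2)"
      by simp
  qed (auto intro!: sum_nonneg mult_nonneg_nonneg)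
  finally have "real (card G) * (real (card G) * (sq_norm (quad_op b))\<^sup>2) \<le> real (card G) * (768 * real p ^ 7 * (sq_norm b)\<^sup>2)"
    by (simp add: power2_eq_square mult_ac eval_nat_numeral)
  moreover have pos: "real (card G) > 0" using card_G p_ge_5 by simp
  ultimately have "real (card G) * (sq_norm (quad_op b))\<^sup>2 \<le> 768 * real p ^ 7 * (sq_norm b)\<^sup>2"
    by (simp only: mult_le_cancel_left_pos)
  \<comment> \<open>From p - 1 >= 4 p / 5, valid for p >= 5; this turns 768 into 960 = 768 * 5 /
    4.\<close>
  moreover have "4 / 5 * (real p * real p) * (sq_norm (quad_op b))\<^sup>2 \<le> real (card G) * (sq_norm (quad_op b))\<^sup>2"
  proof (intro mult_right_mono)
    have "5 * real p \<le> real p * real p" using p_ge_5 by (intro mult_right_mono) auto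
    then show "4 / 5 * (real p * real p) \<le> real (card G)"
      unfolding card_G by (simp add: algebra_simps)
  qed simp
  ultimately have "(real p * real p) * (sq_norm (quad_op b))\<^sup>2 \<le> (real p * real p) * (960 * real p ^ 5 * (sq_norm b)\<^sup>2)"
    by (simp add: eval_nat_numeral mult_ac)
  then show ?thesis by (rule mult_left_le_imp_le) (use p_ge_5 in simp)
qed


section \<open>Norms and the splitting off of the translation-invariant part\<close>

definition mat_norm :: "(int \<times> int \<Rightarrow> real) \<Rightarrow> real" where "mat_norm b = sqrt (sq_norm b)"

definition mat_inner :: "(int \<times> int \<Rightarrow> real) \<Rightarrow> (int \<times> int \<Rightarrow> real) \<Rightarrow> real" where
  "mat_inner b c = (\<Sum>q\<in>FF. b q * c q)"

text \<open>The common unit: its powers 2, 4, 5, 6 are p^(1/2), p, p^(5/4), p^(3/2), so all bounds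
  become monomials.\<close>

definition fourth_root_p :: real where "fourth_root_p = root 4 (real p)"

lemma fourth_root_p_pow4: "fourth_root_p ^ 4 = real p"
  by (simp add: fourth_root_p_def)

lemma fourth_root_p_ge_1: "1 \<le> fourth_root_p"
  using p_ge_5 by (simp add: fourth_root_p_def)

lemma mat_norm_L2: "mat_norm b = L2_set b FF"
  by (simp add: mat_norm_def sq_norm_def L2_set_def)

lemma mat_norm_nonneg [simp]: "0 \<le> mat_norm b" by (simp add: mat_norm_def)

lemma mat_norm_square: "(mat_norm b)\<^sup>2 = sq_norm b" by (simp add: mat_norm_def)

lemma mat_norm_triangle: "mat_norm (\<lambda>q. b q + c q) \<le> mat_norm b + mat_norm c"
  unfolding mat_norm_L2 by (rule L2_set_triangle_ineq)

lemma mat_norm_minus: "mat_norm (\<lambda>q. - b q) = mat_norm b" by (simp add: mat_norm_def sq_norm_def)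

lemma mat_norm_triangle_diff: "mat_norm (\<lambda>q. b q - c q) \<le> mat_norm b + mat_norm c"
  using mat_norm_triangle[of b "\<lambda>q. - c q"] by (simp add: mat_norm_minus)

lemma mat_inner_Cauchy_Schwarz: "\<bar>mat_inner b c\<bar> \<le> mat_norm b * mat_norm c"
proof -
  have "\<bar>mat_inner b c\<bar> \<le> (\<Sum>q\<in>FF. \<bar>b q\<bar> * \<bar>c q\<bar>)"
    unfolding mat_inner_def abs_mult[symmetric] by (rule sum_abs)
  also have "\<dots> \<le> mat_norm b * mat_norm c" unfolding mat_norm_L2 by (rule L2_set_mult_ineq)
  finally show ?thesis .
qed

lemma mat_inner_add_right: "mat_inner b (\<lambda>q. c q + d q) = mat_inner b c + mat_inner b d"
  and mat_inner_add_left: "mat_inner (\<lambda>q. c q + d q) b = mat_inner c b + mat_inner d b"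
  by (simp_all add: mat_inner_def sum.distrib algebra_simps)

lemma quad_op_add: "quad_op (\<lambda>q. b q + c q) = (\<lambda>q. quad_op b q + quad_op c q)"
  by (rule ext) (simp add: quad_op_def sum.distrib algebra_simps)

lemma quad_kernel_commute: "quad_kernel q q' = quad_kernel q' q"
  by (cases q, cases q') (simp add: quad_kernel_def chi_commute mult_ac)

lemma mat_inner_quad_op: "mat_inner b (quad_op c) = (\<Sum>q\<in>FF. \<Sum>q'\<in>FF. b q * c q' * quad_kernel q q')"
  by (simp add: mat_inner_def quad_op_def sum_distrib_left mult_ac)

lemma mat_inner_quad_op_commute: "mat_inner b (quad_op c) = mat_inner c (quad_op b)"
  unfolding mat_inner_quad_op by (subst sum.swap) (simp add: quad_kernel_commute mult_ac)

lemma mat_norm_quad_op_crude: "mat_norm (quad_op b) \<le> 6 * fourth_root_p ^ 6 * mat_norm b"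
proof (rule power_le_imp_le_base[where n = 3])
  have "mat_norm (quad_op b) ^ 4 = (sq_norm (quad_op b))\<^sup>2" by (simp add: mat_norm_def sq_norm_def sum_nonneg power4_eq_xxxx power2_eq_square flip: mult.assoc)
  also have "\<dots> \<le> 768 * real p ^ 6 * (sq_norm b)\<^sup>2" by (rule quad_op_crude)
  \<comment> \<open>Fourth powers are compared (\<open>n = 3\<close> stands for the exponent
    \<open>Suc 3\<close>), and 1296 = 6^4 is the next fourth power above 768; it also covers 960
    below.\<close>
  also have "\<dots> \<le> 1296 * real p ^ 6 * (sq_norm b)\<^sup>2" by (intro mult_right_mono) auto
  also have "\<dots> = (6 * fourth_root_p ^ 6 * mat_norm b) ^ 4"
    by (simp add: power_mult_distrib flip: fourth_root_p_pow4 mat_norm_square power_mult)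
  finally show "mat_norm (quad_op b) ^ Suc 3 \<le> (6 * fourth_root_p ^ 6 * mat_norm b) ^ Suc 3" by simp
qed (use fourth_root_p_ge_1 in auto)

lemma mat_norm_quad_op_mean_zero:
  assumes "periodic2 b" "\<And>d. (\<Sum>x\<in>F. b (x, x + d)) = 0"
  shows "mat_norm (quad_op b) \<le> 6 * fourth_root_p ^ 5 * mat_norm b"
proof (rule power_le_imp_le_base[where n = 3])
  have "mat_norm (quad_op b) ^ 4 = (sq_norm (quad_op b))\<^sup>2" by (simp add: mat_norm_def sq_norm_def sum_nonneg power4_eq_xxxx power2_eq_square flip: mult.assoc)
  also have "\<dots> \<le> 960 * real p ^ 5 * (sq_norm b)\<^sup>2" by (rule quad_op_mean_zero[OF assms])
  also have "\<dots> \<le> 1296 * real p ^ 5 * (sq_norm b)\<^sup>2" by (intro mult_right_mono) auto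
  also have "\<dots> = (6 * fourth_root_p ^ 5 * mat_norm b) ^ 4"
    by (simp add: power_mult_distrib flip: fourth_root_p_pow4 mat_norm_square power_mult)
  finally show "mat_norm (quad_op b) ^ Suc 3 \<le> (6 * fourth_root_p ^ 5 * mat_norm b) ^ Suc 3" by simp
qed (use fourth_root_p_ge_1 in auto)

text \<open>\<open>toeplitz (diag_avg b)\<close> is the orthogonal projection of \<open>b\<close> to
  the translation-invariant functions.\<close>

definition diag_avg :: "(int \<times> int \<Rightarrow> real) \<Rightarrow> int \<Rightarrow> real" where
  "diag_avg b d = (\<Sum>x\<in>F. b (x, x + d)) / real p"

definition toeplitz :: "(int \<Rightarrow> real) \<Rightarrow> int \<times> int \<Rightarrow> real" where
  "toeplitz f = (\<lambda>(x, y). f (y - x))"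

lemma periodic_diag_avg: assumes "periodic2 b" shows "periodic (diag_avg b)"
proof (rule periodicI)
  fix d d' assume "P dvd d - d'"
  then have "b (x, x + d) = b (x, x + d')" for x using assms by (intro periodic2_cong) auto
  then show "diag_avg b d = diag_avg b d'" by (simp add: diag_avg_def)
qed

lemma periodic2_toeplitz: assumes "periodic f" shows "periodic2 (toeplitz f)"
proof (rule periodic2I)
  fix x x' y y' assume "P dvd x - x'" "P dvd y - y'"
  then have "P dvd (y - y') - (x - x')" by (simp add: dvd_diff)
  then have "P dvd (y - x) - (y' - x')" by (simp add: algebra_simps)
  then show "toeplitz f (x, y) = toeplitz f (x', y')" using assms periodic_cong by (simp add: toeplitz_def)
qed

lemma sq_norm_toeplitz: assumes "periodic f" shows "sq_norm (toeplitz f) = real p * (\<Sum>d\<in>F. (f d)\<^sup>2)"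
proof -
  have "periodic2 (\<lambda>q. (toeplitz f q)\<^sup>2)" using periodic2_toeplitz[OF assms] by (simp add: periodic2_def)
  then show ?thesis unfolding sq_norm_def by (subst sum_FF_diag) (simp_all add: toeplitz_def sum_distrib_left)
qed

lemma sum_square_le: "(\<Sum>x\<in>F. f x)\<^sup>2 \<le> real p * (\<Sum>x\<in>F. (f x :: real)\<^sup>2)"
  using Cauchy_Schwarz_ineq_sum[of "\<lambda>_. 1" f F] by simp

lemma mat_norm_toeplitz_diag_avg: assumes b: "periodic2 b" shows "mat_norm (toeplitz (diag_avg b)) \<le> mat_norm b"
proof -
  have "sq_norm (toeplitz (diag_avg b)) = real p * (\<Sum>d\<in>F. (diag_avg b d)\<^sup>2)"
    by (rule sq_norm_toeplitz[OF periodic_diag_avg[OF b]])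
  also have "\<dots> \<le> (\<Sum>d\<in>F. \<Sum>x\<in>F. (b (x, x + d))\<^sup>2)"
    unfolding sum_distrib_left
  proof (rule sum_mono)
    fix d
    show "real p * (diag_avg b d)\<^sup>2 \<le> (\<Sum>x\<in>F. (b (x, x + d))\<^sup>2)"
      using sum_square_le[of "\<lambda>x. b (x, x + d)"] p_ge_5
      by (simp add: diag_avg_def power_divide divide_simps power2_eq_square mult_ac)
  qed
  also have "\<dots> = sq_norm b"
    unfolding sq_norm_def using b by (subst sum_FF_diag) (auto simp: periodic2_def)
  finally show ?thesis by (simp add: mat_norm_def)
qed

text \<open>Subtracting the projection makes every diagonal sum zero, at the cost of a factor 2 from
  the triangle inequality: 12 = 6 * 2.\<close>

lemma centered:
  assumes b: "periodic2 b"
  defines "b1 \<equiv> (\<lambda>q. b q - toeplitz (diag_avg b) q)"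
  shows "mat_norm (quad_op b1) \<le> 12 * fourth_root_p ^ 5 * mat_norm b"
proof -
  have per: "periodic2 b1"
    using b periodic2_toeplitz[OF periodic_diag_avg[OF b]] by (simp add: b1_def periodic2_def)
  have "(\<Sum>x\<in>F. b1 (x, x + d)) = 0" for d
    using p_ge_5 by (simp add: b1_def toeplitz_def sum_subtractf diag_avg_def)
  then have "mat_norm (quad_op b1) \<le> 6 * fourth_root_p ^ 5 * mat_norm b1" using per by (intro mat_norm_quad_op_mean_zero) auto
  also have "mat_norm b1 \<le> 2 * mat_norm b"
    using mat_norm_triangle_diff[of b "toeplitz (diag_avg b)"] mat_norm_toeplitz_diag_avg[OF b] by (simp add: b1_def)
  finally show ?thesis using fourth_root_p_ge_1 by (simp add: mult_left_mono)
qed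

text \<open>By \<open>sum_chi_chi\<close> the square of the matrix chi (i - j) is p I - J with J the
  all-ones matrix, and -J only helps.\<close>

lemma S_norm: "(\<Sum>y\<in>F. (\<Sum>s\<in>F. a s * chi (s - y))\<^sup>2) \<le> real p * (\<Sum>s\<in>F. (a s)\<^sup>2)"
proof -
  have "(\<Sum>y\<in>F. (\<Sum>s\<in>F. a s * chi (s - y))\<^sup>2) = (\<Sum>y\<in>F. \<Sum>s\<in>F. \<Sum>t\<in>F. (a s * a t) * (chi (y - s) * chi (y - t)))"
    unfolding power2_eq_square sum_product by (intro sum.cong refl) (simp add: mult_ac chi_commute)
  also have "\<dots> = (\<Sum>s\<in>F. \<Sum>y\<in>F. \<Sum>t\<in>F. (a s * a t) * (chi (y - s) * chi (y - t)))"
    by (rule sum.swap)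
  also have "\<dots> = (\<Sum>s\<in>F. \<Sum>t\<in>F. \<Sum>y\<in>F. (a s * a t) * (chi (y - s) * chi (y - t)))"
    by (intro sum.cong refl sum.swap)
  also have "\<dots> = (\<Sum>s\<in>F. \<Sum>t\<in>F. (if t = s then real p * (a s * a t) else 0) - a s * a t)"
  proof (intro sum.cong refl)
    fix s t assume "s \<in> F" "t \<in> F"
    then have "P dvd s - t \<longleftrightarrow> t = s" using F_eqI[of s t] by auto
    then show "(\<Sum>y\<in>F. (a s * a t) * (chi (y - s) * chi (y - t))) = (if t = s then real p * (a s * a t) else 0) - a s * a t"
      by (simp add: sum_chi_chi algebra_simps flip: sum_distrib_left)
  qed
  also have "\<dots> = real p * (\<Sum>s\<in>F. (a s)\<^sup>2) - (\<Sum>s\<in>F. a s)\<^sup>2"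
    unfolding power2_eq_square[of "\<Sum>s\<in>F. a s"] sum_product
    by (simp add: sum_subtractf power2_eq_square sum_distrib_left)
  finally show ?thesis by simp
qed


section \<open>Translation-invariant functions\<close>

text \<open>Inversion should exchange 0 and infinity, but \<open>recip\<close> fixes 0. Deleting the
  row and the column of 0 removes the pairs at which Moebius invariance fails.\<close>

definition punctured :: "(int \<Rightarrow> real) \<Rightarrow> int \<times> int \<Rightarrow> real" where
  "punctured f = (\<lambda>(x, y). if P dvd x \<or> P dvd y then 0 else f (y - x))"

definition inverted :: "(int \<Rightarrow> real) \<Rightarrow> int \<times> int \<Rightarrow> real" where
  "inverted f = (\<lambda>(x, y). punctured f (recip x, recip y))"

lemma dvd_cong: "P dvd x - y \<Longrightarrow> P dvd x \<longleftrightarrow> P dvd y"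
  by (metis mod_eq_dvd_iff dvd_mod_iff dvd_refl)

lemma periodic2_punctured: assumes "periodic f" shows "periodic2 (punctured f)"
proof (rule periodic2I)
  fix x x' y y' assume xy: "P dvd x - x'" "P dvd y - y'"
  then have "toeplitz f (x, y) = toeplitz f (x', y')" by (rule periodic2_cong[OF periodic2_toeplitz[OF assms]])
  then show "punctured f (x, y) = punctured f (x', y')"
    using dvd_cong[OF xy(1)] dvd_cong[OF xy(2)] by (simp add: punctured_def toeplitz_def)
qed

lemma periodic2_inverted: assumes "periodic f" shows "periodic2 (inverted f)"
  by (rule periodic2I)
    (simp add: inverted_def, intro periodic2_cong[OF periodic2_punctured[OF assms]] recip_cong)

lemma sum_FF_recip:
  assumes "periodic2 (h :: int \<times> int \<Rightarrow> real)"
  shows "(\<Sum>q\<in>FF. h (recip (fst q), recip (snd q))) = (\<Sum>q\<in>FF. h q)"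
  using assms by (rule sum_FF_reindex) (rule recip_inj)

lemma sq_norm_inverted: assumes "periodic f" shows "sq_norm (inverted f) = sq_norm (punctured f)"
proof -
  have "periodic2 (\<lambda>q. (punctured f q)\<^sup>2)" using periodic2_punctured[OF assms] by (simp add: periodic2_def)
  from sum_FF_recip[OF this] show ?thesis by (simp add: sq_norm_def inverted_def case_prod_unfold)
qed

lemma sq_norm_punctured_le: "sq_norm (punctured f) \<le> sq_norm (toeplitz f)"
  unfolding sq_norm_def by (intro sum_mono) (auto simp: punctured_def toeplitz_def)

text \<open>One row and one column carry the squared norm of f each, a share 2 / p of that of
  \<open>toeplitz f\<close>.\<close>

lemma sq_norm_toeplitz_minus_punctured:
  assumes f: "periodic f"
  shows "sq_norm (\<lambda>q. toeplitz f q - punctured f q) \<le> 2 * (\<Sum>d\<in>F. (f d)\<^sup>2)"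
proof -
  have f2: "periodic (\<lambda>d. (f d)\<^sup>2)" using f by (simp add: periodic_def)
  have "sq_norm (\<lambda>q. toeplitz f q - punctured f q)
      = (\<Sum>x\<in>F. \<Sum>y\<in>F. (if x = 0 \<or> y = 0 then (f (y - x))\<^sup>2 else 0))"
    unfolding sq_norm_def sum_FF
    by (intro sum.cong refl) (auto simp: toeplitz_def punctured_def dvd_F_iff simp del: atLeastLessThan_iff)
  also have "\<dots> \<le> (\<Sum>x\<in>F. \<Sum>y\<in>F. (if x = 0 then (f y)\<^sup>2 else 0) + (if y = 0 then (f (0 - x))\<^sup>2 else 0))"
    by (intro sum_mono) auto
  also have "\<dots> = (\<Sum>y\<in>F. \<Sum>x\<in>F. (if x = 0 then (f y)\<^sup>2 else 0)) + (\<Sum>x\<in>F. \<Sum>y\<in>F. (if y = 0 then (f (0 - x))\<^sup>2 else 0))"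
    unfolding sum.distrib by (subst (1) sum.swap) simp
  also have "\<dots> = (\<Sum>y\<in>F. (f y)\<^sup>2) + (\<Sum>x\<in>F. (f (0 - x))\<^sup>2)"
    using p_ge_5 by (simp add: sum.delta)
  also have "(\<Sum>x\<in>F. (f (0 - x))\<^sup>2) = (\<Sum>d\<in>F. (f d)\<^sup>2)" by (rule sum_reflect[OF f2])
  finally show ?thesis by simp
qed

text \<open>1/x - 1/y = (y - x) / (x y), and dividing by x y has the same effect on
  \<open>chi\<close> as multiplying.\<close>

lemma chi_recip_diff:
  assumes "\<not> P dvd x" "\<not> P dvd y"
  shows "chi (recip x - recip y) = chi x * chi y * chi (x - y)"
proof -
  have "P dvd (- y) * (x * recip x - 1) + x * (y * recip y - 1)"
    by (intro dvd_add dvd_mult recip_mult assms)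
  moreover have "(- y) * (x * recip x - 1) + x * (y * recip y - 1) = (y - x) - x * y * (recip x - recip y)"
    by (simp add: algebra_simps)
  ultimately have "chi (y - x) = chi (x * y * (recip x - recip y))"
    by (intro chi_cong) simp
  then have "chi x * chi y * chi (y - x) = (chi x * chi x) * (chi y * chi y) * chi (recip x - recip y)"
    by (simp add: chi_mult mult_ac)
  then show ?thesis by (simp add: chi_square assms chi_commute)
qed

text \<open>The kernel \<^term>\<open>quad_kernel\<close> is a function of the cross ratio of its four arguments, hence invariant
  under all Moebius transformations and not only under affine maps.\<close>

lemma quad_kernel_recip:
  assumes "\<not> P dvd i" "\<not> P dvd j" "\<not> P dvd k" "\<not> P dvd l"
  shows "quad_kernel (recip i, recip j) (recip k, recip l) = quad_kernel (i, j) (k, l)"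
proof -
  have "quad_kernel (recip i, recip j) (recip k, recip l)
      = (chi i * chi i) * (chi j * chi j) * (chi k * chi k) * (chi l * chi l) * quad_kernel (i, j) (k, l)"
    by (simp add: quad_kernel_def chi_recip_diff assms mult_ac)
  then show ?thesis by (simp add: chi_square assms)
qed

lemma periodic2_quad_kernel: "periodic2 (\<lambda>q. quad_kernel q q')" "periodic2 (\<lambda>q. quad_kernel q' q)"
  by (cases q', rule periodic2I,
      auto simp: quad_kernel_def intro!: arg_cong2[of _ _ _ _ "(*)"] chi_cong simp: dvd_diff_commute)+

text \<open>After substituting inverses in all four entries, terms with an entry divisible by p
  vanish on both sides because of the puncturing; the others agree by
  \<open>quad_kernel_recip\<close>.\<close>

lemma mat_inner_quad_op_inverted:
  assumes f: "periodic f"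
  shows "mat_inner (inverted f) (quad_op (inverted f)) = mat_inner (punctured f) (quad_op (punctured f))"
proof -
  let ?e = "punctured f" and ?R = "\<lambda>q. (recip (fst q), recip (snd q))"
  note e = periodic2_punctured[OF f]
  have "(\<Sum>q\<in>FF. \<Sum>q'\<in>FF. ?e q * ?e q' * quad_kernel q q') = (\<Sum>q\<in>FF. \<Sum>q'\<in>FF. ?e (?R q) * ?e q' * quad_kernel (?R q) q')"
    using e periodic2_quad_kernel by (intro sum_FF_recip[symmetric, of "\<lambda>q. \<Sum>q'\<in>FF. ?e q * ?e q' * quad_kernel q q'"]) (simp add: periodic2_def)
  also have "\<dots> = (\<Sum>q\<in>FF. \<Sum>q'\<in>FF. ?e (?R q) * ?e (?R q') * quad_kernel (?R q) (?R q'))"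
    using e periodic2_quad_kernel by (intro sum.cong refl sum_FF_recip[symmetric, of "\<lambda>q'. ?e _ * ?e q' * quad_kernel _ q'"]) (simp add: periodic2_def)
  also have "\<dots> = (\<Sum>q\<in>FF. \<Sum>q'\<in>FF. inverted f q * inverted f q' * quad_kernel q q')"
  proof (intro sum.cong refl)
    fix q q' :: "int \<times> int"
    obtain i j k l where q: "q = (i, j)" "q' = (k, l)" by (cases q, cases q')
    show "?e (?R q) * ?e (?R q') * quad_kernel (?R q) (?R q') = inverted f q * inverted f q' * quad_kernel q q'"
    proof (cases "P dvd i \<or> P dvd j \<or> P dvd k \<or> P dvd l")
      case True
      then show ?thesis unfolding q by (auto simp: inverted_def punctured_def recip_dvd_iff)
    next
      case False
      then show ?thesis unfolding q by (simp add: inverted_def quad_kernel_recip)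
    qed
  qed
  finally show ?thesis by (simp add: mat_inner_quad_op)
qed

text \<open>This shows that inversion almost destroys translation invariance. One has 1 / (x + d) -
  1 / x = -4 d / z with z = 4 x (x + d) = (2 x + d)^2 - d^2. Summing over the squares (2 x + d)^2
  weighs each value by 1 + chi: the 1 gives a term independent of d, and the \<open>chi\<close>
  gives the matrix chi (s - y) applied to f chi at y = 4 / d, which is small on average over
  d.\<close>

lemma sum_inverted_shift:
  assumes f: "periodic f" and f0: "f 0 = 0" and d: "\<not> P dvd d"
  shows "(\<Sum>x\<in>F. inverted f (x, x + d)) = (\<Sum>s\<in>F. f s) + (\<Sum>s\<in>F. f s * chi s * chi (s - 4 * recip d))"
proof -
  \<comment> \<open>The diagonal values as a function of z; the value 0 at z = 0 reproduces the
    puncturing.\<close>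
  define h where "h a = (if P dvd a then 0 else f (- 4 * d * recip a))" for a
  have h: "periodic h"
  proof (rule periodicI)
    fix a b assume ab: "P dvd a - b"
    have "f (- 4 * d * recip a) = f (- 4 * d * recip b)"
      by (rule periodic_cong[OF f]) (simp add: recip_cong[OF ab] flip: right_diff_distrib del: mult_minus_left)
    then show "h a = h b" using dvd_cong[OF ab] by (simp add: h_def)
  qed
  have step: "inverted f (x, x + d) = h ((2 * x + d)\<^sup>2 - d\<^sup>2)" for x
  proof -
    define z where "z = 4 * x * (x + d)"
    have z: "(2 * x + d)\<^sup>2 - d\<^sup>2 = z" by (simp add: z_def power2_eq_square algebra_simps)
    have dz: "P dvd z \<longleftrightarrow> P dvd x \<or> P dvd x + d" using not_dvd_4 by (simp add: z_def dvd_mult_iff)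
    show ?thesis
    proof (cases "P dvd z")
      case True
      then show ?thesis unfolding z h_def using dz by (auto simp: inverted_def punctured_def recip_dvd_iff)
    next
      case False
      then have nx: "\<not> P dvd x" "\<not> P dvd x + d" using dz by auto
      \<comment> \<open>The combination equals z times the difference of the two expressions for the
        argument of f, and z is invertible.\<close>
      have "P dvd 4 * x * ((x + d) * recip (x + d) - 1) + (- 4 * (x + d)) * (x * recip x - 1)
          + 4 * d * (z * recip z - 1)"
        by (intro dvd_add dvd_mult recip_mult nx False)
      also have "4 * x * ((x + d) * recip (x + d) - 1) + (- 4 * (x + d)) * (x * recip x - 1)
          + 4 * d * (z * recip z - 1) = z * ((recip (x + d) - recip x) - (- 4 * d * recip z))"
        by (simp add: z_def algebra_simps)
      finally have "P dvd (recip (x + d) - recip x) - (- 4 * d * recip z)"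
        using False by (simp only: dvd_mult_iff) blast
      then have "f (recip (x + d) - recip x) = f (- 4 * d * recip z)" by (rule periodic_cong[OF f])
      then show ?thesis unfolding z using nx False by (simp add: inverted_def punctured_def recip_dvd_iff h_def)
    qed
  qed
  have p1: "periodic (\<lambda>y. h (y\<^sup>2 - d\<^sup>2))"
  proof (rule periodicI, rule periodic_cong[OF h])
    fix a b assume "P dvd a - b"
    then have "P dvd (a - b) * (a + b)" by simp
    then show "P dvd a\<^sup>2 - d\<^sup>2 - (b\<^sup>2 - d\<^sup>2)" by (simp add: power2_eq_square algebra_simps)
  qed
  have p2: "periodic (\<lambda>a. h (a - d\<^sup>2))" by (rule periodicI, rule periodic_cong[OF h]) simp
  have p3: "periodic (\<lambda>a. (1 + chi a) * h (a - d\<^sup>2))"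
    using p2 periodic_chi by (simp add: periodic_def)
  have p4: "periodic (\<lambda>a. (1 + chi (a + d\<^sup>2)) * h a)"
    using h chi_cong by (intro periodicI arg_cong2[of _ _ _ _ "(*)"] periodic_cong[OF h] arg_cong2[of _ _ _ _ "(+)"] refl chi_cong) auto
  have "(\<Sum>x\<in>F. inverted f (x, x + d)) = (\<Sum>x\<in>F. h ((2 * x + d)\<^sup>2 - d\<^sup>2))" by (simp only: step)
  also have "\<dots> = (\<Sum>y\<in>F. h (y\<^sup>2 - d\<^sup>2))" by (rule sum_affine[OF p1 not_dvd_2])
  also have "\<dots> = (\<Sum>a\<in>F. (1 + chi a) * h (a - d\<^sup>2))" by (rule sum_squares[OF p2])
  also have "\<dots> = (\<Sum>a\<in>F. (1 + chi (a + d\<^sup>2)) * h a)"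
    using sum_shift[OF p3, of "d\<^sup>2"] by simp
  also have "\<dots> = (\<Sum>s\<in>F. (1 + chi (- 4 * d * s + d\<^sup>2)) * h (- 4 * d * s))"
    using sum_affine[OF p4, of "- 4 * d" 0] d not_dvd_4 by (simp add: dvd_mult_iff)
  also have "\<dots> = (\<Sum>s\<in>F. (1 + chi (- 4 * d * recip s + d\<^sup>2)) * h (- 4 * d * recip s))"
  proof (rule sum_recip[symmetric], rule periodicI)
    fix a b assume "P dvd a - b"
    then have "P dvd (- 4 * d) * (a - b)" by (rule dvd_mult)
    then have ab: "P dvd - 4 * d * a - - 4 * d * b" by (simp only: right_diff_distrib)
    then show "(1 + chi (- 4 * d * a + d\<^sup>2)) * h (- 4 * d * a) = (1 + chi (- 4 * d * b + d\<^sup>2)) * h (- 4 * d * b)"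
      by (rule periodic_cong[OF p4])
  qed
  also have "\<dots> = (\<Sum>s\<in>F. f s + f s * chi s * chi (s - 4 * recip d))"
  proof (rule sum.cong[OF refl])
    fix s assume s: "s \<in> F"
    show "(1 + chi (- 4 * d * recip s + d\<^sup>2)) * h (- 4 * d * recip s) = f s + f s * chi s * chi (s - 4 * recip d)"
    \<comment> \<open>At s = 0 the left side is 0 because \<open>h\<close> vanishes at 0; the right
      side is 0 because \<open>f 0 = 0\<close>.\<close>
    proof (cases "P dvd s")
      case True
      then have "f s = 0" using dvd_F_iff[OF s] f0 by simp
      then show ?thesis using True by (simp add: h_def recip_dvd_iff)
    next
      case False
      define a where "a = - 4 * d * recip s"
      have na: "\<not> P dvd a"
        using d False not_dvd_4 by (simp add: a_def dvd_mult_iff recip_dvd_iff)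
      have "P dvd (- s) * (a * recip a - 1) + (- 4 * d * recip a) * (s * recip s - 1)"
        by (intro dvd_add dvd_mult recip_mult na False)
      also have "(- s) * (a * recip a - 1) + (- 4 * d * recip a) * (s * recip s - 1) = s - (- 4 * d * recip a)"
        by (simp add: a_def algebra_simps)
      finally have "f s = f (- 4 * d * recip a)" by (rule periodic_cong[OF f])
      then have hf: "h a = f s" using na by (simp add: h_def)
      let ?r = "recip d"
      have nr: "\<not> P dvd s * ?r" using d False by (simp add: dvd_mult_iff recip_dvd_iff)
      \<comment> \<open>Certificate for (s / d)^2 (a + d^2) = s (s - 4 / d), where a = -4 d / s; the
        factor s / d is removed as a square.\<close>
      have "P dvd (s * s * (1 + d * ?r)  - 4 * s * ?r * (s * recip s)) * (d * ?r - 1) + (- 4 * s * ?r) * (s * recip s - 1)"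
        by (intro dvd_add dvd_mult recip_mult d False)
      also have "(s * s * (1 + d * ?r) - 4 * s * ?r * (s * recip s)) * (d * ?r - 1) + (- 4 * s * ?r) * (s * recip s - 1)
          = (s * ?r) * (s * ?r) * (a + d\<^sup>2) - s * (s - 4 * ?r)"
        by (simp add: a_def algebra_simps power2_eq_square)
      finally have "chi ((s * ?r) * (s * ?r) * (a + d\<^sup>2)) = chi (s * (s - 4 * ?r))" by (rule chi_cong)
      then have "chi (a + d\<^sup>2) = chi s * chi (s - 4 * ?r)"
        using chi_square[OF nr] by (simp only: chi_mult)
      then show ?thesis using hf by (simp add: a_def algebra_simps)
    qed
  qed
  finally show ?thesis by (simp add: sum.distrib)
qed


lemma sum_quad_kernel: assumes "\<not> P dvd i - j" shows "(\<Sum>q'\<in>FF. quad_kernel (i, j) q') = 1"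
proof -
  have "(\<Sum>q'\<in>FF. quad_kernel (i, j) q') = (\<Sum>k\<in>F. chi (k - i) * chi (k - j))\<^sup>2"
    unfolding sum_FF quad_kernel_def power2_eq_square sum_product prod.case
    by (intro sum.cong refl) (simp add: mult_ac chi_commute)
  then show ?thesis using assms by (simp add: sum_chi_chi)
qed

text \<open>T fixes constants off the diagonal, where its row sums are (-1)^2 = 1, and on the
  diagonal \<open>b\<close> vanishes. What remains is m times the sum of \<open>b\<close>.\<close>

lemma mat_inner_quad_op_const:
  assumes "\<And>x. b (x, x) = 0"
  shows "\<bar>mat_inner b (quad_op (\<lambda>_. m))\<bar> \<le> \<bar>m\<bar> * real p * mat_norm b"
proof -
  have "b q * quad_op (\<lambda>_. m) q = m * b q" if "q \<in> FF" for q
  proof -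
    obtain i j where q: "q = (i, j)" by (cases q)
    show ?thesis
    proof (cases "i = j")
      case False
      then have "\<not> P dvd i - j" using F_eqI[of i j] that q by auto
      then show ?thesis by (simp add: q quad_op_def sum_quad_kernel flip: sum_distrib_right)
    qed (simp add: q assms)
  qed
  then have eq: "mat_inner b (quad_op (\<lambda>_. m)) = m * (\<Sum>q\<in>FF. b q)"
    unfolding mat_inner_def sum_distrib_left by (intro sum.cong refl)
  have "(\<Sum>q\<in>FF. b q)\<^sup>2 \<le> (real p * mat_norm b)\<^sup>2"
    using Cauchy_Schwarz_ineq_sum[of "\<lambda>_. 1" b FF]
    by (simp add: power_mult_distrib mat_norm_square sq_norm_def card_cartesian_product power2_eq_square[of "real p"])
  then have "\<bar>\<Sum>q\<in>FF. b q\<bar> \<le> real p * mat_norm b"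
    using abs_le_square_iff[of "\<Sum>q\<in>FF. b q" "real p * mat_norm b"] by simp
  then show ?thesis by (simp add: eq abs_mult mult.assoc mult_left_mono)
qed

lemma mat_norm_bound_of_sq_norm:
  assumes "sq_norm D \<le> 2 * s" "real p * s = sq_norm B" shows "fourth_root_p\<^sup>2 * mat_norm D \<le> 2 * mat_norm B"
proof (rule power2_le_imp_le)
  have "(fourth_root_p\<^sup>2 * mat_norm D)\<^sup>2 = real p * sq_norm D"
    by (simp add: power_mult_distrib mat_norm_square flip: fourth_root_p_pow4 power_mult)
  also have "\<dots> \<le> real p * (2 * s)" using assms by (intro mult_left_mono) auto
  also have "\<dots> \<le> (2 * mat_norm B)\<^sup>2" using assms sq_norm_nonneg[of B] by (simp add: power_mult_distrib mat_norm_square mult.commute)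
  finally show "(fourth_root_p\<^sup>2 * mat_norm D)\<^sup>2 \<le> (2 * mat_norm B)\<^sup>2" .
qed simp

text \<open>In the applications B is \<open>toeplitz f\<close> and s the squared norm of f. D is
  then smaller than B by a factor of order sqrt p, so even the crude bound p^(3/2) yields order p,
  relaxed here to p^(5/4); 12 = 6 * 2.\<close>

lemma mat_inner_quad_op_small:
  assumes "sq_norm D \<le> 2 * s" "real p * s = sq_norm B" and c: "mat_norm c \<le> mat_norm B"
  shows "\<bar>mat_inner c (quad_op D)\<bar> \<le> 12 * fourth_root_p ^ 5 * sq_norm B"
proof -
  have "\<bar>mat_inner c (quad_op D)\<bar> \<le> mat_norm c * mat_norm (quad_op D)" by (rule mat_inner_Cauchy_Schwarz)
  also have "\<dots> \<le> mat_norm B * (6 * fourth_root_p ^ 6 * mat_norm D)" by (intro mult_mono c mat_norm_quad_op_crude) auto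
  also have "\<dots> = mat_norm B * (6 * fourth_root_p ^ 4 * (fourth_root_p\<^sup>2 * mat_norm D))" by (simp add: eval_nat_numeral)
  also have "\<dots> \<le> mat_norm B * (6 * fourth_root_p ^ 4 * (2 * mat_norm B))"
    using fourth_root_p_ge_1 by (intro mult_left_mono mat_norm_bound_of_sq_norm[OF assms(1,2)]) auto
  also have "\<dots> = 12 * fourth_root_p ^ 4 * sq_norm B" by (simp add: power2_eq_square flip: mat_norm_square)
  also have "\<dots> \<le> 12 * fourth_root_p ^ 5 * sq_norm B"
    using fourth_root_p_ge_1 by (intro mult_right_mono mult_left_mono power_increasing) auto
  finally show ?thesis .
qed

text \<open>The inverted function splits into a part with zero diagonal sums, a constant m, and a
  small translation-invariant remainder \<open>toeplitz delta\<close>. Their contributions give 25 =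
  12 + 1 + 12.\<close>

lemma mat_inner_quad_op_inverted_le:
  assumes f: "periodic f" and f0: "f 0 = 0"
  shows "\<bar>mat_inner (inverted f) (quad_op (inverted f))\<bar> \<le> 25 * fourth_root_p ^ 5 * sq_norm (toeplitz f)"
proof -
  define B where "B = toeplitz f"
  define c where "c = inverted f"
  define s where "s = (\<Sum>d\<in>F. (f d)\<^sup>2)"
  define m where "m = (\<Sum>d\<in>F. f d) / real p"
  define delta where "delta d = diag_avg c d - m" for d
  define c1 where "c1 = (\<lambda>q. c q - toeplitz (diag_avg c) q)"
  have pc: "periodic2 c" unfolding c_def by (rule periodic2_inverted[OF f])
  have B: "real p * s = sq_norm B" unfolding B_def s_def by (rule sq_norm_toeplitz[OF f, symmetric])
  have c_le: "mat_norm c \<le> mat_norm B"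
    using sq_norm_inverted[OF f] sq_norm_punctured_le[of f] by (simp add: mat_norm_def c_def B_def)
  have diag: "c (x, x) = 0" for x by (simp add: c_def inverted_def punctured_def f0)
  have pd: "periodic delta"
    using periodic_diag_avg[OF pc] by (simp add: delta_def periodic_def)
  have m2: "m\<^sup>2 \<le> s / real p"
    using sum_square_le[of f] p_ge_5 by (simp add: m_def s_def power_divide divide_simps power2_eq_square mult_ac)
  \<comment> \<open>The formula of \<open>sum_inverted_shift\<close> needs d nonzero; at d = 0 the
    diagonal of \<open>c\<close> vanishes and -m remains.\<close>
  have "delta 0 = - m" by (simp add: delta_def diag_avg_def diag)
  have delta: "delta d = (\<Sum>s\<in>F. f s * chi s * chi (s - 4 * recip d)) / real p" if "d \<in> F" "d \<noteq> 0" for d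
  proof -
    have "\<not> P dvd d" using that dvd_F_iff by simp
    from sum_inverted_shift[OF f f0 this] show ?thesis
      by (simp add: delta_def diag_avg_def c_def m_def add_divide_distrib)
  qed
  \<comment> \<open>One share s / p comes from d nonzero, where d to 4 / d is a permutation and
    \<open>S_norm\<close> applies, the other from delta 0 = -m.\<close>
  have "(\<Sum>d\<in>F. (delta d)\<^sup>2) \<le> 2 * s / real p"
  proof -
    define w where "w y = (\<Sum>s\<in>F. f s * chi s * chi (s - y))\<^sup>2" for y
    have pw: "periodic w"
    proof (rule periodicI)
      fix a b assume "P dvd a - b"
      then have "P dvd b - a" by (simp only: dvd_diff_commute)
      then have "chi (t - a) = chi (t - b)" for t by (intro chi_cong) simp
      then show "w a = w b" by (simp add: w_def)
    qed
    have pw4: "periodic (\<lambda>x. w (4 * x))"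
    proof (rule periodicI)
      fix a b assume "P dvd a - b"
      then have "P dvd 4 * (a - b)" by (rule dvd_mult)
      then have "P dvd 4 * a - 4 * b" by (simp only: right_diff_distrib)
      then show "w (4 * a) = w (4 * b)" by (rule periodic_cong[OF pw])
    qed
    have "(\<Sum>d\<in>F - {0}. (delta d)\<^sup>2) = (\<Sum>d\<in>F - {0}. w (4 * recip d) / (real p)\<^sup>2)"
      by (intro sum.cong refl) (simp add: delta power_divide w_def)
    also have "\<dots> \<le> (\<Sum>d\<in>F. w (4 * recip d) / (real p)\<^sup>2)"
      by (intro sum_mono2) (auto simp: w_def)
    also have "\<dots> = (\<Sum>d\<in>F. w (4 * recip d)) / (real p)\<^sup>2" by (simp only: sum_divide_distrib)
    also have "(\<Sum>d\<in>F. w (4 * recip d)) = (\<Sum>d\<in>F. w (4 * d))" by (rule sum_recip[OF pw4])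
    also have "\<dots> = (\<Sum>y\<in>F. w y)" using sum_affine[OF pw not_dvd_4, of 0] by simp
    also have "\<dots> \<le> real p * (\<Sum>s\<in>F. (f s * chi s)\<^sup>2)" unfolding w_def by (rule S_norm)
    also have "(\<Sum>s\<in>F. (f s * chi s)\<^sup>2) \<le> s"
      unfolding s_def using abs_chi_le by (intro sum_mono) (simp add: power_mult_distrib abs_square_le_1 mult_left_le)
    finally have "(\<Sum>d\<in>F - {0}. (delta d)\<^sup>2) \<le> s / real p"
      using p_ge_5 by (simp add: divide_simps power2_eq_square mult_ac)
    then show ?thesis using m2 \<open>delta 0 = - m\<close> sum_split_0[of "\<lambda>d. (delta d)\<^sup>2"] by simp
  qed
  then have "real p * (\<Sum>d\<in>F. (delta d)\<^sup>2) \<le> real p * (2 * s / real p)" by (rule mult_left_mono) simp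
  then have D: "sq_norm (toeplitz delta) \<le> 2 * s" unfolding sq_norm_toeplitz[OF pd] using p_ge_5 by simp
  have "c = (\<lambda>q. c1 q + (m + toeplitz delta q))"
    by (rule ext) (simp add: c1_def delta_def toeplitz_def case_prod_unfold)
  from arg_cong[OF this, of "\<lambda>z. mat_inner c (quad_op z)"]
  have "mat_inner c (quad_op c) = mat_inner c (quad_op c1) + (mat_inner c (quad_op (\<lambda>_. m)) + mat_inner c (quad_op (toeplitz delta)))"
    by (simp only: quad_op_add mat_inner_add_right)
  moreover have "\<bar>mat_inner c (quad_op c1)\<bar> \<le> 12 * fourth_root_p ^ 5 * sq_norm B"
  proof -
    have "\<bar>mat_inner c (quad_op c1)\<bar> \<le> mat_norm c * mat_norm (quad_op c1)" by (rule mat_inner_Cauchy_Schwarz)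
    also have "\<dots> \<le> mat_norm B * (12 * fourth_root_p ^ 5 * mat_norm B)"
      using centered[OF pc] c_le fourth_root_p_ge_1
      by (intro mult_mono order_trans[OF centered[OF pc, folded c1_def] mult_left_mono]) auto
    finally show ?thesis by (simp add: power2_eq_square mult_ac flip: mat_norm_square)
  qed
  moreover have "\<bar>mat_inner c (quad_op (\<lambda>_. m))\<bar> \<le> fourth_root_p ^ 5 * sq_norm B"
  proof -
    have "\<bar>mat_inner c (quad_op (\<lambda>_. m))\<bar> \<le> \<bar>m\<bar> * real p * mat_norm c" by (rule mat_inner_quad_op_const) (rule diag)
    also have "\<bar>m\<bar> * real p \<le> mat_norm B"
    proof (rule power2_le_imp_le)
      have "(\<bar>m\<bar> * real p)\<^sup>2 \<le> (s / real p) * (real p)\<^sup>2"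
        unfolding power_mult_distrib power2_abs using m2 by (rule mult_right_mono) simp
      also have "\<dots> = real p * s" using p_ge_5 by (simp add: power2_eq_square)
      finally show "(\<bar>m\<bar> * real p)\<^sup>2 \<le> (mat_norm B)\<^sup>2" by (simp only: B mat_norm_square)
    qed simp
    then have "\<bar>m\<bar> * real p * mat_norm c \<le> mat_norm B * mat_norm B" using c_le by (intro mult_mono) auto
    also have "\<dots> = 1 * sq_norm B" by (simp add: power2_eq_square flip: mat_norm_square)
    also have "\<dots> \<le> fourth_root_p ^ 5 * sq_norm B" using fourth_root_p_ge_1 by (intro mult_right_mono) auto
    finally show ?thesis by simp
  qed
  moreover have "\<bar>mat_inner c (quad_op (toeplitz delta))\<bar> \<le> 12 * fourth_root_p ^ 5 * sq_norm B"
    by (rule mat_inner_quad_op_small[OF D B c_le])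
  ultimately show ?thesis unfolding B_def[symmetric] c_def[symmetric] by linarith
qed

text \<open>Replacing B by its punctured form on both sides costs two small terms: 49 = 25 + 12 +
  12.\<close>

lemma mat_inner_quad_op_toeplitz_le:
  assumes f: "periodic f" and f0: "f 0 = 0"
  shows "\<bar>mat_inner (toeplitz f) (quad_op (toeplitz f))\<bar> \<le> 49 * fourth_root_p ^ 5 * sq_norm (toeplitz f)"
proof -
  define B where "B = toeplitz f"
  define e where "e = punctured f"
  define e' where "e' = (\<lambda>q. B q - e q)"
  define s where "s = (\<Sum>d\<in>F. (f d)\<^sup>2)"
  have B: "real p * s = sq_norm B" unfolding B_def s_def by (rule sq_norm_toeplitz[OF f, symmetric])
  have e': "sq_norm e' \<le> 2 * s" unfolding e'_def B_def e_def s_def by (rule sq_norm_toeplitz_minus_punctured[OF f])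
  have e: "mat_norm e \<le> mat_norm B" using sq_norm_punctured_le[of f] by (simp add: mat_norm_def e_def B_def)
  have eq: "B = (\<lambda>q. e q + e' q)" by (simp add: e'_def)
  from arg_cong[OF eq, of "\<lambda>z. mat_inner B (quad_op z)"]
  have "mat_inner B (quad_op B) = mat_inner B (quad_op e) + mat_inner B (quad_op e')"
    by (simp only: quad_op_add mat_inner_add_right)
  also have "mat_inner B (quad_op e) = mat_inner e (quad_op B)" by (rule mat_inner_quad_op_commute)
  also have "\<dots> = mat_inner e (quad_op e) + mat_inner e (quad_op e')"
    using arg_cong[OF eq, of "\<lambda>z. mat_inner e (quad_op z)"] by (simp only: quad_op_add mat_inner_add_right)
  finally have "mat_inner B (quad_op B) = mat_inner e (quad_op e) + mat_inner e (quad_op e') + mat_inner B (quad_op e')" .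
  moreover have "\<bar>mat_inner e (quad_op e)\<bar> \<le> 25 * fourth_root_p ^ 5 * sq_norm B"
    using mat_inner_quad_op_inverted_le[OF f f0] mat_inner_quad_op_inverted[OF f] by (simp add: e_def B_def)
  moreover have "\<bar>mat_inner e (quad_op e')\<bar> \<le> 12 * fourth_root_p ^ 5 * sq_norm B" by (rule mat_inner_quad_op_small[OF e' B e])
  moreover have "\<bar>mat_inner B (quad_op e')\<bar> \<le> 12 * fourth_root_p ^ 5 * sq_norm B" by (rule mat_inner_quad_op_small[OF e' B order_refl])
  ultimately show ?thesis unfolding B_def[symmetric] by linarith
qed

text \<open>The centred part is bounded on either side, T being symmetric; the invariant part has
  symbol \<open>diag_avg b\<close>, which vanishes at 0 like the diagonal of \<open>b\<close>. Hence
  73 = 49 + 12 + 12.\<close>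

lemma mat_inner_quad_op_le:
  assumes b: "periodic2 b" and diag: "\<And>x. b (x, x) = 0"
  shows "\<bar>mat_inner b (quad_op b)\<bar> \<le> 73 * fourth_root_p ^ 5 * sq_norm b"
proof -
  define b0 where "b0 = toeplitz (diag_avg b)"
  define b1 where "b1 = (\<lambda>q. b q - b0 q)"
  have b0: "mat_norm b0 \<le> mat_norm b" unfolding b0_def by (rule mat_norm_toeplitz_diag_avg[OF b])
  have b1: "mat_norm (quad_op b1) \<le> 12 * fourth_root_p ^ 5 * mat_norm b" unfolding b1_def b0_def by (rule centered[OF b])
  have small: "\<bar>mat_inner c (quad_op b1)\<bar> \<le> 12 * fourth_root_p ^ 5 * sq_norm b" if "mat_norm c \<le> mat_norm b" for c
  proof -
    have "\<bar>mat_inner c (quad_op b1)\<bar> \<le> mat_norm c * mat_norm (quad_op b1)" by (rule mat_inner_Cauchy_Schwarz)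
    also have "\<dots> \<le> mat_norm b * (12 * fourth_root_p ^ 5 * mat_norm b)" using that b1 by (intro mult_mono) auto
    finally show ?thesis by (simp add: power2_eq_square mult_ac flip: mat_norm_square)
  qed
  have eq: "b = (\<lambda>q. b1 q + b0 q)" by (simp add: b1_def)
  from arg_cong[OF eq, of "\<lambda>z. mat_inner b (quad_op z)"]
  have "mat_inner b (quad_op b) = mat_inner b (quad_op b1) + mat_inner b (quad_op b0)"
    by (simp only: quad_op_add mat_inner_add_right)
  also have "mat_inner b (quad_op b0) = mat_inner b0 (quad_op b)" by (rule mat_inner_quad_op_commute)
  also have "\<dots> = mat_inner b0 (quad_op b1) + mat_inner b0 (quad_op b0)"
    using arg_cong[OF eq, of "\<lambda>z. mat_inner b0 (quad_op z)"] by (simp only: quad_op_add mat_inner_add_right)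
  finally have "mat_inner b (quad_op b) = mat_inner b (quad_op b1) + (mat_inner b0 (quad_op b1) + mat_inner b0 (quad_op b0))" .
  moreover have "\<bar>mat_inner b0 (quad_op b0)\<bar> \<le> 49 * fourth_root_p ^ 5 * sq_norm b"
  proof -
    have "\<bar>mat_inner b0 (quad_op b0)\<bar> \<le> 49 * fourth_root_p ^ 5 * sq_norm b0"
      unfolding b0_def using b diag by (intro mat_inner_quad_op_toeplitz_le periodic_diag_avg) (simp_all add: diag_avg_def)
    also have "sq_norm b0 \<le> sq_norm b" using b0 by (simp add: mat_norm_def)
    finally show ?thesis using fourth_root_p_ge_1 by (simp add: mult_left_mono)
  qed
  ultimately show ?thesis using small[OF order_refl] small[OF b0] by linarith
qed


section \<open>The remaining error forms\<close>

definition norm1 :: "(int \<Rightarrow> real) \<Rightarrow> real" where "norm1 a = L2_set a F"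

lemma norm1_nonneg [simp]: "0 \<le> norm1 a" by (simp add: norm1_def)

lemma norm1_square: "(norm1 a)\<^sup>2 = (\<Sum>x\<in>F. (a x)\<^sup>2)"
  by (simp add: norm1_def L2_set_def sum_nonneg)

lemma Cauchy_Schwarz_F: "\<bar>\<Sum>x\<in>F. a x * c x\<bar> \<le> norm1 a * norm1 c"
proof -
  have "\<bar>\<Sum>x\<in>F. a x * c x\<bar> \<le> (\<Sum>x\<in>F. \<bar>a x\<bar> * \<bar>c x\<bar>)"
    unfolding abs_mult[symmetric] by (rule sum_abs)
  then show ?thesis using L2_set_mult_ineq[of a c F] by (simp add: norm1_def)
qed

lemma norm1_S: "norm1 (\<lambda>y. \<Sum>s\<in>F. a s * chi (s - y)) \<le> fourth_root_p\<^sup>2 * norm1 a"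
proof (rule power2_le_imp_le)
  show "(norm1 (\<lambda>y. \<Sum>s\<in>F. a s * chi (s - y)))\<^sup>2 \<le> (fourth_root_p\<^sup>2 * norm1 a)\<^sup>2"
    using S_norm[of a] by (simp add: norm1_square power_mult_distrib fourth_root_p_pow4 flip: power_mult)
qed simp

lemma S_bilinear: "\<bar>\<Sum>x\<in>F. \<Sum>y\<in>F. a x * c y * chi (x - y)\<bar> \<le> fourth_root_p\<^sup>2 * norm1 a * norm1 c"
proof -
  have "(\<Sum>x\<in>F. \<Sum>y\<in>F. a x * c y * chi (x - y)) = (\<Sum>x\<in>F. a x * (\<Sum>y\<in>F. c y * chi (y - x)))"
    unfolding sum_distrib_left by (intro sum.cong refl) (simp add: chi_commute mult_ac)
  also have "\<bar>\<dots>\<bar> \<le> norm1 a * norm1 (\<lambda>x. \<Sum>y\<in>F. c y * chi (y - x))" by (rule Cauchy_Schwarz_F)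
  also have "\<dots> \<le> norm1 a * (fourth_root_p\<^sup>2 * norm1 c)" by (intro mult_left_mono norm1_S) simp
  finally show ?thesis by (simp add: mult_ac)
qed

text \<open>The Gram matrix of the rows chi (i - j) chi (i - k), indexed by i, has entries squared
  character sums: (p - 1)^2 on the diagonal and 1 off it. So it is ((p - 1)^2 - 1) I + J, of norm at
  most p^2.\<close>

lemma W_transpose_norm: "sq_norm (\<lambda>(j, k). \<Sum>i\<in>F. a i * chi (i - j) * chi (i - k)) \<le> (real p)\<^sup>2 * (norm1 a)\<^sup>2"
proof -
  have "sq_norm (\<lambda>(j, k). \<Sum>i\<in>F. a i * chi (i - j) * chi (i - k))
      = (\<Sum>q\<in>FF. \<Sum>i\<in>F. \<Sum>i'\<in>F. (a i * a i') * ((chi (fst q - i) * chi (fst q - i')) * (chi (snd q - i) * chi (snd q - i'))))"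
    unfolding sq_norm_def power2_eq_square sum_product case_prod_unfold
    by (intro sum.cong refl) (simp add: chi_commute mult_ac)
  also have "\<dots> = (\<Sum>i\<in>F. \<Sum>q\<in>FF. \<Sum>i'\<in>F. (a i * a i') * ((chi (fst q - i) * chi (fst q - i')) * (chi (snd q - i) * chi (snd q - i'))))"
    by (rule sum.swap)
  also have "\<dots> = (\<Sum>i\<in>F. \<Sum>i'\<in>F. \<Sum>q\<in>FF. (a i * a i') * ((chi (fst q - i) * chi (fst q - i')) * (chi (snd q - i) * chi (snd q - i'))))"
    by (intro sum.cong refl sum.swap)
  also have "\<dots> = (\<Sum>i\<in>F. \<Sum>i'\<in>F. (a i * a i') * (\<Sum>x\<in>F. chi (x - i) * chi (x - i'))\<^sup>2)"
    by (simp add: sum_FF power2_eq_square sum_product flip: sum_distrib_left)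
  also have "\<dots> = (\<Sum>i\<in>F. \<Sum>i'\<in>F. (if i' = i then ((real p - 1)\<^sup>2 - 1) * (a i * a i') else 0) + a i * a i')"
  proof (intro sum.cong refl)
    fix i i' assume "i \<in> F" "i' \<in> F"
    then have "P dvd i - i' \<longleftrightarrow> i' = i" using F_eqI[of i i'] by auto
    then show "(a i * a i') * (\<Sum>x\<in>F. chi (x - i) * chi (x - i'))\<^sup>2
        = (if i' = i then ((real p - 1)\<^sup>2 - 1) * (a i * a i') else 0) + a i * a i'"
      unfolding sum_chi_chi by (simp add: algebra_simps)
  qed
  also have "\<dots> = ((real p - 1)\<^sup>2 - 1) * (norm1 a)\<^sup>2 + (\<Sum>i\<in>F. a i)\<^sup>2"
    unfolding power2_eq_square[of "\<Sum>i\<in>F. a i"] sum_product norm1_square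
    by (simp add: sum.distrib power2_eq_square sum_distrib_left)
  also have "\<dots> \<le> ((real p - 1)\<^sup>2 - 1) * (norm1 a)\<^sup>2 + real p * (norm1 a)\<^sup>2"
    using sum_square_le[of a] by (simp add: norm1_square)
  also have "\<dots> = ((real p)\<^sup>2 - real p) * (norm1 a)\<^sup>2" by (simp add: power2_eq_square algebra_simps)
  also have "\<dots> \<le> (real p)\<^sup>2 * (norm1 a)\<^sup>2" by (intro mult_right_mono) auto
  finally show ?thesis .
qed

lemma W_bilinear:
  "\<bar>\<Sum>i\<in>F. \<Sum>j\<in>F. \<Sum>k\<in>F. a i * b (j, k) * chi (i - j) * chi (i - k)\<bar> \<le> fourth_root_p ^ 4 * norm1 a * mat_norm b"
proof -
  let ?w = "\<lambda>(j, k). \<Sum>i\<in>F. a i * chi (i - j) * chi (i - k)"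
  have "(\<Sum>i\<in>F. \<Sum>j\<in>F. \<Sum>k\<in>F. a i * b (j, k) * chi (i - j) * chi (i - k))
      = (\<Sum>i\<in>F. \<Sum>q\<in>FF. a i * b q * chi (i - fst q) * chi (i - snd q))"
    by (simp add: sum_FF)
  also have "\<dots> = (\<Sum>q\<in>FF. \<Sum>i\<in>F. a i * b q * chi (i - fst q) * chi (i - snd q))"
    by (rule sum.swap)
  also have "\<dots> = mat_inner b ?w"
    unfolding mat_inner_def case_prod_unfold sum_distrib_left by (intro sum.cong refl) (simp add: mult_ac)
  also have "\<bar>\<dots>\<bar> \<le> mat_norm b * mat_norm ?w" by (rule mat_inner_Cauchy_Schwarz)
  also have "mat_norm ?w \<le> real p * norm1 a"
  proof (rule power2_le_imp_le)
    show "(mat_norm ?w)\<^sup>2 \<le> (real p * norm1 a)\<^sup>2"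
      unfolding mat_norm_square power_mult_distrib by (rule W_transpose_norm)
  qed simp
  then have "mat_norm b * mat_norm ?w \<le> mat_norm b * (real p * norm1 a)" by (intro mult_left_mono) auto
  finally show ?thesis by (simp add: fourth_root_p_pow4 mult_ac)
qed

lemma row_sums_le:
  "norm1 (\<lambda>i. \<Sum>k\<in>F. \<bar>b (i, k)\<bar>) \<le> fourth_root_p\<^sup>2 * mat_norm b"
proof (rule power2_le_imp_le)
  have "(norm1 (\<lambda>i. \<Sum>k\<in>F. \<bar>b (i, k)\<bar>))\<^sup>2 \<le> (\<Sum>i\<in>F. real p * (\<Sum>k\<in>F. \<bar>b (i, k)\<bar>\<^sup>2))"
    unfolding norm1_square by (intro sum_mono sum_square_le)
  also have "\<dots> = (fourth_root_p\<^sup>2 * mat_norm b)\<^sup>2"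
    by (simp add: power_mult_distrib mat_norm_square sq_norm_def sum_FF fourth_root_p_pow4 sum_distrib_left flip: power_mult)
  finally show "(norm1 (\<lambda>i. \<Sum>k\<in>F. \<bar>b (i, k)\<bar>))\<^sup>2 \<le> (fourth_root_p\<^sup>2 * mat_norm b)\<^sup>2" .
qed simp

definition adj :: "int \<Rightarrow> int \<Rightarrow> real" where
  "adj i j = (if i = j then 0 else (1 + chi (i - j)) / 2)"

text \<open>A polynomial in \<open>chi\<close>, so products of it expand; it differs from
  \<open>adj\<close> only on the diagonal, where it is 1/2. The diagonal corrections are estimated
  separately.\<close>

definition adj_half :: "int \<Rightarrow> int \<Rightarrow> real" where
  "adj_half i j = (1 + chi (i - j)) / 2"

lemma adj_half_bounds: "0 \<le> adj_half i j" "adj_half i j \<le> 1"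
  using abs_chi_le[of "i - j"] by (auto simp: adj_half_def)

lemma adj_bounds: "0 \<le> adj i j" "adj i j \<le> 1"
  using adj_half_bounds[of i j] by (auto simp: adj_def adj_half_def)

text \<open>On \<open>F\<close> the adjacency matrix is (J + S - I) / 2 with S of norm at most sqrt
  p; J gives the main term.\<close>

lemma form_aa:
  "(\<Sum>i\<in>F. \<Sum>j\<in>F. a i * a j * adj i j) \<ge> (\<Sum>i\<in>F. a i)\<^sup>2 / 2 - fourth_root_p\<^sup>2 * (norm1 a)\<^sup>2"
proof -
  have "(\<Sum>i\<in>F. \<Sum>j\<in>F. a i * a j * adj i j)
      = (\<Sum>i\<in>F. \<Sum>j\<in>F. a i * a j / 2 + a i * a j * chi (i - j) / 2 - (if j = i then a i * a j / 2 else 0))"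
    by (intro sum.cong refl) (auto simp: adj_def field_simps)
  also have "\<dots> = (\<Sum>i\<in>F. a i)\<^sup>2 / 2 + (\<Sum>i\<in>F. \<Sum>j\<in>F. a i * a j * chi (i - j)) / 2 - (norm1 a)\<^sup>2 / 2"
    unfolding power2_eq_square[of "\<Sum>i\<in>F. a i"] sum_product norm1_square
    by (simp add: sum.distrib sum_subtractf power2_eq_square flip: sum_divide_distrib)
  finally have eq: "(\<Sum>i\<in>F. \<Sum>j\<in>F. a i * a j * adj i j) = \<dots>" .
  have "(norm1 a)\<^sup>2 \<le> fourth_root_p\<^sup>2 * (norm1 a)\<^sup>2"
    using fourth_root_p_ge_1 by (simp add: mult_le_cancel_right1 power2_eq_square mult_ge1_I)
  then show ?thesis using S_bilinear[of a a] unfolding eq by (simp add: power2_eq_square[of "norm1 a"] abs_le_iff)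
qed


lemma abs_diff_le_1:
  assumes "0 \<le> x" "x \<le> 1" "0 \<le> y" "y \<le> (1::real)"
  shows "\<bar>x - y\<bar> \<le> 1"
  using assms by linarith

text \<open>Of the four terms of the expanded product, 1 gives the main term and chi (i - j) chi (i
  - k) the form of \<open>W_bilinear\<close>. The two terms with a single \<open>chi\<close> see
  \<open>b\<close> only through its row sums and are bounded by the norm of L. The last error is the
  diagonal correction j = i or k = i.\<close>

lemma form_ab:
  fixes b :: "int \<times> int \<Rightarrow> real"
  assumes sym: "\<And>x y. b (x, y) = b (y, x)"
  defines "L \<equiv> (\<lambda>i. \<Sum>j\<in>F. b (i, j))"
  shows "\<bar>(\<Sum>i\<in>F. \<Sum>j\<in>F. \<Sum>k\<in>F. a i * b (j, k) * (adj i j * adj i k)) - (\<Sum>i\<in>F. a i) * (\<Sum>q\<in>FF. b q) / 4\<bar>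
    \<le> fourth_root_p\<^sup>2 * norm1 a * norm1 L / 2 + fourth_root_p ^ 4 * norm1 a * mat_norm b / 4 + 2 * fourth_root_p\<^sup>2 * norm1 a * mat_norm b"
proof -
  let ?X = "\<Sum>i\<in>F. \<Sum>j\<in>F. \<Sum>k\<in>F. a i * b (j, k) * (adj i j * adj i k)"
  let ?X' = "\<Sum>i\<in>F. \<Sum>j\<in>F. \<Sum>k\<in>F. a i * b (j, k) * (adj_half i j * adj_half i k)"
  let ?W = "\<Sum>i\<in>F. \<Sum>j\<in>F. \<Sum>k\<in>F. a i * b (j, k) * chi (i - j) * chi (i - k)"
  let ?SL = "\<Sum>i\<in>F. \<Sum>j\<in>F. a i * L j * chi (i - j)"
  have "?X' = (\<Sum>i\<in>F. \<Sum>j\<in>F. \<Sum>k\<in>F. a i * b (j, k) / 4 + a i * b (j, k) * chi (i - j) / 4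
      + a i * b (j, k) * chi (i - k) / 4 + a i * b (j, k) * chi (i - j) * chi (i - k) / 4)"
    by (intro sum.cong refl) (simp add: adj_half_def field_simps)
  also have "\<dots> = (\<Sum>i\<in>F. \<Sum>j\<in>F. \<Sum>k\<in>F. a i * b (j, k)) / 4 + (\<Sum>i\<in>F. \<Sum>j\<in>F. \<Sum>k\<in>F. a i * b (j, k) * chi (i - j)) / 4
      + (\<Sum>i\<in>F. \<Sum>j\<in>F. \<Sum>k\<in>F. a i * b (j, k) * chi (i - k)) / 4 + ?W / 4"
    by (simp add: sum.distrib flip: sum_divide_distrib)
  also have "(\<Sum>i\<in>F. \<Sum>j\<in>F. \<Sum>k\<in>F. a i * b (j, k)) = (\<Sum>i\<in>F. a i) * (\<Sum>q\<in>FF. b q)"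
    by (simp add: sum_FF sum_product flip: sum_distrib_left)
  also have "(\<Sum>i\<in>F. \<Sum>j\<in>F. \<Sum>k\<in>F. a i * b (j, k) * chi (i - j)) = ?SL"
    by (simp add: L_def sum_distrib_left sum_distrib_right)
  also have "(\<Sum>i\<in>F. \<Sum>j\<in>F. \<Sum>k\<in>F. a i * b (j, k) * chi (i - k)) = (\<Sum>i\<in>F. \<Sum>k\<in>F. \<Sum>j\<in>F. a i * b (j, k) * chi (i - k))"
    by (rule sum.cong[OF refl], rule sum.swap)
  also have "\<dots> = ?SL"
    unfolding L_def sum_distrib_left sum_distrib_right by (intro sum.cong refl) (simp add: sym)
  finally have X': "?X' = (\<Sum>i\<in>F. a i) * (\<Sum>q\<in>FF. b q) / 4 + ?SL / 2 + ?W / 4" by simp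
  have "\<bar>?X - ?X'\<bar> \<le> (\<Sum>i\<in>F. \<Sum>j\<in>F. \<Sum>k\<in>F. \<bar>a i * b (j, k) * (adj i j * adj i k) - a i * b (j, k) * (adj_half i j * adj_half i k)\<bar>)"
    unfolding sum_subtractf[symmetric] by (intro order_trans[OF sum_abs] sum_mono order_refl)
  also have "\<dots> \<le> (\<Sum>i\<in>F. \<Sum>j\<in>F. \<Sum>k\<in>F. (if j = i then \<bar>a i\<bar> * \<bar>b (j, k)\<bar> else 0) + (if k = i then \<bar>a i\<bar> * \<bar>b (j, k)\<bar> else 0))"
  proof (intro sum_mono)
    fix i j k
    have "\<bar>a i * b (j, k) * (adj i j * adj i k) - a i * b (j, k) * (adj_half i j * adj_half i k)\<bar>
        = \<bar>a i\<bar> * \<bar>b (j, k)\<bar> * \<bar>adj i j * adj i k - adj_half i j * adj_half i k\<bar>"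
      by (simp only: abs_mult[symmetric] right_diff_distrib)
    moreover have "\<bar>adj i j * adj i k - adj_half i j * adj_half i k\<bar> \<le> 1"
      by (intro abs_diff_le_1 mult_nonneg_nonneg mult_le_one adj_bounds adj_half_bounds)
    moreover have "adj i j * adj i k - adj_half i j * adj_half i k = 0" if "j \<noteq> i" "k \<noteq> i"
      using that by (simp add: adj_def adj_half_def)
    ultimately show "\<bar>a i * b (j, k) * (adj i j * adj i k) - a i * b (j, k) * (adj_half i j * adj_half i k)\<bar>
        \<le> (if j = i then \<bar>a i\<bar> * \<bar>b (j, k)\<bar> else 0) + (if k = i then \<bar>a i\<bar> * \<bar>b (j, k)\<bar> else 0)"
      by (cases "j = i \<or> k = i") (auto simp: mult_left_le intro: order_trans[OF mult_left_le])
  qed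
  also have "\<dots> = (\<Sum>i\<in>F. \<Sum>k\<in>F. \<bar>a i\<bar> * \<bar>b (i, k)\<bar>) + (\<Sum>i\<in>F. \<Sum>j\<in>F. \<bar>a i\<bar> * \<bar>b (j, i)\<bar>)"
  proof -
    have "(\<Sum>i\<in>F. \<Sum>j\<in>F. \<Sum>k\<in>F. (if j = i then \<bar>a i\<bar> * \<bar>b (j, k)\<bar> else 0)) = (\<Sum>i\<in>F. \<Sum>k\<in>F. \<bar>a i\<bar> * \<bar>b (i, k)\<bar>)"
      by (rule sum.cong[OF refl], subst sum.swap) (simp add: sum.delta)
    then show ?thesis by (simp add: sum.distrib sum.delta)
  qed
  also have "\<dots> = 2 * (\<Sum>i\<in>F. \<bar>a i\<bar> * (\<Sum>k\<in>F. \<bar>b (i, k)\<bar>))"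
    by (simp add: sym[of _ "_ :: int"] sum_distrib_left)
  also have "\<dots> \<le> 2 * (norm1 (\<lambda>i. \<bar>a i\<bar>) * norm1 (\<lambda>i. \<Sum>k\<in>F. \<bar>b (i, k)\<bar>))"
    using Cauchy_Schwarz_F[of "\<lambda>i. \<bar>a i\<bar>" "\<lambda>i. \<Sum>k\<in>F. \<bar>b (i, k)\<bar>"] by simp
  also have "\<dots> \<le> 2 * (norm1 a * (fourth_root_p\<^sup>2 * mat_norm b))"
  proof -
    have "norm1 (\<lambda>i. \<bar>a i\<bar>) = norm1 a" by (simp add: norm1_def L2_set_def)
    then show ?thesis using row_sums_le by (simp add: mult_left_mono)
  qed
  finally have err: "\<bar>?X - ?X'\<bar> \<le> 2 * fourth_root_p\<^sup>2 * norm1 a * mat_norm b" by (simp add: mult_ac)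
  have W: "\<bar>?W\<bar> \<le> fourth_root_p ^ 4 * norm1 a * mat_norm b" by (rule W_bilinear)
  have SL: "\<bar>?SL\<bar> \<le> fourth_root_p\<^sup>2 * norm1 a * norm1 L" by (rule S_bilinear)
  show ?thesis using err W SL unfolding X' by linarith
qed

text \<open>\<open>form_aa\<close> for each row of \<open>b\<close>, summed over the rows. The
  positive square of the norm of L later pays for the terms that couple L with \<open>a\<close> and
  with \<open>b\<close>.\<close>

lemma form_bb3:
  fixes b :: "int \<times> int \<Rightarrow> real"
  defines "L \<equiv> (\<lambda>i. \<Sum>j\<in>F. b (i, j))"
  shows "(\<Sum>i\<in>F. \<Sum>j\<in>F. \<Sum>l\<in>F. b (i, j) * b (i, l) * adj j l) \<ge> (norm1 L)\<^sup>2 / 2 - fourth_root_p\<^sup>2 * sq_norm b"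
proof -
  have "(\<Sum>i\<in>F. ((L i)\<^sup>2 / 2 - fourth_root_p\<^sup>2 * (\<Sum>j\<in>F. (b (i, j))\<^sup>2))) \<le> (\<Sum>i\<in>F. \<Sum>j\<in>F. \<Sum>l\<in>F. b (i, j) * b (i, l) * adj j l)"
    using form_aa[of "\<lambda>j. b (_, j)"] by (intro sum_mono) (simp add: L_def norm1_square)
  moreover have "(\<Sum>i\<in>F. ((L i)\<^sup>2 / 2 - fourth_root_p\<^sup>2 * (\<Sum>j\<in>F. (b (i, j))\<^sup>2))) = (norm1 L)\<^sup>2 / 2 - fourth_root_p\<^sup>2 * sq_norm b"
    by (simp add: norm1_square sq_norm_def sum_FF sum_subtractf flip: sum_divide_distrib sum_distrib_left)
  ultimately show ?thesis by simp
qed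

section \<open>Forms in two pairs of vertices\<close>

definition pair_form :: "(int \<times> int \<Rightarrow> real) \<Rightarrow> (int \<Rightarrow> int \<Rightarrow> int \<Rightarrow> int \<Rightarrow> real) \<Rightarrow> real" where
  "pair_form b G = (\<Sum>i\<in>F. \<Sum>j\<in>F. \<Sum>k\<in>F. \<Sum>l\<in>F. b (i, j) * b (k, l) * G i j k l)"

lemma pair_form_add: "pair_form b (\<lambda>i j k l. G i j k l + H i j k l) = pair_form b G + pair_form b H"
  by (simp add: pair_form_def sum.distrib ring_distribs)

lemma pair_form_diff: "pair_form b (\<lambda>i j k l. G i j k l - H i j k l) = pair_form b G - pair_form b H"
  by (simp add: pair_form_def sum_subtractf ring_distribs)

lemma pair_form_scale: "pair_form b (\<lambda>i j k l. G i j k l / r) = pair_form b G / r"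
  by (simp add: pair_form_def sum_divide_distrib)

context
  fixes b :: "int \<times> int \<Rightarrow> real"
  assumes sym: "\<And>x y. b (x, y) = b (y, x)"
begin

text \<open>The swaps within and between pairs generate a group of order 8 that identifies most of
  the 16 terms of the product of four factors 1 + chi; one bound per orbit is enough.\<close>

lemma pair_form_swap12: "pair_form b G = pair_form b (\<lambda>i j k l. G j i k l)"
proof -
  have "pair_form b G = (\<Sum>i\<in>F. \<Sum>j\<in>F. \<Sum>k\<in>F. \<Sum>l\<in>F. b (j, i) * b (k, l) * G i j k l)"
    unfolding pair_form_def using sym by (intro sum.cong refl) simp
  also have "\<dots> = pair_form b (\<lambda>i j k l. G j i k l)" unfolding pair_form_def by (rule sum.swap)
  finally show ?thesis .
qed

lemma pair_form_swap34: "pair_form b G = pair_form b (\<lambda>i j k l. G i j l k)"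
proof -
  have "pair_form b G = (\<Sum>i\<in>F. \<Sum>j\<in>F. \<Sum>k\<in>F. \<Sum>l\<in>F. b (i, j) * b (l, k) * G i j k l)"
    unfolding pair_form_def using sym by (intro sum.cong refl) simp
  also have "\<dots> = pair_form b (\<lambda>i j k l. G i j l k)"
    unfolding pair_form_def by (rule sum.cong[OF refl], rule sum.cong[OF refl], rule sum.swap)
  finally show ?thesis .
qed

lemma pair_form_FF: "pair_form b G = (\<Sum>q\<in>FF. \<Sum>q'\<in>FF. b q * b q' * G (fst q) (snd q) (fst q') (snd q'))"
  by (simp add: pair_form_def sum_FF)

lemma pair_form_swap_pairs: "pair_form b G = pair_form b (\<lambda>i j k l. G k l i j)"
  unfolding pair_form_FF by (subst sum.swap) (simp add: mult_ac)

lemma pair_form_1: "pair_form b (\<lambda>_ _ _ _. 1) = (\<Sum>q\<in>FF. b q)\<^sup>2"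
  unfolding pair_form_FF by (simp add: power2_eq_square sum_product)

lemma pair_form_S:
  "\<bar>pair_form b (\<lambda>i j k l. chi (i - k))\<bar> \<le> fourth_root_p\<^sup>2 * (norm1 (\<lambda>i. \<Sum>j\<in>F. b (i, j)))\<^sup>2"
proof -
  have "pair_form b (\<lambda>i j k l. chi (i - k)) = (\<Sum>i\<in>F. \<Sum>k\<in>F. \<Sum>j\<in>F. \<Sum>l\<in>F. b (i, j) * b (k, l) * chi (i - k))"
    unfolding pair_form_def by (rule sum.cong[OF refl], rule sum.swap)
  also have "\<dots> = (\<Sum>i\<in>F. \<Sum>k\<in>F. (\<Sum>j\<in>F. b (i, j)) * (\<Sum>l\<in>F. b (k, l)) * chi (i - k))"
    unfolding sum_product unfolding sum_distrib_right ..
  finally show ?thesis using S_bilinear[of "\<lambda>i. \<Sum>j\<in>F. b (i, j)" "\<lambda>i. \<Sum>j\<in>F. b (i, j)"]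
    by (simp add: power2_eq_square mult_ac)
qed

lemma pair_form_W:
  "\<bar>pair_form b (\<lambda>i j k l. chi (i - k) * chi (i - l))\<bar> \<le> fourth_root_p ^ 4 * norm1 (\<lambda>i. \<Sum>j\<in>F. b (i, j)) * mat_norm b"
proof -
  have "pair_form b (\<lambda>i j k l. chi (i - k) * chi (i - l))
      = (\<Sum>i\<in>F. \<Sum>k\<in>F. \<Sum>j\<in>F. \<Sum>l\<in>F. b (i, j) * b (k, l) * (chi (i - k) * chi (i - l)))"
    unfolding pair_form_def by (rule sum.cong[OF refl], rule sum.swap)
  also have "\<dots> = (\<Sum>i\<in>F. \<Sum>k\<in>F. \<Sum>l\<in>F. \<Sum>j\<in>F. b (i, j) * b (k, l) * (chi (i - k) * chi (i - l)))"
    by (rule sum.cong[OF refl], rule sum.cong[OF refl], rule sum.swap)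
  also have "\<dots> = (\<Sum>i\<in>F. \<Sum>k\<in>F. \<Sum>l\<in>F. (\<Sum>j\<in>F. b (i, j)) * b (k, l) * chi (i - k) * chi (i - l))"
    unfolding sum_distrib_right by (simp only: mult.assoc)
  finally show ?thesis using W_bilinear[of "\<lambda>i. \<Sum>j\<in>F. b (i, j)" b] by simp
qed

text \<open>The matrix product of \<open>b\<close> with the matrix of \<open>chi\<close>.\<close>

definition half_S :: "int \<times> int \<Rightarrow> real" where
  "half_S = (\<lambda>(i, k). \<Sum>j\<in>F. b (i, j) * chi (j - k))"

lemma sq_norm_half_S: "sq_norm half_S \<le> fourth_root_p ^ 4 * sq_norm b"
proof -
  have "sq_norm half_S = (\<Sum>i\<in>F. \<Sum>k\<in>F. (\<Sum>j\<in>F. b (i, j) * chi (j - k))\<^sup>2)"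
    by (simp add: sq_norm_def sum_FF half_S_def)
  also have "\<dots> \<le> (\<Sum>i\<in>F. real p * (\<Sum>j\<in>F. (b (i, j))\<^sup>2))" by (intro sum_mono S_norm)
  also have "\<dots> = fourth_root_p ^ 4 * sq_norm b" by (simp add: sq_norm_def sum_FF fourth_root_p_pow4 sum_distrib_left)
  finally show ?thesis .
qed

text \<open>An entrywise product with the transpose; a multiplier bounded by 1 costs nothing in
  Cauchy-Schwarz.\<close>

lemma half_S_form:
  assumes "\<And>q. \<bar>g q\<bar> \<le> 1"
  shows "\<bar>\<Sum>q\<in>FF. g q * (half_S q * half_S (snd q, fst q))\<bar> \<le> fourth_root_p ^ 4 * sq_norm b"
proof -
  let ?h = "\<lambda>q. half_S (snd q, fst q)"
  have "sq_norm ?h = sq_norm half_S" unfolding sq_norm_def sum_FF by (subst sum.swap) simp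
  have "\<bar>\<Sum>q\<in>FF. g q * (half_S q * ?h q)\<bar> = \<bar>mat_inner (\<lambda>q. g q * half_S q) ?h\<bar>"
    by (simp add: mat_inner_def mult_ac)
  also have "\<dots> \<le> mat_norm (\<lambda>q. g q * half_S q) * mat_norm ?h" by (rule mat_inner_Cauchy_Schwarz)
  also have "\<dots> \<le> mat_norm half_S * mat_norm half_S"
  proof (intro mult_mono)
    have "sq_norm (\<lambda>q. g q * half_S q) \<le> sq_norm half_S"
      unfolding sq_norm_def using assms
      by (intro sum_mono) (simp add: power_mult_distrib abs_square_le_1 mult_left_le_one_le)
    then show "mat_norm (\<lambda>q. g q * half_S q) \<le> mat_norm half_S" by (simp add: mat_norm_def)
    show "mat_norm ?h \<le> mat_norm half_S" using \<open>sq_norm ?h = sq_norm half_S\<close> by (simp add: mat_norm_def)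
  qed auto
  also have "\<dots> = sq_norm half_S" by (simp add: power2_eq_square flip: mat_norm_square)
  finally show ?thesis using sq_norm_half_S by simp
qed

lemma pair_form_X: "\<bar>pair_form b (\<lambda>i j k l. chi (i - k) * chi (j - l))\<bar> \<le> fourth_root_p ^ 4 * sq_norm b"
proof -
  have "pair_form b (\<lambda>i j k l. chi (i - k) * chi (j - l))
      = (\<Sum>i\<in>F. \<Sum>j\<in>F. \<Sum>l\<in>F. \<Sum>k\<in>F. b (i, j) * b (k, l) * (chi (i - k) * chi (j - l)))"
    unfolding pair_form_def by (rule sum.cong[OF refl], rule sum.cong[OF refl], rule sum.swap)
  also have "\<dots> = (\<Sum>i\<in>F. \<Sum>l\<in>F. \<Sum>j\<in>F. \<Sum>k\<in>F. b (i, j) * b (k, l) * (chi (i - k) * chi (j - l)))"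
    by (rule sum.cong[OF refl], rule sum.swap)
  also have "\<dots> = (\<Sum>i\<in>F. \<Sum>l\<in>F. half_S (i, l) * half_S (l, i))"
    unfolding half_S_def sum_product prod.case
    by (intro sum.cong refl) (simp add: sym chi_commute mult_ac)
  finally show ?thesis using half_S_form[of "\<lambda>_. 1"] by (simp add: sum_FF)
qed

text \<open>Summing over j and l uses up two of the factors; the third, chi (i - k), depends only on
  the free indices and is a bounded multiplier.\<close>

lemma pair_form_Y: "\<bar>pair_form b (\<lambda>i j k l. chi (i - k) * chi (i - l) * chi (j - k))\<bar> \<le> fourth_root_p ^ 4 * sq_norm b"
proof -
  have "pair_form b (\<lambda>i j k l. chi (i - k) * chi (i - l) * chi (j - k))
      = (\<Sum>i\<in>F. \<Sum>k\<in>F. \<Sum>j\<in>F. \<Sum>l\<in>F. b (i, j) * b (k, l) * (chi (i - k) * chi (i - l) * chi (j - k)))"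
    unfolding pair_form_def by (rule sum.cong[OF refl], rule sum.swap)
  also have "\<dots> = (\<Sum>i\<in>F. \<Sum>k\<in>F. chi (i - k) * (half_S (i, k) * half_S (k, i)))"
    unfolding half_S_def prod.case sum_product unfolding sum_distrib_left
    by (intro sum.cong refl) (simp add: chi_commute mult_ac)
  finally show ?thesis using half_S_form[of "\<lambda>q. chi (fst q - snd q)"] by (simp add: sum_FF abs_chi_le)
qed

lemma pair_form_T:
  assumes "periodic2 b" "\<And>x. b (x, x) = 0"
  shows "\<bar>pair_form b (\<lambda>i j k l. chi (i - k) * chi (i - l) * chi (j - k) * chi (j - l))\<bar> \<le> 73 * fourth_root_p ^ 5 * sq_norm b"
proof -
  have "pair_form b (\<lambda>i j k l. chi (i - k) * chi (i - l) * chi (j - k) * chi (j - l)) = mat_inner b (quad_op b)"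
    by (simp add: pair_form_FF mat_inner_quad_op quad_kernel_def case_prod_unfold)
  then show ?thesis using mat_inner_quad_op_le[of b] assms by simp
qed

end

end

section \<open>Real inequalities that balance the positive terms against the errors\<close>

text \<open>Completing the square in d x - t^2 v z. With v = p the hypothesis on t^3 v^2 is the
  condition that fixes the order of t.\<close>

lemma weighted_am_gm:
  fixes t v x z d :: real
  assumes "0 < d" "t ^ 3 * v\<^sup>2 \<le> d\<^sup>2" "0 < t"
  shows "2 * (t\<^sup>2 * v * x * z) \<le> d * (x\<^sup>2 + t * z\<^sup>2)"
proof -
  have "0 \<le> (d * x - t\<^sup>2 * v * z)\<^sup>2" by simp
  also have "\<dots> = d\<^sup>2 * x\<^sup>2 - 2 * d * (t\<^sup>2 * v * x * z) + (t ^ 3 * v\<^sup>2) * (t * z\<^sup>2)"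
    by (simp add: power2_eq_square algebra_simps eval_nat_numeral)
  also have "\<dots> \<le> d\<^sup>2 * x\<^sup>2 - 2 * d * (t\<^sup>2 * v * x * z) + d\<^sup>2 * (t * z\<^sup>2)"
    using assms by (intro add_left_mono mult_right_mono) auto
  finally have "d * (2 * (t\<^sup>2 * v * x * z)) \<le> d * (d * (x\<^sup>2 + t * z\<^sup>2))"
    by (simp add: algebra_simps power2_eq_square)
  then show ?thesis using assms by simp
qed

text \<open>The linear part of the next lemma with all products as atoms. The constant 20000 is
  tuned to the coefficient 8 of \<open>Z2\<close>: 146944 / 20000 is below 147/20, and 147/20 + 1/50
  + 1/5 is below 8.\<close>

lemma slack_arith:
  fixes X2 :: real
  assumes "A1 \<le> X2 / 20000" "A2 \<le> XY / 20000" "A3 \<le> (X2 + Z2) / 40000" "A4 \<le> A3" "A5 \<le> Z2 / 20000"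
    "A6 \<le> Y2 / 20000" "A7 \<le> (Y2 + Z2) / 40000" "A8 \<le> A9" "A9 \<le> Z2 / 20000"
    "0 \<le> X2 - 32 * XY + 256 * Y2" "XY \<le> (X2 + Y2) / 2" "0 \<le> X2" "0 \<le> XY" "0 \<le> Y2" "0 \<le> Z2"
  shows "0 \<le> X2 - 4 * A1 - 16 * XY - 128 * A2 - 64 * A3 - 512 * A4 + 8 * Z2 + 256 * Y2 - 512 * A5
    - 4096 * A6 - 4096 * A7 - 71680 * A8 - 74752 * A9"
proof -
  have "4 * A1 + 128 * A2 \<le> (X2 + Y2) / 4" using assms(1,2,11,12,13,14) by argo
  moreover have "64 * A3 + 512 * A4 \<le> (X2 + Z2) / 50" using assms(3,4,12,15) by argo
  moreover have "512 * A5 + 71680 * A8 + 74752 * A9 \<le> 147 / 20 * Z2" using assms(5,8,9,15) by argo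
  moreover have "4096 * A6 + 4096 * A7 \<le> Y2 + Z2 / 5" using assms(6,7,14,15) by argo
  ultimately show ?thesis using assms(10,12,14,15) by argo
qed

text \<open>Here u, v, w stand for p^(1/2), p, p^(5/4) and x, y, z for the norms of
  \<open>a\<close>, of the row sums L, and of \<open>b\<close>. With Y = t y the positive terms are
  t x^2, 256 t Y^2 and 8 t^2 z^2.\<close>

lemma slack_dominates_errors:
  fixes t u v w x y z :: real
  assumes t: "0 < t" and nn: "0 \<le> x" "0 \<le> y" "0 \<le> z" and uvw: "0 \<le> u" "u \<le> v" "v \<le> w"
    and tu: "t * u \<le> 1 / 20000" and tv: "t ^ 3 * v\<^sup>2 \<le> (1 / 20000)\<^sup>2" and tw: "t\<^sup>2 * w \<le> 1 / 20000"
  shows "0 \<le> t * x\<^sup>2 - 4 * t\<^sup>2 * (u * x\<^sup>2) - 16 * t\<^sup>2 * (x * y)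
    - 256 * t ^ 3 * (u * x * y / 2 + v * x * z / 4 + 2 * u * x * z) + 8 * t\<^sup>2 * z\<^sup>2
    + 512 * t ^ 3 * (y\<^sup>2 / 2 - u * z\<^sup>2)
    + 16384 * t ^ 4 * (- (4 * (u * y\<^sup>2) + 4 * (v * y * z) + (6 * v + 73 * w) * z\<^sup>2) / 16 - 4 * v * z\<^sup>2)"
proof -
  define Y where "Y = t * y"
  have Y: "0 \<le> Y" using t nn by (simp add: Y_def)
  define X2 where "X2 = t * x\<^sup>2"
  define XY where "XY = t * (x * Y)"
  define Y2 where "Y2 = t * Y\<^sup>2"
  define Z2 where "Z2 = t\<^sup>2 * z\<^sup>2"
  have pos: "0 \<le> X2" "0 \<le> XY" "0 \<le> Y2" "0 \<le> Z2"
    using t nn Y by (simp_all add: X2_def XY_def Y2_def Z2_def)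
  have td: "(t * u) * s \<le> s / 20000" if "0 \<le> s" for s
    using mult_right_mono[OF tu that] by simp
  have e1: "(t * u) * X2 \<le> X2 / 20000" and e2: "(t * u) * XY \<le> XY / 20000"
    and e5: "(t * u) * Z2 \<le> Z2 / 20000" and e6: "(t * u) * Y2 \<le> Y2 / 20000"
    by (intro td pos)+
  have xz: "t\<^sup>2 * v * x * z \<le> (x\<^sup>2 + t * z\<^sup>2) / 40000" and yz: "t\<^sup>2 * v * Y * z \<le> (Y\<^sup>2 + t * z\<^sup>2) / 40000"
    using weighted_am_gm[of "1/20000" t v x z] weighted_am_gm[of "1/20000" t v Y z] tv t by auto
  have e3: "t * (t\<^sup>2 * v * x * z) \<le> (X2 + Z2) / 40000" and e7: "t * (t\<^sup>2 * v * Y * z) \<le> (Y2 + Z2) / 40000"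
    using mult_left_mono[OF xz, of t] mult_left_mono[OF yz, of t] t
    by (simp_all add: X2_def Y2_def Z2_def power2_eq_square algebra_simps)
  have e3': "t * (t\<^sup>2 * u * x * z) \<le> t * (t\<^sup>2 * v * x * z)"
    using t nn uvw by (intro mult_left_mono mult_right_mono) auto
  have e8: "(t\<^sup>2 * w) * Z2 \<le> Z2 / 20000" using mult_right_mono[OF tw pos(4)] by simp
  have e8': "(t\<^sup>2 * v) * Z2 \<le> (t\<^sup>2 * w) * Z2"
    using t uvw pos by (intro mult_right_mono mult_left_mono) auto
  \<comment> \<open>The coupling 16 x Y of \<open>a\<close> with the row sums is not small. Half of
    this square cancels it and leaves half of x^2 + 256 Y^2 for the errors.\<close>
  have "0 \<le> t * (x - 16 * Y)\<^sup>2" using t by simp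
  then have sq: "0 \<le> X2 - 32 * XY + 256 * Y2"
    by (simp add: X2_def XY_def Y2_def power2_eq_square algebra_simps)
  have xy: "XY \<le> (X2 + Y2) / 2"
  proof -
    have "0 \<le> t * (x - Y)\<^sup>2" using t by simp
    then show ?thesis by (simp add: X2_def XY_def Y2_def power2_eq_square algebra_simps)
  qed
  have "t * x\<^sup>2 - 4 * t\<^sup>2 * (u * x\<^sup>2) - 16 * t\<^sup>2 * (x * y)
    - 256 * t ^ 3 * (u * x * y / 2 + v * x * z / 4 + 2 * u * x * z) + 8 * t\<^sup>2 * z\<^sup>2
    + 512 * t ^ 3 * (y\<^sup>2 / 2 - u * z\<^sup>2)
    + 16384 * t ^ 4 * (- (4 * (u * y\<^sup>2) + 4 * (v * y * z) + (6 * v + 73 * w) * z\<^sup>2) / 16 - 4 * v * z\<^sup>2)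
    = X2 - 4 * ((t * u) * X2) - 16 * XY - 128 * ((t * u) * XY) - 64 * (t * (t\<^sup>2 * v * x * z))
      - 512 * (t * (t\<^sup>2 * u * x * z)) + 8 * Z2 + 256 * Y2 - 512 * ((t * u) * Z2)
      - 4096 * ((t * u) * Y2) - 4096 * (t * (t\<^sup>2 * v * Y * z)) - 71680 * ((t\<^sup>2 * v) * Z2)
      - 74752 * ((t\<^sup>2 * w) * Z2)"
    unfolding X2_def XY_def Y2_def Z2_def Y_def
    by (simp add: power2_eq_square field_simps eval_nat_numeral)
  also have "0 \<le> \<dots>"
    by (rule slack_arith[OF e1 e2 e3 e3' e5 e6 e7 e8' e8 sq xy pos])
  finally show ?thesis .
qed

lemma combine_bounds:
  fixes J0 :: real
  assumes "0 \<le> J0 + J1 + 2 * J2 + J3" "0 \<le> X - E1 - 2 * E2 - 2 * E3 + Z + E4 + E5" "J1 - E1 \<le> M1"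
    "- E2 \<le> M2" "J2 - E3 \<le> M3" "E4 \<le> M4" "J3 + E5 \<le> M5"
  shows "0 \<le> J0 + (X + M1) + 2 * (M2 + M3) + (Z + M4 + M5)"
  using assms by argo

section \<open>Nonnegativity of the moment form\<close>

context paley
begin

text \<open>The two products agree unless one of i, j equals one of k, l. Each of the four
  coincidences costs at most the squared norm of the absolute row sums, which is at most p times
  that of \<open>b\<close>.\<close>

lemma form_bb4_error:
  fixes b :: "int \<times> int \<Rightarrow> real"
  assumes sym: "\<And>x y. b (x, y) = b (y, x)"
  shows "\<bar>pair_form b (\<lambda>i j k l. adj i k * adj i l * adj j k * adj j l)
      - pair_form b (\<lambda>i j k l. adj_half i k * adj_half i l * adj_half j k * adj_half j l)\<bar> \<le> 4 * fourth_root_p ^ 4 * sq_norm b"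
proof -
  define B where "B q = \<bar>b q\<bar>" for q
  have symB: "B (x, y) = B (y, x)" for x y using sym by (simp add: B_def)
  let ?G = "\<lambda>i j k l. adj i k * adj i l * adj j k * adj j l"
  let ?G' = "\<lambda>i j k l. adj_half i k * adj_half i l * adj_half j k * adj_half j l"
  let ?e = "\<lambda>x y. if y = x then (1::real) else 0"
  have eB: "pair_form B (\<lambda>i j k l. ?e i k) \<le> fourth_root_p ^ 4 * sq_norm b"
  proof -
    have "pair_form B (\<lambda>i j k l. ?e i k) = (\<Sum>i\<in>F. \<Sum>j\<in>F. \<Sum>l\<in>F. \<Sum>k\<in>F. B (i, j) * B (k, l) * ?e i k)"
      unfolding pair_form_def by (rule sum.cong[OF refl], rule sum.cong[OF refl], rule sum.swap)
    also have "\<dots> = (\<Sum>i\<in>F. \<Sum>j\<in>F. \<Sum>l\<in>F. B (i, j) * B (i, l))"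
      by (intro sum.cong refl) (simp add: sum.delta if_distrib[where f = "\<lambda>x. _ * x"] cong: if_cong)
    also have "\<dots> = (norm1 (\<lambda>i. \<Sum>k\<in>F. \<bar>b (i, k)\<bar>))\<^sup>2"
      unfolding norm1_square unfolding power2_eq_square sum_product by (simp add: B_def)
    also have "\<dots> \<le> (fourth_root_p\<^sup>2 * mat_norm b)\<^sup>2" by (intro power_mono row_sums_le) simp
    also have "\<dots> = fourth_root_p ^ 4 * sq_norm b" by (simp add: power_mult_distrib mat_norm_square flip: power_mult)
    finally show ?thesis .
  qed
  have "\<bar>pair_form b ?G - pair_form b ?G'\<bar> = \<bar>pair_form b (\<lambda>i j k l. ?G i j k l - ?G' i j k l)\<bar>" by (simp only: pair_form_diff)
  also have "\<dots> \<le> (\<Sum>i\<in>F. \<Sum>j\<in>F. \<Sum>k\<in>F. \<Sum>l\<in>F. \<bar>b (i, j) * b (k, l) * (?G i j k l - ?G' i j k l)\<bar>)"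
    unfolding pair_form_def by (intro order_trans[OF sum_abs] sum_mono order_refl)
  also have "\<dots> \<le> pair_form B (\<lambda>i j k l. ?e i k + ?e i l + ?e j k + ?e j l)"
    unfolding pair_form_def
  proof (intro sum_mono)
    fix i j k l
    have "\<bar>?G i j k l - ?G' i j k l\<bar> \<le> 1"
      by (intro abs_diff_le_1 mult_nonneg_nonneg mult_le_one adj_bounds adj_half_bounds)
    moreover have "?G i j k l - ?G' i j k l = 0" if "k \<noteq> i" "l \<noteq> i" "k \<noteq> j" "l \<noteq> j"
      using that by (simp add: adj_def adj_half_def)
    ultimately have "\<bar>?G i j k l - ?G' i j k l\<bar> \<le> ?e i k + ?e i l + ?e j k + ?e j l"
      by (cases "k = i \<or> l = i \<or> k = j \<or> l = j") auto
    then show "\<bar>b (i, j) * b (k, l) * (?G i j k l - ?G' i j k l)\<bar>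
        \<le> B (i, j) * B (k, l) * (?e i k + ?e i l + ?e j k + ?e j l)"
      unfolding abs_mult B_def by (intro mult_left_mono) auto
  qed
  also have "\<dots> = pair_form B (\<lambda>i j k l. ?e i k) + pair_form B (\<lambda>i j k l. ?e i l) + pair_form B (\<lambda>i j k l. ?e j k) + pair_form B (\<lambda>i j k l. ?e j l)"
    by (simp only: pair_form_add)
  also have "pair_form B (\<lambda>i j k l. ?e j k) = pair_form B (\<lambda>i j k l. ?e i k)" by (rule pair_form_swap12[of B, OF symB])
  also have "pair_form B (\<lambda>i j k l. ?e j l) = pair_form B (\<lambda>i j k l. ?e i l)" by (rule pair_form_swap12[of B, OF symB])
  also have "pair_form B (\<lambda>i j k l. ?e i l) = pair_form B (\<lambda>i j k l. ?e i k)" by (rule pair_form_swap34[of B, OF symB])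
  finally show ?thesis using eB by simp
qed

text \<open>The 16 terms fall into orbits of sizes 1, 4, 4, 2, 4, 1. The orbits of sizes 2 and 4
  bounded by the form X and the form Y together give the coefficient 6; the last one is T.\<close>

lemma form_bb4:
  fixes b :: "int \<times> int \<Rightarrow> real"
  assumes sym: "\<And>x y. b (x, y) = b (y, x)" and per: "periodic2 b" and diag: "\<And>x. b (x, x) = 0"
  defines "y \<equiv> norm1 (\<lambda>i. \<Sum>j\<in>F. b (i, j))"
  shows "pair_form b (\<lambda>i j k l. adj i k * adj i l * adj j k * adj j l)
    \<ge> (\<Sum>q\<in>FF. b q)\<^sup>2 / 16 + (- (4 * (fourth_root_p\<^sup>2 * y\<^sup>2) + 4 * (fourth_root_p ^ 4 * y * mat_norm b) + (6 * fourth_root_p ^ 4 + 73 * fourth_root_p ^ 5) * (mat_norm b)\<^sup>2) / 16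
      - 4 * fourth_root_p ^ 4 * (mat_norm b)\<^sup>2)"
proof -
  let ?x = "\<lambda>i j k l. chi (i - k)" and ?y = "\<lambda>i j k l. chi (i - l)"
    and ?z = "\<lambda>i j k l. chi (j - k)" and ?w = "\<lambda>i j k l. chi (j - l)"
  let ?xy = "\<lambda>i j k l. chi (i - k) * chi (i - l)" and ?zw = "\<lambda>i j k l. chi (j - k) * chi (j - l)"
    and ?xz = "\<lambda>i j k l. chi (i - k) * chi (j - k)" and ?yw = "\<lambda>i j k l. chi (i - l) * chi (j - l)"
    and ?xw = "\<lambda>i j k l. chi (i - k) * chi (j - l)" and ?yz = "\<lambda>i j k l. chi (i - l) * chi (j - k)"
  let ?xyz = "\<lambda>i j k l. chi (i - k) * chi (i - l) * chi (j - k)"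
    and ?xyw = "\<lambda>i j k l. chi (i - k) * chi (i - l) * chi (j - l)"
    and ?xzw = "\<lambda>i j k l. chi (i - k) * chi (j - k) * chi (j - l)"
    and ?yzw = "\<lambda>i j k l. chi (i - l) * chi (j - k) * chi (j - l)"
  let ?T = "\<lambda>i j k l. chi (i - k) * chi (i - l) * chi (j - k) * chi (j - l)"
  have exp: "adj_half i k * adj_half i l * adj_half j k * adj_half j l = (1 + ?x i j k l + ?y i j k l + ?z i j k l + ?w i j k l
      + ?xy i j k l + ?zw i j k l + ?xz i j k l + ?yw i j k l + ?xw i j k l + ?yz i j k l
      + ?xyz i j k l + ?xyw i j k l + ?xzw i j k l + ?yzw i j k l + ?T i j k l) / 16" for i j k l
    by (simp add: adj_half_def field_simps)
  have s1: "pair_form b ?y = pair_form b ?x" by (rule pair_form_swap34[of b, OF sym])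
  have s2: "pair_form b ?z = pair_form b ?x" by (rule pair_form_swap12[of b, OF sym])
  have s3: "pair_form b ?w = pair_form b ?y" by (rule pair_form_swap12[of b, OF sym])
  have s4: "pair_form b ?zw = pair_form b ?xy" by (rule pair_form_swap12[of b, OF sym])
  have s5: "pair_form b ?xz = pair_form b ?xy"
    using pair_form_swap_pairs[of b ?xz, OF sym] by (simp add: chi_commute)
  have s6: "pair_form b ?yw = pair_form b ?xz" by (rule pair_form_swap34[of b, OF sym])
  have s7: "pair_form b ?yz = pair_form b ?xw" by (rule pair_form_swap34[of b, OF sym])
  have s8: "pair_form b ?xyw = pair_form b ?xyz"
    using pair_form_swap34[of b ?xyw, OF sym] by (simp add: mult_ac)
  have s9: "pair_form b ?xzw = pair_form b ?xyz"
    using pair_form_swap12[of b ?xzw, OF sym] by (simp add: mult_ac)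
  have s10: "pair_form b ?yzw = pair_form b ?xyw"
    using pair_form_swap12[of b ?yzw, OF sym] by (simp add: mult_ac)
  have eq: "pair_form b (\<lambda>i j k l. adj_half i k * adj_half i l * adj_half j k * adj_half j l)
      = ((\<Sum>q\<in>FF. b q)\<^sup>2 + 4 * pair_form b ?x + 4 * pair_form b ?xy + 2 * pair_form b ?xw + 4 * pair_form b ?xyz + pair_form b ?T) / 16"
    unfolding exp pair_form_scale pair_form_add s3 s1 s2 s4 s6 s5 s7 s10 s8 s9 pair_form_1[of b, OF sym] by simp
  have "\<bar>pair_form b ?x\<bar> \<le> fourth_root_p\<^sup>2 * y\<^sup>2" unfolding y_def by (rule pair_form_S[of b, OF sym])
  moreover have "\<bar>pair_form b ?xy\<bar> \<le> fourth_root_p ^ 4 * y * mat_norm b" unfolding y_def by (rule pair_form_W[of b, OF sym])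
  moreover have "\<bar>pair_form b ?xw\<bar> \<le> fourth_root_p ^ 4 * sq_norm b" by (rule pair_form_X[of b, OF sym])
  moreover have "\<bar>pair_form b ?xyz\<bar> \<le> fourth_root_p ^ 4 * sq_norm b" by (rule pair_form_Y[of b, OF sym])
  moreover have "\<bar>pair_form b ?T\<bar> \<le> 73 * fourth_root_p ^ 5 * sq_norm b" by (rule pair_form_T[of b, OF sym per diag])
  moreover note form_bb4_error[of b, OF sym, unfolded eq]
  moreover have "(6 * fourth_root_p ^ 4 + 73 * fourth_root_p ^ 5) * sq_norm b = 6 * (fourth_root_p ^ 4 * sq_norm b) + 73 * fourth_root_p ^ 5 * sq_norm b"
    by (simp add: algebra_simps)
  ultimately show ?thesis unfolding mat_norm_square by (simp add: abs_le_iff field_simps)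
qed

lemma quad_form_nonneg:
  fixes a :: "int \<Rightarrow> real" and b :: "int \<times> int \<Rightarrow> real" and c t :: real
  assumes sym: "\<And>x y. b (x, y) = b (y, x)" and per: "periodic2 b" and diag: "\<And>x. b (x, x) = 0"
    and t: "0 < t" and t1: "t * fourth_root_p\<^sup>2 \<le> 1 / 20000" and t2: "t ^ 3 * (fourth_root_p ^ 4)\<^sup>2 \<le> (1 / 20000)\<^sup>2"
    and t3: "t\<^sup>2 * fourth_root_p ^ 5 \<le> 1 / 20000"
  defines "L \<equiv> (\<lambda>i. \<Sum>j\<in>F. b (i, j))"
  shows "0 \<le> c\<^sup>2 + 2 * c * (t * (\<Sum>i\<in>F. a i)) + 2 * c * (4 * t\<^sup>2 * (\<Sum>q\<in>FF. b q))
    + (t * (\<Sum>i\<in>F. (a i)\<^sup>2) + 4 * t\<^sup>2 * (\<Sum>i\<in>F. \<Sum>j\<in>F. a i * a j * adj i j))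
    + 2 * (8 * t\<^sup>2 * (\<Sum>i\<in>F. a i * L i)
        + 128 * t ^ 3 * (\<Sum>i\<in>F. \<Sum>j\<in>F. \<Sum>k\<in>F. a i * b (j, k) * (adj i j * adj i k)))
    + (8 * t\<^sup>2 * sq_norm b + 512 * t ^ 3 * (\<Sum>i\<in>F. \<Sum>j\<in>F. \<Sum>l\<in>F. b (i, j) * b (i, l) * adj j l)
        + 16384 * t ^ 4 * pair_form b (\<lambda>i j k l. adj i k * adj i l * adj j k * adj j l))"
proof -
  define x where "x = norm1 a"
  define y where "y = norm1 L"
  define z where "z = mat_norm b"
  define s where "s = (\<Sum>i\<in>F. a i)"
  define B where "B = (\<Sum>q\<in>FF. b q)"
  let ?ea = "fourth_root_p\<^sup>2 * x * y / 2 + fourth_root_p ^ 4 * x * z / 4 + 2 * fourth_root_p\<^sup>2 * x * z"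
  let ?eb = "- (4 * (fourth_root_p\<^sup>2 * y\<^sup>2) + 4 * (fourth_root_p ^ 4 * y * z) + (6 * fourth_root_p ^ 4 + 73 * fourth_root_p ^ 5) * z\<^sup>2) / 16 - 4 * fourth_root_p ^ 4 * z\<^sup>2"
  have tp: "0 \<le> 4 * t\<^sup>2" "0 \<le> 8 * t\<^sup>2" "0 \<le> 128 * t ^ 3" "0 \<le> 512 * t ^ 3" "0 \<le> 16384 * t ^ 4" using t by auto
  have aa: "4 * t\<^sup>2 * (s\<^sup>2 / 2 - fourth_root_p\<^sup>2 * x\<^sup>2) \<le> 4 * t\<^sup>2 * (\<Sum>i\<in>F. \<Sum>j\<in>F. a i * a j * adj i j)"
    unfolding s_def x_def by (intro mult_left_mono form_aa tp)
  have aL: "8 * t\<^sup>2 * (- (x * y)) \<le> 8 * t\<^sup>2 * (\<Sum>i\<in>F. a i * L i)"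
    using Cauchy_Schwarz_F[of a L] unfolding x_def y_def by (intro mult_left_mono tp) (simp add: abs_le_iff)
  have ab: "128 * t ^ 3 * (s * B / 4 - ?ea)
      \<le> 128 * t ^ 3 * (\<Sum>i\<in>F. \<Sum>j\<in>F. \<Sum>k\<in>F. a i * b (j, k) * (adj i j * adj i k))"
    using form_ab[of b a, OF sym] unfolding x_def y_def z_def s_def B_def L_def
    by (intro mult_left_mono tp) linarith
  have b3: "512 * t ^ 3 * (y\<^sup>2 / 2 - fourth_root_p\<^sup>2 * z\<^sup>2) \<le> 512 * t ^ 3 * (\<Sum>i\<in>F. \<Sum>j\<in>F. \<Sum>l\<in>F. b (i, j) * b (i, l) * adj j l)"
    unfolding y_def z_def L_def mat_norm_square by (intro mult_left_mono form_bb3 tp)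
  have b4: "16384 * t ^ 4 * (B\<^sup>2 / 16 + ?eb) \<le> 16384 * t ^ 4 * pair_form b (\<lambda>i j k l. adj i k * adj i l * adj j k * adj j l)"
    unfolding B_def y_def z_def L_def by (intro mult_left_mono form_bb4 sym per diag tp)
  \<comment> \<open>The form in c, s and B alone. Removing the first square leaves t^2 s^2 + 56 t^3
    s B + 1008 t^4 B^2, which is definite as 28^2 = 784 and 1008 - 784 = 224.\<close>
  have "0 \<le> (c + t * s + 4 * t\<^sup>2 * B)\<^sup>2 + (t * s + 28 * t\<^sup>2 * B)\<^sup>2 + 224 * (t\<^sup>2 * B)\<^sup>2" by simp
  also have "\<dots> = c\<^sup>2 + 2 * c * (t * s) + 2 * c * (4 * t\<^sup>2 * B) + 4 * t\<^sup>2 * (s\<^sup>2 / 2)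
      + 2 * (128 * t ^ 3 * (s * B / 4)) + 16384 * t ^ 4 * (B\<^sup>2 / 16)"
    by (simp add: power2_eq_square algebra_simps eval_nat_numeral)
  finally have J: "0 \<le> \<dots>" .
  have "1 \<le> fourth_root_p" by (rule fourth_root_p_ge_1)
  then have "fourth_root_p\<^sup>2 \<le> fourth_root_p ^ 4" "fourth_root_p ^ 4 \<le> fourth_root_p ^ 5" by (auto intro: power_increasing)
  from slack_dominates_errors[OF t _ _ _ _ this t1 t2 t3, of x y z]
  have R: "0 \<le> t * x\<^sup>2 - 4 * t\<^sup>2 * (fourth_root_p\<^sup>2 * x\<^sup>2) - 2 * (8 * t\<^sup>2 * (x * y)) - 2 * (128 * t ^ 3 * ?ea) + 8 * t\<^sup>2 * z\<^sup>2
    + 512 * t ^ 3 * (y\<^sup>2 / 2 - fourth_root_p\<^sup>2 * z\<^sup>2) + 16384 * t ^ 4 * ?eb"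
    by (simp only: mult.assoc[symmetric]) (simp add: x_def y_def z_def)
  have x2: "(\<Sum>i\<in>F. (a i)\<^sup>2) = x\<^sup>2" by (simp add: x_def norm1_square)
  have z2: "sq_norm b = z\<^sup>2" by (simp add: z_def mat_norm_square)
  show ?thesis
    unfolding x2 z2 s_def[symmetric] B_def[symmetric]
    by (rule combine_bounds[OF J R aa[unfolded right_diff_distrib] aL[unfolded mult_minus_right]
          ab[unfolded right_diff_distrib[of "128 * t ^ 3"]] b3 b4[unfolded distrib_left[of "16384 * t ^ 4"]]])
qed

end

section \<open>Pseudomoments\<close>

text \<open>A monomial is evaluated through its support only, so the relations x_i^2 = x_i hold for
  every choice of moments.\<close>

definition pseudo_ev :: "('v set \<Rightarrow> real) \<Rightarrow> 'v mpoly \<Rightarrow> real" where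
  "pseudo_ev \<Phi> f = (\<Sum>m\<in>Poly_Mapping.keys f. Poly_Mapping.lookup f m * \<Phi> (Poly_Mapping.keys m))"

lemma pseudo_ev_superset:
  assumes "finite A" "Poly_Mapping.keys f \<subseteq> A"
  shows "pseudo_ev \<Phi> f = (\<Sum>m\<in>A. Poly_Mapping.lookup f m * \<Phi> (Poly_Mapping.keys m))"
  unfolding pseudo_ev_def using assms by (intro sum.mono_neutral_left) (auto simp: in_keys_iff)

lemma pseudo_ev_add: "pseudo_ev \<Phi> (f + g) = pseudo_ev \<Phi> f + pseudo_ev \<Phi> g"
proof -
  let ?A = "Poly_Mapping.keys f \<union> Poly_Mapping.keys g"
  have "pseudo_ev \<Phi> (f + g) = (\<Sum>m\<in>?A. Poly_Mapping.lookup (f + g) m * \<Phi> (Poly_Mapping.keys m))"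
    by (intro pseudo_ev_superset Poly_Mapping.keys_add) auto
  also have "\<dots> = (\<Sum>m\<in>?A. Poly_Mapping.lookup f m * \<Phi> (Poly_Mapping.keys m))
      + (\<Sum>m\<in>?A. Poly_Mapping.lookup g m * \<Phi> (Poly_Mapping.keys m))"
    by (simp add: lookup_add ring_distribs sum.distrib)
  also have "\<dots> = pseudo_ev \<Phi> f + pseudo_ev \<Phi> g" by (simp add: pseudo_ev_superset[of ?A])
  finally show ?thesis .
qed

lemma pseudo_ev_0: "pseudo_ev \<Phi> 0 = 0" by (simp add: pseudo_ev_def)

lemma pseudo_ev_single: "pseudo_ev \<Phi> (Poly_Mapping.single m r) = r * \<Phi> (Poly_Mapping.keys m)"
  by (simp add: pseudo_ev_def)

lemma pseudo_ev_diff: "pseudo_ev \<Phi> (f - g) = pseudo_ev \<Phi> f - pseudo_ev \<Phi> g"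
  using pseudo_ev_add[of \<Phi> "f - g" g] by simp

lemma pseudo_ev_sum: "pseudo_ev \<Phi> (\<Sum>x\<in>A. g x) = (\<Sum>x\<in>A. pseudo_ev \<Phi> (g x))"
  by (induction A rule: infinite_finite_induct) (auto simp: pseudo_ev_0 pseudo_ev_add)

text \<open>The support of a product of monomials is the union of the supports; nesting lets each
  factor be replaced by its normal form in turn.\<close>

lemma pseudo_ev_mult: "pseudo_ev \<Phi> (f * g) = pseudo_ev (\<lambda>K. pseudo_ev (\<lambda>K'. \<Phi> (K \<union> K')) g) f"
proof -
  let ?s = "\<lambda>h m. Poly_Mapping.single m (Poly_Mapping.lookup h m)"
  have "f * g = (\<Sum>m\<in>Poly_Mapping.keys f. ?s f m) * (\<Sum>n\<in>Poly_Mapping.keys g. ?s g n)"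
    by (simp only: poly_as_sum[symmetric])
  also have "\<dots> = (\<Sum>m\<in>Poly_Mapping.keys f. \<Sum>n\<in>Poly_Mapping.keys g.
      Poly_Mapping.single (m + n) (Poly_Mapping.lookup f m * Poly_Mapping.lookup g n))"
    by (simp add: sum_product mult_single)
  finally have "pseudo_ev \<Phi> (f * g) = (\<Sum>m\<in>Poly_Mapping.keys f. \<Sum>n\<in>Poly_Mapping.keys g.
      Poly_Mapping.lookup f m * Poly_Mapping.lookup g n * \<Phi> (Poly_Mapping.keys m \<union> Poly_Mapping.keys n))"
    by (simp add: pseudo_ev_sum pseudo_ev_single keys_add_nat)
  then show ?thesis by (simp add: pseudo_ev_def sum_distrib_left mult_ac)
qed

lemma pseudo_ev_const_mult: "pseudo_ev \<Phi> (const_poly c * f) = c * pseudo_ev \<Phi> f"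
  by (simp add: pseudo_ev_mult const_poly_def pseudo_ev_single)

lemma pseudo_ev_1: "pseudo_ev \<Phi> 1 = \<Phi> {}"
  using pseudo_ev_single[of \<Phi> 0 1] by simp

lemma pseudo_ev_var: "pseudo_ev \<Phi> (var_poly i) = \<Phi> {i}"
  by (simp add: var_poly_def pseudo_ev_single)

lemma pseudo_ev_var_mult: "pseudo_ev \<Phi> (var_poly i * f) = pseudo_ev (\<lambda>K. \<Phi> (insert i K)) f"
  by (simp add: pseudo_ev_mult var_poly_def pseudo_ev_single)

lemma pseudo_ev_boolean: "pseudo_ev \<Phi> ((var_poly i ^ 2 - var_poly i) * q) = 0"
  by (simp add: left_diff_distrib pseudo_ev_diff power2_eq_square mult.assoc pseudo_ev_var_mult)

text \<open>A multilinear normal form modulo x_i^2 = x_i: asking for all set functions at once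
  expresses equality modulo these relations.\<close>

definition quad_rep :: "'v set \<Rightarrow> 'v mpoly \<Rightarrow> real \<Rightarrow> ('v \<Rightarrow> real) \<Rightarrow> ('v \<times> 'v \<Rightarrow> real) \<Rightarrow> bool" where
  "quad_rep V q c a b \<longleftrightarrow> (\<forall>x y. b (x, y) = b (y, x)) \<and> (\<forall>x. b (x, x) = 0) \<and>
    (\<forall>\<Phi>. pseudo_ev \<Phi> q = c * \<Phi> {} + (\<Sum>i\<in>V. a i * \<Phi> {i}) + (\<Sum>i\<in>V. \<Sum>j\<in>V. b (i, j) * \<Phi> {i, j}))"

lemma quad_rep_add:
  assumes "quad_rep V q c a b" "quad_rep V q' c' a' b'"
  shows "quad_rep V (q + q') (c + c') (\<lambda>i. a i + a' i) (\<lambda>x. b x + b' x)"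
  using assms unfolding quad_rep_def
  by (simp add: pseudo_ev_add ring_distribs sum.distrib)

lemma quad_rep_single:
  fixes V :: "'v set"
  assumes V: "finite V" and m: "Poly_Mapping.keys m \<subseteq> V" "mon_degree m \<le> 2"
  shows "\<exists>c a b. quad_rep V (Poly_Mapping.single m r) c a b"
proof -
  let ?K = "Poly_Mapping.keys m"
  have "card ?K = (\<Sum>i\<in>?K. 1)" by simp
  also have "\<dots> \<le> mon_degree m"
    unfolding mon_degree_def by (intro sum_mono) (auto simp: in_keys_iff Suc_le_eq)
  finally have "card ?K \<le> 2" using m by simp
  then consider "?K = {}" | i where "?K = {i}" | i j where "?K = {i, j}" "i \<noteq> j"
    by (metis (no_types) card_1_singletonE card_2_iff card_eq_0_iff finite_keys le_SucE le_zero_eq numeral_2_eq_2 One_nat_def)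
  then show ?thesis
  proof cases
    case 1
    have "quad_rep V (Poly_Mapping.single m r) r (\<lambda>_. 0) (\<lambda>_. 0)"
      by (simp add: quad_rep_def pseudo_ev_single 1)
    then show ?thesis by blast
  next
    case (2 i)
    then have "i \<in> V" using m by auto
    then have "quad_rep V (Poly_Mapping.single m r) 0 (\<lambda>x. if x = i then r else 0) (\<lambda>_. 0)"
      using V by (simp add: quad_rep_def pseudo_ev_single 2 if_distrib[where f = "\<lambda>x. x * _"] cong: if_cong)
    then show ?thesis by blast
  next
    case (3 i j)
    then have ij: "i \<in> V" "j \<in> V" using m by auto
    \<comment> \<open>\<open>b\<close> runs over ordered pairs, so either order of i and j carries
      half of the coefficient.\<close>
    let ?b = "\<lambda>(x, y). (if x = i then (if y = j then r / 2 else 0) else 0) + (if x = j then (if y = i then r / 2 else 0) else 0)"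
    have "quad_rep V (Poly_Mapping.single m r) 0 (\<lambda>_. 0) ?b"
      unfolding quad_rep_def
    proof (intro conjI allI)
      fix \<Phi> :: "'v set \<Rightarrow> real"
      have "(\<Sum>x\<in>V. \<Sum>y\<in>V. ?b (x, y) * \<Phi> {x, y})
          = (\<Sum>x\<in>V. \<Sum>y\<in>V. (if x = i then (if y = j then r / 2 * \<Phi> {x, y} else 0) else 0))
          + (\<Sum>x\<in>V. \<Sum>y\<in>V. (if x = j then (if y = i then r / 2 * \<Phi> {x, y} else 0) else 0))"
        unfolding sum.distrib[symmetric] by (intro sum.cong refl) (auto simp: ring_distribs)
      also have "\<dots> = r * \<Phi> {i, j}"
      proof -
        have "(\<Sum>x\<in>V. \<Sum>y\<in>V. (if x = u then (if y = v then r / 2 * \<Phi> {x, y} else 0) else 0)) = r / 2 * \<Phi> {u, v}"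
          if "u \<in> V" "v \<in> V" for u v
        proof -
          have "(\<Sum>x\<in>V. \<Sum>y\<in>V. (if x = u then (if y = v then r / 2 * \<Phi> {x, y} else 0) else 0))
              = (\<Sum>x\<in>V. if x = u then (\<Sum>y\<in>V. if y = v then r / 2 * \<Phi> {x, y} else 0) else 0)"
            by (intro sum.cong refl) auto
          then show ?thesis using V that by simp
        qed
        from this[OF ij] this[OF ij(2,1)] show ?thesis by (simp add: insert_commute)
      qed
      finally show "pseudo_ev \<Phi> (Poly_Mapping.single m r) = 0 * \<Phi> {} + (\<Sum>i\<in>V. 0 * \<Phi> {i})
          + (\<Sum>x\<in>V. \<Sum>y\<in>V. ?b (x, y) * \<Phi> {x, y})"
        by (simp add: pseudo_ev_single 3)
    qed (use 3 in auto)
    then show ?thesis by blast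
  qed
qed

lemma quad_rep_exists:
  assumes V: "finite V" and q: "q \<in> polys_upto V 2"
  shows "\<exists>c a b. quad_rep V q c a b"
proof -
  let ?s = "\<lambda>m. Poly_Mapping.single m (Poly_Mapping.lookup q m)"
  have "\<exists>c a b. quad_rep V (\<Sum>m\<in>B. ?s m) c a b" if "finite B" "B \<subseteq> Poly_Mapping.keys q" for B
    using that
  proof (induction B rule: finite_induct)
    case empty
    have "quad_rep V 0 0 (\<lambda>_. 0) (\<lambda>_. 0)" by (simp add: quad_rep_def pseudo_ev_0)
    then show ?case by auto
  next
    case (insert m B)
    then have "Poly_Mapping.keys m \<subseteq> V" "mon_degree m \<le> 2" using q by (auto simp: polys_upto_def)
    from quad_rep_single[OF V this, of "Poly_Mapping.lookup q m"] insert
    obtain c a b c' a' b' where "quad_rep V (?s m) c a b" "quad_rep V (\<Sum>m\<in>B. ?s m) c' a' b'" by blast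
    from quad_rep_add[OF this] insert show ?case by (auto simp: insert.hyps)
  qed
  from this[of "Poly_Mapping.keys q"] show ?thesis by (simp flip: poly_as_sum)
qed

section \<open>The pseudomoments of the Paley graph\<close>

context paley
begin

definition clique :: "int set \<Rightarrow> bool" where
  "clique K \<longleftrightarrow> (\<forall>x\<in>K. \<forall>y\<in>K. x \<noteq> y \<longrightarrow> chi (x - y) = 1)"

text \<open>The natural values 1, t, 2t^2, 8t^3, 64t^4 (as for independent vertices of a random graph) make
  the main part of the moment form only semidefinite; the larger constants leave room for the errors.\<close>

definition moment :: "real \<Rightarrow> int set \<Rightarrow> real" where
  "moment t K = (if clique K then [1, t, 4 * t\<^sup>2, 128 * t ^ 3, 16384 * t ^ 4] ! card K else 0)"

lemma paley_adj_iff: "paley_adj p i j \<longleftrightarrow> chi (i - j) = 1"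
  by (simp add: paley_adj_def chi_eq_1_iff cong_iff_dvd_diff)

lemma adj_eq: assumes "i \<in> F" "j \<in> F" shows "adj i j = of_bool (chi (i - j) = 1)"
proof (cases "i = j")
  case False
  then have "\<not> P dvd i - j" using F_eqI[of i j] assms by auto
  then have "chi (i - j) = 1 \<or> chi (i - j) = -1"
    using chi_square[of "i - j"] by (simp add: square_eq_1_iff)
  then show ?thesis using False by (auto simp: adj_def)
qed (simp add: adj_def)

lemma moment_1: "moment t {i} = t"
  by (simp add: moment_def clique_def)

lemma moment_2:
  assumes "i \<in> F" "j \<in> F"
  shows "moment t {i, j} = t * of_bool (j = i) + 4 * t\<^sup>2 * adj i j"
  unfolding adj_eq[OF assms]
  by (cases "i = j") (auto simp: moment_def clique_def card_insert_if numeral_2_eq_2 chi_commute[of j i])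

lemma moment_3:
  assumes "i \<in> F" "j \<in> F" "k \<in> F" "chi (j - k) = 1"
  shows "moment t {i, j, k} = 4 * t\<^sup>2 * of_bool (j = i) + 4 * t\<^sup>2 * of_bool (k = i) + 128 * t ^ 3 * (adj i j * adj i k)"
proof -
  have jk: "j \<noteq> k" using assms by auto
  note [simp] = adj_eq[OF assms(1,2)] adj_eq[OF assms(1,3)]
  consider "j = i" | "k = i" | "j \<noteq> i" "k \<noteq> i" by blast
  then show ?thesis
  proof cases
    case 1
    then show ?thesis using assms(4) jk
      by (auto simp: moment_def clique_def card_insert_if chi_commute[of k i] adj_def numeral_2_eq_2)
  next
    case 2
    then show ?thesis using assms(4) jk
      by (auto simp: moment_def clique_def card_insert_if chi_commute[of i j] adj_def numeral_2_eq_2)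
  next
    case 3
    then show ?thesis using assms(4) jk
      by (auto simp: moment_def clique_def card_insert_if chi_commute[of k j] chi_commute[of k i] chi_commute[of j i] numeral_3_eq_3)
  qed
qed

text \<open>Given the edges i j and k l, four distinct vertices form a clique iff the four cross
  pairs are edges. If the pairs share a vertex, the set has at most three elements and
  \<open>moment_3\<close> applies; \<open>adj\<close> being 0 on the diagonal keeps only the term of
  the right size.\<close>

lemma moment_4:
  assumes "i \<in> F" "j \<in> F" "k \<in> F" "l \<in> F" "chi (i - j) = 1" "chi (k - l) = 1"
  shows "moment t {i, j, k, l} = 4 * t\<^sup>2 * (of_bool (k = i \<and> l = j) + of_bool (l = i \<and> k = j))
    + 128 * t ^ 3 * (of_bool (k = i) * adj j l + of_bool (l = i) * adj j k + of_bool (k = j) * adj i l + of_bool (l = j) * adj i k)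
    + 16384 * t ^ 4 * (adj i k * adj i l * adj j k * adj j l)"
proof -
  have ij: "i \<noteq> j" "k \<noteq> l" using assms by auto
  have sym: "chi (j - i) = 1" "chi (l - k) = 1" using assms chi_commute by metis+
  have ii: "adj x x = 0" for x by (simp add: adj_def)
  have adj_c: "adj x y = adj y x" for x y by (simp add: adj_def chi_commute)
  show ?thesis
  proof (cases "k = i \<or> k = j \<or> l = i \<or> l = j")
    case True
    have m3: "moment t {x, j', k'} = 4 * t\<^sup>2 * of_bool (j' = x) + 4 * t\<^sup>2 * of_bool (k' = x) + 128 * t ^ 3 * (adj x j' * adj x k')"
      if "{x, j', k'} \<subseteq> F" "chi (j' - k') = 1" for x j' k'
      using that by (intro moment_3) auto
    have one: "adj i j = 1" "adj j i = 1" "adj k l = 1" "adj l k = 1"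
      using assms sym by (simp_all add: adj_eq)
    consider "k = i" | "k = j" | "l = i" | "l = j" using True by blast
    then show ?thesis
    proof cases
      case 1
      have "{i, j, k, l} = {j, k, l}" using 1 by auto
      then show ?thesis using m3[of j k l] assms 1 ij one ii by (auto simp: adj_c[of l j])
    next
      case 2
      have "{i, j, k, l} = {i, k, l}" using 2 by auto
      then show ?thesis using m3[of i k l] assms 2 ij one ii by (auto simp: adj_c[of l i])
    next
      case 3
      have "{i, j, k, l} = {j, k, l}" using 3 by auto
      then show ?thesis using m3[of j k l] assms 3 ij one ii by (auto simp: adj_c[of k j])
    next
      case 4
      have "{i, j, k, l} = {i, k, l}" using 4 by auto
      then show ?thesis using m3[of i k l] assms 4 ij one ii by (auto simp: adj_c[of k i])
    qed
  next
    case False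
    then have c4: "card {i, j, k, l} = 4" using ij by (auto simp: card_insert_if)
    have "clique {i, j, k, l} \<longleftrightarrow> chi (i - k) = 1 \<and> chi (i - l) = 1 \<and> chi (j - k) = 1 \<and> chi (j - l) = 1"
      using False ij assms(5,6) sym
      by (auto simp: clique_def chi_commute[of k i] chi_commute[of l i] chi_commute[of k j] chi_commute[of l j])
    then show ?thesis using False c4 assms(1-4) by (auto simp: moment_def adj_eq)
  qed
qed

lemma moment_nonadjacent:
  assumes "i \<noteq> j" "chi (i - j) \<noteq> 1" "i \<in> K" "j \<in> K"
  shows "moment t K = 0"
  using assms by (auto simp: moment_def clique_def)

lemma sum_F_of_bool:
  assumes "i \<in> F"
  shows "(\<Sum>x\<in>F. h x * of_bool (x = i)) = (h i :: real)"
proof -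
  have "(\<Sum>x\<in>F. h x * of_bool (x = i)) = (\<Sum>x\<in>F. if x = i then h x else 0)" by (intro sum.cong refl) simp
  then show ?thesis using assms by simp
qed

lemma pair_form_mult: "pair_form b (\<lambda>i j k l. r * G i j k l) = r * pair_form b G"
  by (simp add: pair_form_def sum_distrib_left mult_ac)

lemma pair_form_cong:
  assumes "\<And>i j k l. i \<in> F \<Longrightarrow> j \<in> F \<Longrightarrow> k \<in> F \<Longrightarrow> l \<in> F \<Longrightarrow> b (i, j) \<noteq> 0 \<Longrightarrow> b (k, l) \<noteq> 0 \<Longrightarrow> G i j k l = H i j k l"
  shows "pair_form b G = pair_form b H"
  unfolding pair_form_def
proof (intro sum.cong refl)
  fix i j k l assume "i \<in> F" "j \<in> F" "k \<in> F" "l \<in> F"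
  then show "b (i, j) * b (k, l) * G i j k l = b (i, j) * b (k, l) * H i j k l"
    using assms[of i j k l] by (cases "b (i, j) = 0 \<or> b (k, l) = 0") auto
qed

text \<open>By symmetry 8 = 2 * 4 counts the two ways for the pairs to coincide and 512 = 4 * 128
  the four ways to share a vertex.\<close>

lemma pair_form_moment:
  assumes sym: "\<And>x y. b (x, y) = b (y, x)" and edge: "\<And>x y. b (x, y) \<noteq> 0 \<Longrightarrow> chi (x - y) = 1"
  shows "pair_form b (\<lambda>i j k l. moment t {i, j, k, l}) = 8 * t\<^sup>2 * sq_norm b
    + 512 * t ^ 3 * (\<Sum>i\<in>F. \<Sum>j\<in>F. \<Sum>l\<in>F. b (i, j) * b (i, l) * adj j l)
    + 16384 * t ^ 4 * pair_form b (\<lambda>i j k l. adj i k * adj i l * adj j k * adj j l)"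
proof -
  let ?d = "\<lambda>i j k l. of_bool (k = i \<and> l = j) :: real"
  let ?d' = "\<lambda>i j k l. of_bool (l = i \<and> k = j) :: real"
  let ?g = "\<lambda>i j k l. of_bool (k = i) * adj j l"
  let ?g2 = "\<lambda>i j k l. of_bool (l = i) * adj j k"
  let ?g3 = "\<lambda>i j k l. of_bool (k = j) * adj i l"
  let ?g4 = "\<lambda>i j k l. of_bool (l = j) * adj i k"
  have "pair_form b (\<lambda>i j k l. moment t {i, j, k, l}) = pair_form b (\<lambda>i j k l. 4 * t\<^sup>2 * (?d i j k l + ?d' i j k l)
    + 128 * t ^ 3 * (?g i j k l + ?g2 i j k l + ?g3 i j k l + ?g4 i j k l)
    + 16384 * t ^ 4 * (adj i k * adj i l * adj j k * adj j l))"
    by (rule pair_form_cong) (intro moment_4 edge)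
  also have "\<dots> = 4 * t\<^sup>2 * (pair_form b ?d + pair_form b ?d') + 128 * t ^ 3 * (pair_form b ?g + pair_form b ?g2 + pair_form b ?g3 + pair_form b ?g4)
    + 16384 * t ^ 4 * pair_form b (\<lambda>i j k l. adj i k * adj i l * adj j k * adj j l)"
    unfolding pair_form_add pair_form_mult ..
  also have "pair_form b ?d' = pair_form b ?d" by (rule pair_form_swap34[of b, OF sym])
  also have "pair_form b ?g2 = pair_form b ?g" by (rule pair_form_swap34[of b, OF sym])
  also have "pair_form b ?g4 = pair_form b ?g3" by (rule pair_form_swap34[of b, OF sym])
  also have "pair_form b ?g3 = pair_form b ?g" by (rule pair_form_swap12[of b, OF sym])
  also have "pair_form b ?d = sq_norm b"
  proof -
    have "pair_form b ?d = (\<Sum>i\<in>F. \<Sum>j\<in>F. \<Sum>k\<in>F. \<Sum>l\<in>F. b (i, j) * b (k, l) * of_bool (k = i) * of_bool (l = j))"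
      unfolding pair_form_def by (intro sum.cong refl) (simp add: of_bool_conj)
    also have "\<dots> = (\<Sum>i\<in>F. \<Sum>j\<in>F. b (i, j) * b (i, j))"
      by (intro sum.cong refl) (simp only: sum_F_of_bool)
    finally show ?thesis by (simp add: sq_norm_def sum_FF power2_eq_square)
  qed
  also have "pair_form b ?g = (\<Sum>i\<in>F. \<Sum>j\<in>F. \<Sum>l\<in>F. b (i, j) * b (i, l) * adj j l)"
  proof -
    have "pair_form b ?g = (\<Sum>i\<in>F. \<Sum>j\<in>F. \<Sum>l\<in>F. \<Sum>k\<in>F. b (i, j) * b (k, l) * (of_bool (k = i) * adj j l))"
      unfolding pair_form_def by (rule sum.cong[OF refl], rule sum.cong[OF refl], rule sum.swap)
    also have "\<dots> = (\<Sum>i\<in>F. \<Sum>j\<in>F. \<Sum>l\<in>F. \<Sum>k\<in>F. (b (i, j) * b (k, l) * adj j l) * of_bool (k = i))"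
      by (intro sum.cong refl) (simp add: mult_ac)
    also have "\<dots> = (\<Sum>i\<in>F. \<Sum>j\<in>F. \<Sum>l\<in>F. b (i, j) * b (i, l) * adj j l)"
      by (intro sum.cong refl) (simp only: sum_F_of_bool)
    finally show ?thesis .
  qed
  finally show ?thesis by simp
qed

text \<open>Moments vanish on sets containing a non-edge, so \<open>b0\<close> can be restricted to
  edges, where the formulas for the moments hold; reduction mod p makes it periodic, as the bound
  for T requires.\<close>

lemma pseudo_ev_moment_square:
  assumes rep: "quad_rep F q c a b0"
  defines "b \<equiv> (\<lambda>(x, y). if chi (x - y) = 1 then b0 (x mod P, y mod P) else 0)"
  shows "pseudo_ev (moment t) (q * q) = c\<^sup>2 + 2 * c * (t * (\<Sum>i\<in>F. a i)) + 2 * c * (4 * t\<^sup>2 * (\<Sum>q\<in>FF. b q))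
    + (t * (\<Sum>i\<in>F. (a i)\<^sup>2) + 4 * t\<^sup>2 * (\<Sum>i\<in>F. \<Sum>j\<in>F. a i * a j * adj i j))
    + 2 * (8 * t\<^sup>2 * (\<Sum>i\<in>F. a i * (\<Sum>j\<in>F. b (i, j)))
        + 128 * t ^ 3 * (\<Sum>i\<in>F. \<Sum>j\<in>F. \<Sum>k\<in>F. a i * b (j, k) * (adj i j * adj i k)))
    + (8 * t\<^sup>2 * sq_norm b + 512 * t ^ 3 * (\<Sum>i\<in>F. \<Sum>j\<in>F. \<Sum>l\<in>F. b (i, j) * b (i, l) * adj j l)
        + 16384 * t ^ 4 * pair_form b (\<lambda>i j k l. adj i k * adj i l * adj j k * adj j l))"
proof -
  have sym0: "b0 (x, y) = b0 (y, x)" and diag0: "b0 (x, x) = 0" for x y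
    using rep by (auto simp: quad_rep_def)
  have pseudo_ev_q: "pseudo_ev \<Phi> q = c * \<Phi> {} + (\<Sum>i\<in>F. a i * \<Phi> {i}) + (\<Sum>i\<in>F. \<Sum>j\<in>F. b0 (i, j) * \<Phi> {i, j})" for \<Phi>
    using rep by (auto simp: quad_rep_def)
  have sym: "b (x, y) = b (y, x)" for x y by (simp add: b_def sym0 chi_commute[of y x])
  have edge: "b (x, y) \<noteq> 0 \<Longrightarrow> chi (x - y) = 1" for x y by (simp add: b_def split: if_splits)
  have to_edges: "b0 (i, j) * s = b (i, j) * s"
    if "i \<in> F" "j \<in> F" "i \<noteq> j \<Longrightarrow> chi (i - j) \<noteq> 1 \<Longrightarrow> s = 0" for i j s
    using that by (cases "i = j") (auto simp: b_def diag0)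
  \<comment> \<open>The value at q times a monomial with support K. It vanishes when K contains a
    non-edge, so the restriction to edges works for both factors of q * q.\<close>
  define g where "g K = c * moment t K + (\<Sum>i\<in>F. a i * moment t (K \<union> {i})) + (\<Sum>i\<in>F. \<Sum>j\<in>F. b (i, j) * moment t (K \<union> {i, j}))" for K
  have g: "pseudo_ev (\<lambda>K'. moment t (K \<union> K')) q = g K" for K
    unfolding pseudo_ev_q g_def using moment_nonadjacent
    by (intro arg_cong2[of _ _ _ _ "(+)"] sum.cong refl to_edges) auto
  have g0: "g K = 0" if "i \<noteq> j" "chi (i - j) \<noteq> 1" "i \<in> K" "j \<in> K" for i j K
    using moment_nonadjacent[OF that(1,2)] that(3,4) by (simp add: g_def)
  have "pseudo_ev (moment t) (q * q) = pseudo_ev g q" by (simp add: pseudo_ev_mult g)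
  also have "\<dots> = c * g {} + (\<Sum>i\<in>F. a i * g {i}) + (\<Sum>i\<in>F. \<Sum>j\<in>F. b (i, j) * g {i, j})"
    unfolding pseudo_ev_q using g0 by (intro arg_cong2[of _ _ _ _ "(+)"] sum.cong refl to_edges) auto
  finally have main: "pseudo_ev (moment t) (q * q) = \<dots>" .
  let ?s = "\<Sum>i\<in>F. a i" and ?B = "\<Sum>q\<in>FF. b q"
  let ?M = "\<Sum>i\<in>F. \<Sum>j\<in>F. \<Sum>k\<in>F. a i * b (j, k) * moment t {i, j, k}"
  have bm: "(\<Sum>i\<in>F. \<Sum>j\<in>F. b (i, j) * moment t {i, j}) = 4 * t\<^sup>2 * ?B"
  proof -
    have "b (i, j) * moment t {i, j} = 4 * t\<^sup>2 * b (i, j)" if "i \<in> F" "j \<in> F" for i j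
      using that edge[of i j] by (cases "b (i, j) = 0") (auto simp: moment_2 adj_eq)
    then have "(\<Sum>i\<in>F. \<Sum>j\<in>F. b (i, j) * moment t {i, j}) = (\<Sum>i\<in>F. \<Sum>j\<in>F. 4 * t\<^sup>2 * b (i, j))"
      by (intro sum.cong refl)
    then show ?thesis by (simp add: sum_FF sum_distrib_left)
  qed
  have p0: "c * g {} = c\<^sup>2 + c * (t * ?s) + c * (4 * t\<^sup>2 * ?B)"
  proof -
    have "moment t {} = 1" by (simp add: moment_def clique_def)
    then have "g {} = c + t * ?s + 4 * t\<^sup>2 * ?B"
      using bm by (simp add: g_def moment_1 sum_distrib_left mult.commute)
    then show ?thesis by (simp add: power2_eq_square ring_distribs)
  qed
  have p1: "(\<Sum>i\<in>F. a i * g {i}) = c * (t * ?s) + (\<Sum>i\<in>F. \<Sum>j\<in>F. a i * a j * moment t {i, j}) + ?M"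
    by (simp add: g_def moment_1 ring_distribs sum.distrib sum_distrib_left mult_ac insert_commute)
  have p2: "(\<Sum>i\<in>F. \<Sum>j\<in>F. b (i, j) * g {i, j}) = c * (4 * t\<^sup>2 * ?B) + ?M + pair_form b (\<lambda>i j k l. moment t {i, j, k, l})"
  proof -
    have "(\<Sum>i\<in>F. \<Sum>j\<in>F. b (i, j) * g {i, j}) = c * (\<Sum>i\<in>F. \<Sum>j\<in>F. b (i, j) * moment t {i, j})
        + (\<Sum>i\<in>F. \<Sum>j\<in>F. \<Sum>k\<in>F. a k * b (i, j) * moment t {k, i, j}) + pair_form b (\<lambda>i j k l. moment t {i, j, k, l})"
      by (simp add: g_def pair_form_def ring_distribs sum.distrib sum_distrib_left mult_ac insert_commute)
    also have "(\<Sum>i\<in>F. \<Sum>j\<in>F. \<Sum>k\<in>F. a k * b (i, j) * moment t {k, i, j}) = (\<Sum>i\<in>F. \<Sum>k\<in>F. \<Sum>j\<in>F. a k * b (i, j) * moment t {k, i, j})"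
      by (rule sum.cong[OF refl], rule sum.swap)
    also have "\<dots> = ?M" by (rule sum.swap)
    finally show ?thesis by (simp only: bm)
  qed
  have aa: "(\<Sum>i\<in>F. \<Sum>j\<in>F. a i * a j * moment t {i, j})
      = t * (\<Sum>i\<in>F. (a i)\<^sup>2) + 4 * t\<^sup>2 * (\<Sum>i\<in>F. \<Sum>j\<in>F. a i * a j * adj i j)"
  proof -
    have "(\<Sum>i\<in>F. \<Sum>j\<in>F. a i * a j * moment t {i, j})
        = (\<Sum>i\<in>F. (\<Sum>j\<in>F. (t * a i * a j) * of_bool (j = i)) + (\<Sum>j\<in>F. 4 * t\<^sup>2 * (a i * a j * adj i j)))"
      unfolding sum.distrib[symmetric]
      by (intro sum.cong refl) (simp add: moment_2 ring_distribs mult_ac del: atLeastLessThan_iff)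
    also have "\<dots> = (\<Sum>i\<in>F. t * a i * a i + (\<Sum>j\<in>F. 4 * t\<^sup>2 * (a i * a j * adj i j)))"
      by (intro sum.cong refl) (simp only: sum_F_of_bool)
    finally show ?thesis by (simp add: sum.distrib power2_eq_square sum_distrib_left mult.assoc)
  qed
  have M: "?M = 8 * t\<^sup>2 * (\<Sum>i\<in>F. a i * (\<Sum>j\<in>F. b (i, j)))
      + 128 * t ^ 3 * (\<Sum>i\<in>F. \<Sum>j\<in>F. \<Sum>k\<in>F. a i * b (j, k) * (adj i j * adj i k))"
  proof -
    have pt: "a i * b (j, k) * moment t {i, j, k} = (4 * t\<^sup>2 * a i * b (j, k)) * of_bool (j = i)
        + (4 * t\<^sup>2 * a i * b (j, k)) * of_bool (k = i) + 128 * t ^ 3 * (a i * b (j, k) * (adj i j * adj i k))"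
      if "i \<in> F" "j \<in> F" "k \<in> F" for i j k
    proof (cases "b (j, k) = 0")
      case False
      then show ?thesis unfolding moment_3[OF that edge[OF False]] by (simp add: ring_distribs mult_ac)
    qed simp
    have "?M = (\<Sum>i\<in>F. \<Sum>j\<in>F. \<Sum>k\<in>F. (4 * t\<^sup>2 * a i * b (j, k)) * of_bool (j = i)
        + (4 * t\<^sup>2 * a i * b (j, k)) * of_bool (k = i) + 128 * t ^ 3 * (a i * b (j, k) * (adj i j * adj i k)))"
      by (intro sum.cong refl pt)
    also have "\<dots> = (\<Sum>i\<in>F. \<Sum>j\<in>F. \<Sum>k\<in>F. (4 * t\<^sup>2 * a i * b (j, k)) * of_bool (j = i))
        + (\<Sum>i\<in>F. \<Sum>j\<in>F. \<Sum>k\<in>F. (4 * t\<^sup>2 * a i * b (j, k)) * of_bool (k = i))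
        + 128 * t ^ 3 * (\<Sum>i\<in>F. \<Sum>j\<in>F. \<Sum>k\<in>F. a i * b (j, k) * (adj i j * adj i k))"
      by (simp only: sum.distrib sum_distrib_left)
    also have "(\<Sum>i\<in>F. \<Sum>j\<in>F. \<Sum>k\<in>F. (4 * t\<^sup>2 * a i * b (j, k)) * of_bool (j = i))
        = (\<Sum>i\<in>F. \<Sum>j\<in>F. (\<Sum>k\<in>F. 4 * t\<^sup>2 * a i * b (j, k)) * of_bool (j = i))"
      by (simp only: sum_distrib_right)
    also have "\<dots> = (\<Sum>i\<in>F. \<Sum>k\<in>F. 4 * t\<^sup>2 * a i * b (i, k))"
      by (rule sum.cong[OF refl]) (simp only: sum_F_of_bool)
    also have "(\<Sum>i\<in>F. \<Sum>j\<in>F. \<Sum>k\<in>F. (4 * t\<^sup>2 * a i * b (j, k)) * of_bool (k = i)) = (\<Sum>i\<in>F. \<Sum>j\<in>F. 4 * t\<^sup>2 * a i * b (i, j))"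
      by (intro sum.cong refl) (simp only: sum_F_of_bool sym)
    finally show ?thesis by (simp add: sum_distrib_left mult_ac)
  qed
  have bb: "pair_form b (\<lambda>i j k l. moment t {i, j, k, l}) = 8 * t\<^sup>2 * sq_norm b
      + 512 * t ^ 3 * (\<Sum>i\<in>F. \<Sum>j\<in>F. \<Sum>l\<in>F. b (i, j) * b (i, l) * adj j l)
      + 16384 * t ^ 4 * pair_form b (\<lambda>i j k l. adj i k * adj i l * adj j k * adj j l)"
    using sym edge by (rule pair_form_moment)
  show ?thesis
    unfolding main p0 p1 p2 aa M bb by (simp add: algebra_simps)
qed

text \<open>Singletons are cliques, so the objective is p t. Attainment of the maximum shows that
  the supremum bounds every feasible value.\<close>

lemma SOS4_paley_ge:
  assumes t: "0 < t" and t1: "t * fourth_root_p\<^sup>2 \<le> 1 / 20000" and t2: "t ^ 3 * (fourth_root_p ^ 4)\<^sup>2 \<le> (1 / 20000)\<^sup>2"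
    and t3: "t\<^sup>2 * fourth_root_p ^ 5 \<le> 1 / 20000"
  shows "SOS4 (paley_vertices p) (paley_adj p) \<ge> real p * t"
proof -
  have V: "paley_vertices p = F" by (simp add: paley_vertices_def)
  have "sos4_feasible F (paley_adj p) (pseudo_ev (moment t))"
    unfolding sos4_feasible_def linear_functional_upto_def
  proof (intro conjI ballI allI impI)
    show "pseudo_ev (moment t) 1 = 1" by (simp add: pseudo_ev_1 moment_def clique_def)
  next
    fix i j :: int and q :: "int mpoly" assume "i \<noteq> j \<and> \<not> paley_adj p i j"
    then have "moment t (insert i (insert j K)) = 0" for K
      using moment_nonadjacent[of i j] by (simp add: paley_adj_iff)
    then show "pseudo_ev (moment t) (var_poly i * var_poly j * q) = 0"
      by (simp add: mult.assoc pseudo_ev_var_mult) (simp add: pseudo_ev_def)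
  next
    fix q :: "int mpoly" assume "q \<in> polys_upto F 2"
    then obtain c a b0 where rep: "quad_rep F q c a b0"
      using quad_rep_exists[of F q] by auto
    let ?b = "\<lambda>(x, y). if chi (x - y) = 1 then b0 (x mod P, y mod P) else 0"
    have per: "periodic2 ?b"
    proof (rule periodic2I)
      fix x x' y y' assume xy: "P dvd x - x'" "P dvd y - y'"
      then have "P dvd (x - x') - (y - y')" by (rule dvd_diff)
      then have "chi (x - y) = chi (x' - y')" by (intro chi_cong) (simp add: algebra_simps)
      moreover have "x mod P = x' mod P" "y mod P = y' mod P" using xy by (simp_all add: mod_eq_dvd_iff)
      ultimately show "?b (x, y) = ?b (x', y')" by simp
    qed
    have "0 \<le> pseudo_ev (moment t) (q * q)"
      unfolding pseudo_ev_moment_square[OF rep]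
    proof (rule quad_form_nonneg[OF _ per _ t t1 t2 t3])
      show "?b (x, y) = ?b (y, x)" for x y
        using rep by (simp add: quad_rep_def chi_commute[of y x])
    qed simp
    then show "0 \<le> pseudo_ev (moment t) (q ^ 2)" by (simp add: power2_eq_square)
  qed (simp_all add: pseudo_ev_add pseudo_ev_const_mult pseudo_ev_boolean)
  moreover obtain E where "\<And>E'. sos4_feasible F (paley_adj p) E' \<Longrightarrow> (\<Sum>i\<in>F. E' (var_poly i)) \<le> SOS4 F (paley_adj p)"
    using SOS4_is_maximum[of F "paley_adj p"] by blast
  ultimately have "(\<Sum>i\<in>F. pseudo_ev (moment t) (var_poly i)) \<le> SOS4 F (paley_adj p)" by blast
  then show ?thesis unfolding V by (simp add: pseudo_ev_var moment_1)
qed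

end

theorem theorem1p1:
  shows "\<exists>c::real. c > 0 \<and>
    (\<forall>p::nat. prime p \<and> [p = 1] (mod 4) \<longrightarrow>
       SOS4 (paley_vertices p) (paley_adj p) \<ge> c * real p powr (1 / 3))"
proof (intro exI[of _ "1 / 20000 :: real"] conjI allI impI)
  fix p :: nat assume "prime p \<and> [p = 1] (mod 4)"
  then interpret paley p by unfold_locales auto
  \<comment> \<open>The largest order allowed by t^3 p^2 bounded; p t is then p^(1/3) /
    20000.\<close>
  define t where "t = 1 / 20000 * real p powr (- 2 / 3)"
  have p: "real p > 0" using p_ge_5 by simp
  have t: "0 < t" using p by (simp add: t_def)
  have "(real p powr (- 2 / 3)) ^ 3 = real p powr (- 2)"
    by (simp add: power3_eq_cube flip: powr_add)
  moreover have "real p powr (- 2) * (real p)\<^sup>2 = real p powr (- 2 + 2)"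
    using p by (simp only: powr_add powr_numeral)
  moreover have "fourth_root_p ^ 8 = (real p)\<^sup>2" by (simp flip: fourth_root_p_pow4 power_mult)
  ultimately have cube: "t ^ 3 * fourth_root_p ^ 8 = (1 / 20000) ^ 3"
    using p by (simp only: t_def power_mult_distrib mult.assoc) simp
  have fourth_root_p: "1 \<le> fourth_root_p" by (rule fourth_root_p_ge_1)
  have t1: "t * fourth_root_p\<^sup>2 \<le> 1 / 20000"
  \<comment> \<open>Compared as cubes (\<open>n = 2\<close> stands for the exponent
    \<open>Suc 2\<close>), where the identity \<open>cube\<close> applies because 6 <= 8.\<close>
  proof (rule power_le_imp_le_base[where n = 2])
    have "(t * fourth_root_p\<^sup>2) ^ 3 = t ^ 3 * fourth_root_p ^ 6" by (simp add: power_mult_distrib flip: power_mult)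
    also have "\<dots> \<le> t ^ 3 * fourth_root_p ^ 8" using t fourth_root_p by (intro mult_left_mono power_increasing) auto
    finally show "(t * fourth_root_p\<^sup>2) ^ Suc 2 \<le> (1 / 20000) ^ Suc 2" using cube by simp
  qed simp
  have t2: "t ^ 3 * (fourth_root_p ^ 4)\<^sup>2 \<le> (1 / 20000)\<^sup>2"
    using cube by (simp add: power_divide flip: power_mult)
  have t3: "t\<^sup>2 * fourth_root_p ^ 5 \<le> 1 / 20000"
  \<comment> \<open>Again by cubes, now with the square of \<open>cube\<close>: 15 <= 16 is the
    small room left by p^(5/4) below p^(4/3).\<close>
  proof (rule power_le_imp_le_base[where n = 2])
    have "(t\<^sup>2 * fourth_root_p ^ 5) ^ 3 = t ^ 6 * fourth_root_p ^ 15" by (simp add: power_mult_distrib flip: power_mult)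
    also have "\<dots> \<le> t ^ 6 * fourth_root_p ^ 16" using t fourth_root_p by (intro mult_left_mono power_increasing) auto
    also have "\<dots> = (t ^ 3 * fourth_root_p ^ 8) ^ 2" by (simp add: power_mult_distrib flip: power_mult)
    also have "\<dots> \<le> (1 / 20000) ^ 3" unfolding cube by (simp add: power_divide)
    finally show "(t\<^sup>2 * fourth_root_p ^ 5) ^ Suc 2 \<le> (1 / 20000) ^ Suc 2" by simp
  qed simp
  have "real p * t = 1 / 20000 * (real p powr 1 * real p powr (- 2 / 3))" using p by (simp add: t_def)
  also have "real p powr 1 * real p powr (- 2 / 3) = real p powr (1 + - 2 / 3)" by (rule powr_add[symmetric])
  also have "1 + - 2 / 3 = (1 / 3 :: real)" by simp
  finally show "1 / 20000 * real p powr (1 / 3) \<le> SOS4 (paley_vertices p) (paley_adj p)"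
    using SOS4_paley_ge[OF t t1 t2 t3] by simp
qed simp

end
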